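(* Let $K$ be a field, $E=(E^0,E^1,r,s)$ a directed graph, $\mathbb{F}$ the free group generated by $E^1$, and $D_0\rtimes_\alpha\mathbb{F}$ the partial skew group ring associated to $E$ (which is isomorphic to the Leavitt path algebra $L_K(E)$). Then $D_0\rtimes_\alpha\mathbb{F}$ is simple if and only if the graph $E$ satisfies condition (L) and the only hereditary and saturated subsets of $E^0$ are $\emptyset$ and $E^0$.
   Context: Graph conventions. $E^0$ is the set of vertices, $E^1$ the set of edges, $r,s:E^1\to E^0$ the range and source maps. $W$ is the set of finite paths $\xi=\xi_1\cdots\xi_n$ ($n\ge1$, $\xi_i\in E^1$, $r(\xi_i)=s(\xi_{i+1})$), with length $|\xi|=n$, $s(\xi)=s(\xi_1)$, $r(\xi)=r(\xi_n)$; $W^\infty$ is the set of infinite paths $\xi_1\xi_2\cdots$, with $s(\xi)=s(\xi_1)$; for a vertex $v$, $s(v)=r(v)=v$. A sink is a vertex $v$ with $s^{-1}(v)=\emptyset$. Condition (L): every closed path has an exit, i.e. for every $t=t_1\cdots t_m\in W$ with $s(t)=r(t)$ there are $i$ and an edge $f\neq t_i$ with $s(f)=s(t_i)$. A set $H\subseteq E^0$ is hereditary if for all $e\in E^1$, $s(e)\in H$ implies $r(e)\in H$. A hereditary set $H\subseteq E^0$ is saturated if for every $v\in E^0$ with $0<\#s^{-1}(v)<\infty$, $\{r(e):e\in E^1,\ s(e)=v\}\subseteq H$ implies $v\in H$. The partial action. Let $X=\{\xi\in W:r(\xi)\text{ is a sink}\}\cup\{v\in E^0:v\text{ is a sink}\}\cup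 W^\infty$. Let $\mathbb{F}$ be the free group on $E^1$, with neutral element denoted $0$. Paths in $W$ are regarded as elements of $\mathbb{F}$. Define $X_0=X$; $X_{b^{-1}}=\{\xi\in X:s(\xi)=r(b)\}$ for $b\in W$; $X_a=\{\xi\in X:\xi_1\cdots\xi_{|a|}=a\}$ for $a\in W$; $X_{ab^{-1}}=X_a$ for $a,b\in W$ with $r(a)=r(b)$ and $ab^{-1}$ in reduced form; $X_c=\emptyset$ for all other $c\in\mathbb{F}$. Define bijections $\theta_c:X_{c^{-1}}\to X_c$: $\theta_0=\mathrm{id}$; $\theta_b(\xi)=b\xi$ for $b\in W$ (with $\theta_b(r(b))=b$ if $r(b)$ is a sink), and $\theta_{b^{-1}}$ its inverse, which removes the initial segment $b$ (with $\theta_{b^{-1}}(b)=r(b)$ if $r(b)$ is a sink); for $a,b\in W$ with $r(a)=r(b)$ and $ab^{-1}$ reduced, $\theta_{ab^{-1}}(\xi)=a\xi_{|b|+1}\xi_{|b|+2}\cdots$ (replace the initial segment $b$ by $a$); $\theta_c$ is the empty map otherwise. For $c\in\mathbb{F}$ let $F(X_c)$ be the algebra of all functions $X_c\to K$ (identified with the functions $X\to K$ vanishing outside $X_c$), and $\alpha_c:F(X_{c^{-1}})\to F(X_c)$, $\alpha_c(f)=f\circ\theta_{c^{-1}}$. Let $1_c=\chi_{X_c}$ for $c\in\mathbb{F}$, and $1_v=\chi_{X_v}$ with $X_v=\{\xi\in X:s(\xi)=v\}$ for $v\in E^0$. Let $D_0$ be the $K$-linear span of $\{1_p:p\in\mathbb{F}\setminus\{0\}\}\cup\{1_v:v\in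 E^0\}$ (a commutative $K$-algebra under pointwise operations), and for $p\in\mathbb{F}\setminus\{0\}$ let $D_p=1_pD_0$, which equals the $K$-linear span of $\{1_p1_q:q\in\mathbb{F}\}$. The maps $\alpha_p$ satisfy $\alpha_p(1_{p^{-1}}1_q)=1_p1_{pq}$ and restrict to $K$-algebra isomorphisms $\alpha_p:D_{p^{-1}}\to D_p$, giving a partial action $\alpha$ of $\mathbb{F}$ on $D_0$ by ideals $D_p$. The partial skew group ring $D_0\rtimes_\alpha\mathbb{F}$ is the set of finite formal sums $\sum_{t\in\mathbb{F}}a_t\delta_t$ with $a_t\in D_t$, with componentwise addition and multiplication determined by $(a_t\delta_t)(b_s\delta_s)=\alpha_t(\alpha_{t^{-1}}(a_t)b_s)\delta_{ts}$. A ring $R$ is simple if $\{0\}$ and $R$ are its only two-sided ideals. *)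

theory Defs
  imports
    "HOL-Algebra.Ideal"
    "HOL-Library.Function_Algebras"
    "HOL-Library.Indicator_Function"
    "HOL-Library.Stream"
    "Graph_Theory.Arc_Walk"
begin

section \<open>The free group on a set\<close>

text \<open>
  The letter \<open>(x, True)\<close> stands for the generator \<open>x\<close> and \<open>(x, False)\<close> for its inverse.
  The free group consists of the reduced words.
\<close>

type_synonym 'e word = "('e \<times> bool) list"

definition cancels :: "'e \<times> bool \<Rightarrow> 'e \<times> bool \<Rightarrow> bool" where
  "cancels x y \<longleftrightarrow> fst x = fst y \<and> snd x \<noteq> snd y"

definition reduced :: "'e word \<Rightarrow> bool" where
  "reduced w \<longleftrightarrow> successively (\<lambda>x y. \<not> cancels x y) w"

fun lmult :: "'e \<times> bool \<Rightarrow> 'e word \<Rightarrow> 'e word" where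
  "lmult x [] = [x]"
| "lmult x (y # w) = (if cancels x y then w else x # y # w)"

definition free_group :: "'e set \<Rightarrow> 'e word monoid" where
  "free_group S = \<lparr> carrier = {w. reduced w \<and> fst ` set w \<subseteq> S}, mult = foldr lmult, one = [] \<rparr>"

definition inv_word :: "'e word \<Rightarrow> 'e word" where
  "inv_word w = rev (map (\<lambda>(x, b). (x, \<not> b)) w)"

lemma reduced_Nil [simp]: "reduced []"
  by (simp add: reduced_def)

lemma reduced_Cons:
  "reduced (x # w) \<longleftrightarrow> reduced w \<and> (w \<noteq> [] \<longrightarrow> \<not> cancels x (hd w))"
  by (cases w) (auto simp: reduced_def)

lemma reduced_lmult: "reduced w \<Longrightarrow> reduced (lmult x w)"
  by (cases w) (auto simp: reduced_Cons)

lemma reduced_foldr_lmult: "reduced w \<Longrightarrow> reduced (foldr lmult u w)"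
  by (induction u) (auto intro: reduced_lmult)

lemma set_lmult: "set (lmult x w) \<subseteq> insert x (set w)"
  by (cases w) auto

lemma set_foldr_lmult: "set (foldr lmult u w) \<subseteq> set u \<union> set w"
proof (induction u)
  case (Cons x u)
  then show ?case using set_lmult[of x "foldr lmult u w"] by auto
qed simp

lemma lmult_lmult_cancel: "reduced w \<Longrightarrow> cancels x y \<Longrightarrow> lmult x (lmult y w) = w"
  by (cases w rule: remdups_adj.cases)
    (auto simp: cancels_def reduced_Cons prod_eq_iff)

lemma foldr_lmult_lmult:
  "reduced w \<Longrightarrow> foldr lmult (lmult x v) w = lmult x (foldr lmult v w)"
  by (cases v) (auto simp: lmult_lmult_cancel reduced_foldr_lmult)

lemma foldr_lmult_assoc:
  "reduced w \<Longrightarrow> foldr lmult (foldr lmult u v) w = foldr lmult u (foldr lmult v w)"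
  by (induction u) (auto simp: foldr_lmult_lmult)

lemma foldr_lmult_Nil: "reduced w \<Longrightarrow> foldr lmult w [] = w"
proof (induction w)
  case (Cons x w)
  then show ?case by (cases w) (auto simp: reduced_Cons)
qed simp

lemma foldr_lmult_inv_word: "reduced v \<Longrightarrow> foldr lmult (inv_word w) (foldr lmult w v) = v"
  by (induction w arbitrary: v)
    (auto simp: inv_word_def lmult_lmult_cancel reduced_foldr_lmult cancels_def)

lemma reduced_inv_word: "reduced w \<Longrightarrow> reduced (inv_word w)"
  unfolding reduced_def inv_word_def
  by (auto simp: successively_rev successively_map cancels_def case_prod_beta elim!: successively_mono)

lemma set_inv_word: "fst ` set (inv_word w) = fst ` set w"
  by (force simp: inv_word_def)

lemma group_free_group: "group (free_group S)"
proof (rule groupI)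
  fix u assume "u \<in> carrier (free_group S)"
  then have "inv_word u \<in> carrier (free_group S)"
      "inv_word u \<otimes>\<^bsub>free_group S\<^esub> u = \<one>\<^bsub>free_group S\<^esub>"
    using foldr_lmult_inv_word[of "[]" u] set_inv_word[of u]
    by (auto simp: free_group_def reduced_inv_word foldr_lmult_Nil)
  then show "\<exists>v\<in>carrier (free_group S). v \<otimes>\<^bsub>free_group S\<^esub> u = \<one>\<^bsub>free_group S\<^esub>"
    by blast
next
  fix u v assume uv: "u \<in> carrier (free_group S)" "v \<in> carrier (free_group S)"
  have "fst ` set (foldr lmult u v) \<subseteq> fst ` (set u \<union> set v)"
    by (rule image_mono[OF set_foldr_lmult])
  also have "\<dots> \<subseteq> S"
    using uv by (auto simp: free_group_def)
  finally show "u \<otimes>\<^bsub>free_group S\<^esub> v \<in> carrier (free_group S)"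
    using uv by (simp add: free_group_def reduced_foldr_lmult)
qed (auto simp: free_group_def foldr_lmult_assoc)

lemma inv_free_group:
  assumes "u \<in> carrier (free_group S)"
  shows "inv\<^bsub>free_group S\<^esub> u = inv_word u"
proof (rule group.inv_equality[OF group_free_group])
  show "inv_word u \<otimes>\<^bsub>free_group S\<^esub> u = \<one>\<^bsub>free_group S\<^esub>"
    using assms foldr_lmult_inv_word[of "[]" u] by (auto simp: free_group_def foldr_lmult_Nil)
  show "inv_word u \<in> carrier (free_group S)"
    using assms set_inv_word[of u] by (auto simp: free_group_def reduced_inv_word)
qed (use assms in auto)

lemma inv_word_inv_word [simp]: "inv_word (inv_word w) = w"
  by (induction w) (auto simp: inv_word_def)

section \<open>Paths, condition (L), hereditary and saturated sets\<close>

text \<open>The source map is \<open>tail G\<close> and the range map is \<open>head G\<close>.\<close>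

definition fpaths :: "('v, 'e) pre_digraph \<Rightarrow> 'e list set" where
  "fpaths G = {p. p \<noteq> [] \<and> (\<exists>u v. pre_digraph.awalk G u p v)}"

definition psource :: "('v, 'e) pre_digraph \<Rightarrow> 'e list \<Rightarrow> 'v" where
  "psource G p = tail G (hd p)"

definition prange :: "('v, 'e) pre_digraph \<Rightarrow> 'e list \<Rightarrow> 'v" where
  "prange G p = head G (last p)"

definition sink :: "('v, 'e) pre_digraph \<Rightarrow> 'v \<Rightarrow> bool" where
  "sink G v \<longleftrightarrow> v \<in> verts G \<and> out_arcs G v = {}"

definition condition_L :: "('v, 'e) pre_digraph \<Rightarrow> bool" where
  "condition_L G \<longleftrightarrow>
    (\<forall>t\<in>fpaths G. psource G t = prange G t \<longrightarrow>
      (\<exists>i<length t. \<exists>f\<in>arcs G. f \<noteq> t ! i \<and> tail G f = tail G (t ! i)))"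

definition hereditary :: "('v, 'e) pre_digraph \<Rightarrow> 'v set \<Rightarrow> bool" where
  "hereditary G H \<longleftrightarrow> H \<subseteq> verts G \<and> (\<forall>e\<in>arcs G. tail G e \<in> H \<longrightarrow> head G e \<in> H)"

definition saturated :: "('v, 'e) pre_digraph \<Rightarrow> 'v set \<Rightarrow> bool" where
  "saturated G H \<longleftrightarrow>
    (\<forall>v\<in>verts G. out_arcs G v \<noteq> {} \<and> finite (out_arcs G v) \<longrightarrow>
      head G ` out_arcs G v \<subseteq> H \<longrightarrow> v \<in> H)"

section \<open>The partial action on the boundary paths\<close>

datatype ('v, 'e) bpath = Vtx 'v | Fin "'e list" | Inf "'e stream"

definition bpaths :: "('v, 'e) pre_digraph \<Rightarrow> ('v, 'e) bpath set" where
  "bpaths G =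
    {Fin p | p. p \<in> fpaths G \<and> sink G (prange G p)} \<union>
    {Vtx v | v. sink G v} \<union>
    {Inf w | w. sset w \<subseteq> arcs G \<and> (\<forall>i. head G (w !! i) = tail G (w !! Suc i))}"

fun bsource :: "('v, 'e) pre_digraph \<Rightarrow> ('v, 'e) bpath \<Rightarrow> 'v" where
  "bsource G (Vtx v) = v"
| "bsource G (Fin p) = psource G p"
| "bsource G (Inf w) = tail G (shd w)"

fun starts_with :: "('v, 'e) bpath \<Rightarrow> 'e list \<Rightarrow> bool" where
  "starts_with (Vtx v) a \<longleftrightarrow> a = []"
| "starts_with (Fin p) a \<longleftrightarrow> take (length a) p = a"
| "starts_with (Inf w) a \<longleftrightarrow> stake (length a) w = a"

abbreviation FG :: "('v, 'e) pre_digraph \<Rightarrow> 'e word monoid" where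
  "FG G \<equiv> free_group (arcs G)"

definition of_path :: "'e list \<Rightarrow> 'e word" where
  "of_path a = map (\<lambda>e. (e, True)) a"

text \<open>
  In the last clause \<open>of_path a @ inv_word (of_path b)\<close> is the unreduced product \<open>ab\<^sup>-\<^sup>1\<close>,
  which is required to be a reduced word already.
\<close>

definition Xset :: "('v, 'e) pre_digraph \<Rightarrow> 'e word \<Rightarrow> ('v, 'e) bpath set" where
  "Xset G c = {\<xi> \<in> bpaths G.
     c = [] \<or>
     (\<exists>b\<in>fpaths G. c = inv_word (of_path b) \<and> bsource G \<xi> = prange G b) \<or>
     (\<exists>a\<in>fpaths G. c = of_path a \<and> starts_with \<xi> a) \<or>
     (\<exists>a\<in>fpaths G. \<exists>b\<in>fpaths G. prange G a = prange G b \<and>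
        c = of_path a @ inv_word (of_path b) \<and> reduced c \<and> starts_with \<xi> a)}"

definition Xvert :: "('v, 'e) pre_digraph \<Rightarrow> 'v \<Rightarrow> ('v, 'e) bpath set" where
  "Xvert G v = {\<xi> \<in> bpaths G. bsource G \<xi> = v}"

fun prepend :: "'e list \<Rightarrow> ('v, 'e) bpath \<Rightarrow> ('v, 'e) bpath" where
  "prepend a (Vtx v) = (if a = [] then Vtx v else Fin a)"
| "prepend a (Fin p) = Fin (a @ p)"
| "prepend a (Inf w) = Inf (a @- w)"

fun chop :: "('v, 'e) pre_digraph \<Rightarrow> 'e list \<Rightarrow> ('v, 'e) bpath \<Rightarrow> ('v, 'e) bpath" where
  "chop G b (Vtx v) = Vtx v"
| "chop G b (Fin p) = (if p = b then Vtx (prange G b) else Fin (drop (length b) p))"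
| "chop G b (Inf w) = Inf (sdrop (length b) w)"

definition pos_part :: "'e word \<Rightarrow> 'e list" where
  "pos_part c = map fst (takeWhile snd c)"

definition neg_part :: "'e word \<Rightarrow> 'e list" where
  "neg_part c = rev (map fst (dropWhile snd c))"

text \<open>
  A word \<open>c\<close> with \<open>Xset G c \<noteq> {}\<close> has the form \<open>ab\<^sup>-\<^sup>1\<close>, where \<open>a = pos_part c\<close> and
  \<open>b = neg_part c\<close> may be empty; the map \<open>theta G c\<close> replaces the initial segment \<open>b\<close> by \<open>a\<close>.
  It is meaningful only on \<open>Xset G (inv_word c)\<close>.
\<close>

definition theta :: "('v, 'e) pre_digraph \<Rightarrow> 'e word \<Rightarrow> ('v, 'e) bpath \<Rightarrow> ('v, 'e) bpath" where
  "theta G c \<xi> = prepend (pos_part c) (chop G (neg_part c) \<xi>)"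

lemma pos_part_word [simp]: "pos_part (of_path a @ inv_word (of_path b)) = a"
  and neg_part_word [simp]: "neg_part (of_path a @ inv_word (of_path b)) = b"
proof -
  have inv: "inv_word (of_path b) = map (\<lambda>e. (e, False)) (rev b)"
    by (simp add: inv_word_def of_path_def rev_map o_def)
  have "takeWhile snd (map (\<lambda>e. (e, False)) (rev b)) = []"
       "dropWhile snd (map (\<lambda>e. (e, False)) (rev b)) = map (\<lambda>e. (e, False)) (rev b)"
    by (cases "rev b"; simp)+
  then show "pos_part (of_path a @ inv_word (of_path b)) = a"
       "neg_part (of_path a @ inv_word (of_path b)) = b"
    unfolding pos_part_def neg_part_def inv
    by (simp_all add: of_path_def takeWhile_append dropWhile_append rev_map o_def)
qed

lemma theta_word:
  "theta G (of_path a @ inv_word (of_path b)) \<xi> = prepend a (chop G b \<xi>)"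
  by (simp add: theta_def)

section \<open>The ideals and the action on functions\<close>

text \<open>
  A function on \<open>Xset G c\<close> is identified with its extension by zero to the whole type.
  Addition and multiplication of functions are the pointwise ones of
  \<^theory>\<open>HOL-Library.Function_Algebras\<close>.
\<close>

definition fscale :: "'k::field \<Rightarrow> ('x \<Rightarrow> 'k) \<Rightarrow> 'x \<Rightarrow> 'k" where
  "fscale c f = (\<lambda>x. c * f x)"

lemma module_fscale: "module fscale"
  by unfold_locales (auto simp: fscale_def fun_eq_iff algebra_simps)

definition alpha ::
    "('v, 'e) pre_digraph \<Rightarrow> 'e word \<Rightarrow> (('v, 'e) bpath \<Rightarrow> 'k::field) \<Rightarrow> ('v, 'e) bpath \<Rightarrow> 'k" where
  "alpha G c f = (\<lambda>\<xi>. if \<xi> \<in> Xset G c then f (theta G (inv\<^bsub>FG G\<^esub> c) \<xi>) else 0)"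

definition D0 :: "('v, 'e) pre_digraph \<Rightarrow> (('v, 'e) bpath \<Rightarrow> 'k::field) set" where
  "D0 G = module.span fscale
     ({indicator (Xset G p) | p. p \<in> carrier (FG G) - {\<one>\<^bsub>FG G\<^esub>}} \<union>
      {indicator (Xvert G v) | v. v \<in> verts G})"

definition D :: "('v, 'e) pre_digraph \<Rightarrow> 'e word \<Rightarrow> (('v, 'e) bpath \<Rightarrow> 'k::field) set" where
  "D G p = (if p = \<one>\<^bsub>FG G\<^esub> then D0 G else (\<lambda>f. indicator (Xset G p) * f) ` D0 G)"

section \<open>The partial skew group ring\<close>

text \<open>
  A formal sum is represented by its coefficient function, which vanishes outside the group.
  The ring need not have an identity element, so the field \<open>one\<close> of the record carries no
  information.
\<close>

definition partial_skew_group_ring ::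
    "('g, 'z) monoid_scheme \<Rightarrow> ('g \<Rightarrow> 'a::comm_ring set) \<Rightarrow> ('g \<Rightarrow> 'a \<Rightarrow> 'a) \<Rightarrow> ('g \<Rightarrow> 'a) ring" where
  "partial_skew_group_ring \<Gamma> I \<alpha> =
    \<lparr> carrier = {a. (\<forall>t\<in>carrier \<Gamma>. a t \<in> I t) \<and> (\<forall>t. t \<notin> carrier \<Gamma> \<longrightarrow> a t = 0) \<and>
                    finite {t. a t \<noteq> 0}},
      mult = (\<lambda>a b u. \<Sum>(t, s) \<in> {(t, s). a t \<noteq> 0 \<and> b s \<noteq> 0 \<and> t \<otimes>\<^bsub>\<Gamma>\<^esub> s = u}.
                        \<alpha> t (\<alpha> (inv\<^bsub>\<Gamma>\<^esub> t) (a t) * b s)),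
      one = undefined,
      zero = (\<lambda>t. 0),
      add = (\<lambda>a b t. a t + b t) \<rparr>"

definition graph_skew_ring ::
    "('v, 'e) pre_digraph \<Rightarrow> ('e word \<Rightarrow> ('v, 'e) bpath \<Rightarrow> 'k::field) ring" where
  "graph_skew_ring G = partial_skew_group_ring (FG G) (D G) (alpha G)"

text \<open>
  The library's \<^locale>\<open>ideal\<close> presupposes a ring with identity, hence the following version
  for rings without identity.
\<close>

definition two_sided_ideal :: "'a set \<Rightarrow> ('a, 'm) ring_scheme \<Rightarrow> bool" where
  "two_sided_ideal I R \<longleftrightarrow> additive_subgroup I R \<and>
     (\<forall>x\<in>I. \<forall>r\<in>carrier R. r \<otimes>\<^bsub>R\<^esub> x \<in> I \<and> x \<otimes>\<^bsub>R\<^esub> r \<in> I)"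

definition simple_ring :: "('a, 'm) ring_scheme \<Rightarrow> bool" where
  "simple_ring R \<longleftrightarrow> {I. two_sided_ideal I R} = {{\<zero>\<^bsub>R\<^esub>}, carrier R}"

end

theory Submission
  imports Defs
begin

text \<open>
The words of the free group act on the boundary paths by replacing initial segments, and an element
of the ring is a function \<open>a t \<xi>\<close> of a word \<open>t\<close> and a boundary path \<open>\<xi>\<close>, supported on the pairs with
\<open>\<xi> \<in> X_t\<close>. Multiplication becomes convolution over the orbit relation (\<open>R_mult_apply\<close>), that is,
\<open>(ab) u \<xi>\<close> is the sum of \<open>a t \<xi> b s (t\<^sup>-\<^sup>1\<xi>)\<close> over \<open>ts = u\<close>. In this form the two ideals
constructed below are given by conditions on values, and that they are ideals is read off the
convolution formula.

Let the ring be simple. For a hereditary set \<open>H\<close>, the elements whose support consists of paths that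
enter \<open>H\<close> through a prefix with arcs in some finite set form an ideal. It contains the idempotents
\<open>1_v\<close> with \<open>v \<in> H\<close>. If \<open>H\<close> is also saturated, it contains no other \<open>1_v\<close>: from \<open>v \<notin> H\<close> a boundary path
can be followed that at each step stays outside \<open>H\<close> or uses an arc outside the finite set
(\<open>vunit_notin_hs_ideal\<close>). Hence \<open>H\<close> is trivial. Next, the ring acts on all functions on the boundary
paths by \<open>(a f)(\<xi>) = \<Sum>t. a t \<xi> f(t\<^sup>-\<^sup>1\<xi>)\<close>, and the kernel of this representation is an ideal. It never
contains \<open>1_v\<close>. If \<open>p\<close> is a closed path at \<open>v\<close> without exit, then the periodic path \<open>ppp\<dots>\<close> is the only
boundary path from \<open>v\<close>, and it is fixed by \<open>p\<close>, so that \<open>1_v - 1_p \<delta>_p\<close> is a nonzero element of the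
kernel. This proves condition (L) (\<open>simple_imp_condition_L\<close>).

Conversely, assume condition (L) and let \<open>I\<close> be a nonzero ideal. Some \<open>b \<in> I\<close> has a nonzero coefficient
\<open>b 1 \<xi>\<close> at the neutral element. A word \<open>t \<noteq> 1\<close> fixes at most one boundary path, and by condition (L)
this path is not isolated; as the support of \<open>b\<close> is finite, there is \<open>\<eta>\<close> arbitrarily close to \<open>\<xi>\<close> that
is fixed by no \<open>t \<noteq> 1\<close> in the support (\<open>ex_near_not_fixed\<close>). A small cylinder set \<open>Z\<close> around \<open>\<eta>\<close> is
moved off itself by all these \<open>t\<close>, and the coefficient of \<open>b\<close> at \<open>1\<close> is a constant on \<open>Z\<close>, so cutting
\<open>b\<close> down by \<open>1_Z\<close> on both sides leaves a nonzero multiple of \<open>1_Z\<close>. Conjugating with the path that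
defines \<open>Z\<close> turns \<open>1_Z\<close> into some \<open>1_w\<close> (\<open>ideal_contains_vunit\<close>). The vertices \<open>w\<close> with \<open>1_w \<in> I\<close> form a
nonempty hereditary saturated set. If this is the set of all vertices, then \<open>I\<close> contains local units
for every element and is the whole ring.
\<close>

section \<open>Boundary paths\<close>

fun initial :: "nat \<Rightarrow> ('v, 'e) bpath \<Rightarrow> 'e list" where
  "initial n (Vtx v) = []"
| "initial n (Fin p) = take n p"
| "initial n (Inf w) = stake n w"

text \<open>
The relations \<open>agree G n\<close> define the topology of the boundary path space in which the functions of
\<open>D0\<close> are locally constant. The source is compared separately since for \<open>n = 0\<close>, and for a boundary
path that is a single vertex, the initial segment does not determine it.
\<close>

definition agree :: "('v, 'e) pre_digraph \<Rightarrow> nat \<Rightarrow> ('v, 'e) bpath \<Rightarrow> ('v, 'e) bpath \<Rightarrow> bool" where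
  "agree G n \<xi> \<eta> \<longleftrightarrow> bsource G \<xi> = bsource G \<eta> \<and> initial n \<xi> = initial n \<eta>"

lemma starts_with_iff_initial: "starts_with \<xi> a \<longleftrightarrow> initial (length a) \<xi> = a"
  by (cases \<xi>) auto

lemma starts_with_Nil [simp]: "starts_with \<xi> []"
  by (simp add: starts_with_iff_initial) (cases \<xi>; simp)

lemma initial_0 [simp]: "initial 0 \<xi> = []"
  by (cases \<xi>) auto

lemma prepend_append: "prepend (a @ b) \<xi> = prepend a (prepend b \<xi>)"
  by (cases \<xi>) auto

lemma prepend_Nil [simp]: "prepend [] \<xi> = \<xi>"
  by (cases \<xi>) auto

lemma prepend_Cons: "prepend (e # a) \<xi> = prepend [e] (prepend a \<xi>)"
  using prepend_append[of "[e]" a \<xi>] by simp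

lemma initial_prepend: "initial n (prepend a \<xi>) = take n a @ initial (n - length a) \<xi>"
  by (cases \<xi>) (auto simp: stake_shift)

lemma starts_with_prepend_Cons [simp]:
  "starts_with (prepend [e] \<xi>) (f # a) \<longleftrightarrow> e = f \<and> starts_with \<xi> a"
  by (cases \<xi>) auto

lemma starts_with_prepend: "starts_with (prepend a \<xi>) a"
  by (simp add: starts_with_iff_initial initial_prepend)

lemma take_initial: "take m (initial n \<xi>) = initial (min m n) \<xi>"
  by (cases \<xi>) (auto simp: take_stake min_def)

lemma initial_eq_mono: "initial n \<xi> = initial n \<eta> \<Longrightarrow> m \<le> n \<Longrightarrow> initial m \<xi> = initial m \<eta>"
  by (metis take_initial min.absorb1)

lemma agree_mono: "agree G n \<xi> \<eta> \<Longrightarrow> m \<le> n \<Longrightarrow> agree G m \<xi> \<eta>"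
  unfolding agree_def using initial_eq_mono by blast

lemma agree_refl [simp]: "agree G n \<xi> \<xi>"
  and agree_sym: "agree G n \<xi> \<eta> \<Longrightarrow> agree G n \<eta> \<xi>"
  and agree_trans: "agree G n \<xi> \<eta> \<Longrightarrow> agree G n \<eta> \<zeta> \<Longrightarrow> agree G n \<xi> \<zeta>"
  by (auto simp: agree_def)

lemma starts_with_append: "starts_with \<xi> (a @ b) \<Longrightarrow> starts_with \<xi> a"
  using take_initial[of "length a" "length (a @ b)" \<xi>] by (simp add: starts_with_iff_initial)

context wf_digraph
begin

lemma awalk_hd_last:
  "awalk u p v \<Longrightarrow> p \<noteq> [] \<Longrightarrow> tail G (hd p) = u \<and> head G (last p) = v"
  by (induction p arbitrary: u) (auto simp: awalk_simps)

lemma fpaths_awalk: "p \<in> fpaths G \<Longrightarrow> awalk (psource G p) p (prange G p)"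
proof -
  assume "p \<in> fpaths G"
  then obtain u v where "p \<noteq> []" "awalk u p v" by (auto simp: fpaths_def)
  then show ?thesis
    using awalk_hd_last[of u p v] by (auto simp: psource_def prange_def)
qed

lemma awalk_fpaths:
  assumes "awalk u p v" "p \<noteq> []"
  shows "p \<in> fpaths G" "psource G p = u" "prange G p = v"
  using assms awalk_hd_last[OF assms] by (auto simp: fpaths_def psource_def prange_def)

lemma fpaths_iff: "p \<in> fpaths G \<longleftrightarrow> p \<noteq> [] \<and> awalk (psource G p) p (prange G p)"
  using fpaths_awalk by (auto simp: fpaths_def)

lemma Vtx_in_bpaths: "Vtx v \<in> bpaths G \<longleftrightarrow> sink G v"
  and Fin_in_bpaths: "Fin p \<in> bpaths G \<longleftrightarrow> p \<in> fpaths G \<and> sink G (prange G p)"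
  and Inf_in_bpaths: "Inf w \<in> bpaths G \<longleftrightarrow>
    sset w \<subseteq> arcs G \<and> (\<forall>i. head G (w !! i) = tail G (w !! Suc i))"
  by (auto simp: bpaths_def)

lemmas in_bpaths = Vtx_in_bpaths Fin_in_bpaths Inf_in_bpaths

lemma bsource_in_verts: "\<xi> \<in> bpaths G \<Longrightarrow> bsource G \<xi> \<in> verts G"
proof (cases \<xi>)
  case (Inf w)
  moreover assume "\<xi> \<in> bpaths G"
  moreover have "shd w \<in> sset w" by (cases w) auto
  ultimately show ?thesis by (auto simp: in_bpaths)
qed (auto simp: in_bpaths sink_def dest!: fpaths_awalk)

lemma bpaths_step:
  assumes "\<xi> \<in> bpaths G" "\<not> sink G (bsource G \<xi>)"
  obtains e \<zeta> where "\<xi> = prepend [e] \<zeta>" "\<zeta> \<in> bpaths G" "e \<in> arcs G"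
    "tail G e = bsource G \<xi>" "head G e = bsource G \<zeta>"
proof (cases \<xi>)
  case (Vtx v)
  then show ?thesis using assms by (simp add: in_bpaths)
next
  case (Fin p)
  with assms have p: "p \<in> fpaths G" "sink G (prange G p)" by (auto simp: in_bpaths)
  then obtain e q where q: "p = e # q" by (cases p) (auto simp: fpaths_def)
  have w: "awalk (tail G e) (e # q) (prange G p)"
    using fpaths_awalk[OF p(1)] q by (simp add: psource_def)
  then have e: "e \<in> arcs G" "awalk (head G e) q (prange G p)" by (auto simp: awalk_Cons_iff)
  show ?thesis
  proof (cases "q = []")
    case True
    then show ?thesis using that[of e "Vtx (head G e)"] Fin q p e
      by (auto simp: in_bpaths psource_def prange_def)
  next
    case False
    then show ?thesis using that[of e "Fin q"] Fin q p e awalk_fpaths[OF e(2) False]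
      by (auto simp: in_bpaths psource_def)
  qed
next
  case (Inf w)
  then have w: "sset w \<subseteq> arcs G" "\<And>i. head G (w !! i) = tail G (w !! Suc i)"
    using assms by (auto simp: in_bpaths)
  have "sset (stl w) \<subseteq> arcs G" "shd w \<in> arcs G" using w(1) by (cases w; auto)+
  moreover have "head G (stl w !! i) = tail G (stl w !! Suc i)" for i using w(2)[of "Suc i"] by simp
  moreover have "head G (shd w) = tail G (shd (stl w))" using w(2)[of 0] by simp
  ultimately show ?thesis using that[of "shd w" "Inf (stl w)"] Inf
    by (auto simp: in_bpaths)
qed

lemma prepend_arc_in_bpaths:
  assumes "\<zeta> \<in> bpaths G" "e \<in> arcs G" "head G e = bsource G \<zeta>"
  shows "prepend [e] \<zeta> \<in> bpaths G"
proof (cases \<zeta>)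
  case (Vtx v)
  then have "awalk (tail G e) [e] v" using assms by (auto simp: awalk_simps)
  from awalk_fpaths[OF this] show ?thesis using Vtx assms by (auto simp: in_bpaths)
next
  case (Fin p)
  then have p: "p \<in> fpaths G" "sink G (prange G p)" using assms by (auto simp: in_bpaths)
  have "awalk (tail G e) (e # p) (prange G p)"
    using fpaths_awalk[OF p(1)] assms Fin by (auto simp: awalk_Cons_iff)
  from awalk_fpaths[OF this] show ?thesis using Fin p by (auto simp: in_bpaths)
next
  case (Inf w)
  have "head G ((e ## w) !! i) = tail G ((e ## w) !! Suc i)" for i
    using assms Inf by (cases i) (auto simp: in_bpaths)
  then show ?thesis using assms Inf by (auto simp: in_bpaths)
qed

lemma bsource_prepend_arc [simp]: "bsource G (prepend [e] \<zeta>) = tail G e"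
  by (cases \<zeta>) (auto simp: psource_def)

lemma bsource_prepend: "awalk u a (bsource G \<zeta>) \<Longrightarrow> bsource G (prepend a \<zeta>) = u"
  using prepend_Cons[of "hd a" "tl a" \<zeta>] by (cases a) (auto simp: awalk_simps)

lemma prepend_in_bpaths:
  "awalk u a (bsource G \<zeta>) \<Longrightarrow> \<zeta> \<in> bpaths G \<Longrightarrow> prepend a \<zeta> \<in> bpaths G"
proof (induction a arbitrary: u)
  case (Cons e a)
  then have w: "awalk (head G e) a (bsource G \<zeta>)" "e \<in> arcs G" by (auto simp: awalk_Cons_iff)
  show ?case unfolding prepend_Cons[of e a]
    using prepend_arc_in_bpaths[OF Cons.IH[OF w(1) Cons.prems(2)] w(2)] bsource_prepend[OF w(1)]
    by simp
qed simp

lemma starts_withE: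
  assumes "\<xi> \<in> bpaths G" "starts_with \<xi> a"
  obtains \<zeta> where "\<zeta> \<in> bpaths G" "\<xi> = prepend a \<zeta>" "awalk (bsource G \<xi>) a (bsource G \<zeta>)"
proof -
  have "\<exists>\<zeta>. \<zeta> \<in> bpaths G \<and> \<xi> = prepend a \<zeta> \<and> awalk (bsource G \<xi>) a (bsource G \<zeta>)"
    using assms
  proof (induction a arbitrary: \<xi>)
    case Nil
    then show ?case using bsource_in_verts[of \<xi>] by (auto simp: awalk_simps)
  next
    case (Cons e a)
    have "\<not> sink G (bsource G \<xi>)"
    proof (cases \<xi>)
      case (Fin p)
      then have "p \<in> fpaths G" using Cons.prems by (auto simp: in_bpaths)
      then have "p \<noteq> []" "awalk (psource G p) p (prange G p)"
        using fpaths_awalk by (auto simp: fpaths_def)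
      then have "hd p \<in> arcs G" by (cases p) (auto simp: awalk_simps)
      then show ?thesis using Fin by (auto simp: sink_def psource_def out_arcs_def)
    next
      case (Inf w)
      then have "shd w \<in> arcs G" using Cons.prems by (cases w) (auto simp: in_bpaths)
      then show ?thesis using Inf by (auto simp: sink_def out_arcs_def)
    qed (use Cons.prems in auto)
    from bpaths_step[OF Cons.prems(1) this] obtain f \<eta> where
      f: "\<xi> = prepend [f] \<eta>" "\<eta> \<in> bpaths G" "f \<in> arcs G"
        "tail G f = bsource G \<xi>" "head G f = bsource G \<eta>" .
    with Cons.prems have "e = f" "starts_with \<eta> a" by auto
    with Cons.IH[OF f(2)] obtain \<zeta> where \<zeta>: "\<zeta> \<in> bpaths G" "\<eta> = prepend a \<zeta>"
      "awalk (bsource G \<eta>) a (bsource G \<zeta>)" by auto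
    have "\<xi> = prepend (e # a) \<zeta>" using f(1) \<zeta>(2) \<open>e = f\<close> prepend_Cons[of e a \<zeta>] by simp
    then show ?case using \<zeta> f \<open>e = f\<close> by (auto simp: awalk_Cons_iff)
  qed
  with that show ?thesis by blast
qed

lemma prepend_arc_inj:
  assumes "prepend [e] \<xi> = prepend [f] \<eta>" "\<xi> \<in> bpaths G" "\<eta> \<in> bpaths G"
    "head G e = bsource G \<xi>" "head G f = bsource G \<eta>"
  shows "e = f \<and> \<xi> = \<eta>"
  using assms by (cases \<xi>; cases \<eta>) (auto simp: in_bpaths fpaths_def)

text \<open>
If \<open>b\<xi> = c\<eta>\<close>, then one of \<open>b\<close> and \<open>c\<close> is a prefix of the other, and cancelling it expresses one of
\<open>\<xi>\<close>, \<open>\<eta>\<close> through the other. This is what makes products \<open>ab\<^sup>-\<^sup>1cd\<^sup>-\<^sup>1\<close> computable on boundary paths.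
\<close>

lemma prepend_eq_cases:
  assumes "prepend b \<xi> = prepend c \<eta>" "\<xi> \<in> bpaths G" "\<eta> \<in> bpaths G"
    "awalk u b (bsource G \<xi>)" "awalk v c (bsource G \<eta>)"
  obtains d where "c = b @ d" "\<xi> = prepend d \<eta>" "awalk (bsource G \<xi>) d (bsource G \<eta>)"
  | d where "b = c @ d" "\<eta> = prepend d \<xi>" "awalk (bsource G \<eta>) d (bsource G \<xi>)"
proof -
  have "(\<exists>d. c = b @ d \<and> \<xi> = prepend d \<eta> \<and> awalk (bsource G \<xi>) d (bsource G \<eta>)) \<or>
        (\<exists>d. b = c @ d \<and> \<eta> = prepend d \<xi> \<and> awalk (bsource G \<eta>) d (bsource G \<xi>))"
    using assms
  proof (induction b arbitrary: c u v)
    case Nil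
    then have "\<xi> = prepend c \<eta>" by simp
    with Nil show ?case using bsource_prepend by force
  next
    case (Cons e b)
    show ?case
    proof (cases c)
      case Nil
      with Cons.prems show ?thesis using bsource_prepend by force
    next
      case (Cons f c')
      have w: "awalk (head G e) b (bsource G \<xi>)" "awalk (head G f) c' (bsource G \<eta>)"
        using Cons.prems Cons by (auto simp: awalk_Cons_iff)
      have "prepend [e] (prepend b \<xi>) = prepend [f] (prepend c' \<eta>)"
        using Cons.prems(1) Cons prepend_Cons[of e b \<xi>] prepend_Cons[of f c' \<eta>] by simp
      then have "e = f \<and> prepend b \<xi> = prepend c' \<eta>"
        using prepend_in_bpaths w Cons.prems bsource_prepend by (intro prepend_arc_inj) auto
      with Cons.IH[OF _ Cons.prems(2,3) w] Cons show ?thesis by auto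
    qed
  qed
  with that show ?thesis by blast
qed

lemma bpath_eqI:
  assumes "\<xi> \<in> bpaths G" "\<eta> \<in> bpaths G" "\<And>n. agree G n \<xi> \<eta>"
  shows "\<xi> = \<eta>"
proof -
  have s: "bsource G \<xi> = bsource G \<eta>" and i: "\<And>n. initial n \<xi> = initial n \<eta>"
    using assms(3) by (auto simp: agree_def)
  show ?thesis
  proof (cases \<xi>)
    case (Vtx v)
    then show ?thesis using s i[of 1] assms by (cases \<eta>) (auto simp: in_bpaths fpaths_def)
  next
    case (Fin p)
    show ?thesis
    proof (cases \<eta>)
      case (Fin q)
      then show ?thesis using i[of "max (length p) (length q)"] \<open>\<xi> = Fin p\<close> by simp
    next
      case (Inf w)
      then show ?thesis using arg_cong[OF i[of "Suc (length p)"], of length] \<open>\<xi> = Fin p\<close> by simp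
    qed (use i[of 1] Fin assms in \<open>auto simp: in_bpaths fpaths_def\<close>)
  next
    case (Inf w)
    show ?thesis
    proof (cases \<eta>)
      case (Inf w')
      have "w !! n = w' !! n" for n
        using i[of "Suc n"] \<open>\<xi> = Inf w\<close> Inf by (metis initial.simps(3) lessI stake_nth)
      then show ?thesis using \<open>\<xi> = Inf w\<close> Inf using smap_alt[of id w w'] by (simp add: stream.map_id)
    next
      case (Fin q)
      then show ?thesis using arg_cong[OF i[of "Suc (length q)"], of length] \<open>\<xi> = Inf w\<close> by simp
    qed (use i[of 1] Inf in auto)
  qed
qed

text \<open>
A rule that selects an outgoing arc at every vertex that is not a sink can be followed either for
ever or up to a sink, and both outcomes are boundary paths.
\<close>

lemma bpath_following_choice:
  assumes nx: "\<And>w. w \<in> verts G \<Longrightarrow> \<not> sink G w \<Longrightarrow> nx w \<in> out_arcs G w" and v: "v \<in> verts G"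
  obtains \<xi> where "\<xi> \<in> bpaths G" "bsource G \<xi> = v"
    "\<And>a e. starts_with \<xi> (a @ [e]) \<Longrightarrow> e = nx (tail G e)"
proof -
  define nv where "nv = (\<lambda>w. head G (nx w))"
  have nv: "head G (nx w) = nv w" "(nv ^^ n) (nv w) = nv ((nv ^^ n) w)" for n w
    using funpow_swap1[of nv n w] by (simp_all add: nv_def)
  let ?P = "\<lambda>v \<xi>. \<xi> \<in> bpaths G \<and> bsource G \<xi> = v \<and> (\<forall>a e. starts_with \<xi> (a @ [e]) \<longrightarrow> e = nx (tail G e))"
  have ex: "\<exists>\<xi>. ?P v \<xi>" if "v \<in> verts G" "sink G ((nv ^^ n) v)" for n v
    using that
  proof (induction n arbitrary: v)
    case 0
    then show ?case by (intro exI[of _ "Vtx v"]) (auto simp: in_bpaths)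
  next
    case (Suc n)
    show ?case
    proof (cases "sink G v")
      case True
      then show ?thesis by (intro exI[of _ "Vtx v"]) (auto simp: in_bpaths)
    next
      case False
      then have n: "nx v \<in> arcs G" "tail G (nx v) = v" using nx[OF Suc.prems(1)] by auto
      have "\<exists>\<xi>. ?P (nv v) \<xi>"
        by (rule Suc.IH) (use n Suc.prems head_in_verts[of "nx v"] in \<open>auto simp: nv\<close>)
      then obtain \<zeta> where \<zeta>: "?P (nv v) \<zeta>" ..
      have "e = nx (tail G e)" if "starts_with (prepend [nx v] \<zeta>) (a @ [e])" for a e
        using that \<zeta> n by (cases a) auto
      then show ?thesis using \<zeta> n prepend_arc_in_bpaths[of \<zeta> "nx v"]
        by (intro exI[of _ "prepend [nx v] \<zeta>"]) (auto simp: nv_def)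
    qed
  qed
  show ?thesis
  proof (cases "\<exists>n. sink G ((nv ^^ n) v)")
    case True
    with ex v that show ?thesis by blast
  next
    case False
    have inv: "(nv ^^ n) v \<in> verts G" for n
      by (induction n) (use v False nx in \<open>auto simp: nv_def\<close>)
    let ?w = "smap nx (siterate nv v)"
    have arc: "?w !! i \<in> out_arcs G ((nv ^^ i) v)" for i using nx inv False by simp
    have "tail G (nx (nv ((nv ^^ i) v))) = nv ((nv ^^ i) v)" for i
      using arc[of "Suc i"] nv by simp
    then have "Inf ?w \<in> bpaths G"
      using arc by (auto simp: in_bpaths sset_range nv simp del: funpow.simps)
    moreover have "e = nx (tail G e)" if "starts_with (Inf ?w) (a @ [e])" for a e
    proof -
      have "stake (Suc (length a)) ?w = a @ [e]" using that by simp
      then have "e = ?w !! length a" by (metis lessI nth_append_length stake_nth)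
      then show ?thesis using arc by auto
    qed
    ultimately show ?thesis using that[of "Inf ?w"] arc[of 0] by auto
  qed
qed

lemma ex_bpath_from:
  assumes "v \<in> verts G"
  obtains \<xi> where "\<xi> \<in> bpaths G" "bsource G \<xi> = v"
proof -
  have nx: "(SOME e. e \<in> out_arcs G w) \<in> out_arcs G w" if "w \<in> verts G" "\<not> sink G w" for w
    using that unfolding some_in_eq by (auto simp: sink_def)
  show ?thesis
    by (rule bpath_following_choice[OF nx assms]) (assumption | rule that)+
qed

lemma agree_prependI:
  assumes "agree G m \<zeta> \<zeta>'" "awalk u b (bsource G \<zeta>)"
  shows "agree G (m + length b) (prepend b \<zeta>) (prepend b \<zeta>')"
  using assms bsource_prepend[of u b \<zeta>] bsource_prepend[of u b \<zeta>']
  by (auto simp: agree_def initial_prepend)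

lemma agree_prependD:
  assumes "agree G (m + length a) (prepend a \<zeta>) (prepend a \<zeta>')"
    "awalk u a (bsource G \<zeta>)" "awalk u' a (bsource G \<zeta>')"
  shows "agree G m \<zeta> \<zeta>'"
proof -
  have "bsource G \<zeta> = bsource G \<zeta>'"
  proof (cases "a = []")
    case False
    then show ?thesis using awalk_fpaths(3)[OF assms(2)] awalk_fpaths(3)[OF assms(3)] by simp
  qed (use assms in \<open>simp add: agree_def\<close>)
  then show ?thesis using assms(1) by (simp add: agree_def initial_prepend)
qed

text \<open>
If every member of \<open>S\<close> consists of \<open>p\<close> followed by a member of \<open>S\<close>, then every member is the periodic
path \<open>ppp\<dots>\<close>. Two members are compared through their initial segments.
\<close>

lemma self_similar_unique:
  assumes S: "S \<subseteq> bpaths G" "\<And>\<xi>. \<xi> \<in> S \<Longrightarrow> bsource G \<xi> = v"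
    "\<And>\<xi>. \<xi> \<in> S \<Longrightarrow> \<exists>\<zeta>\<in>S. \<xi> = prepend p \<zeta>" and p: "p \<noteq> []"
    and \<xi>: "\<xi> \<in> S" and \<eta>: "\<eta> \<in> S"
  shows "\<xi> = \<eta>"
proof -
  have init: "initial n \<xi> = initial n \<eta>" if "\<xi> \<in> S" "\<eta> \<in> S" for n \<xi> \<eta>
    using that
  proof (induction n arbitrary: \<xi> \<eta> rule: less_induct)
    case (less n)
    show ?case
    proof (cases "n = 0")
      case True
      then show ?thesis by (cases \<xi>; cases \<eta>) auto
    next
      case False
      obtain \<zeta> where \<zeta>: "\<zeta> \<in> S" "\<xi> = prepend p \<zeta>" using S(3)[OF less.prems(1)] by blast
      obtain \<kappa> where \<kappa>: "\<kappa> \<in> S" "\<eta> = prepend p \<kappa>" using S(3)[OF less.prems(2)] by blast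
      have "n - length p < n" using False p by simp
      from less.IH[OF this \<zeta>(1) \<kappa>(1)] show ?thesis unfolding \<zeta>(2) \<kappa>(2) initial_prepend by simp
    qed
  qed
  have "agree G n \<xi> \<eta>" for n
    unfolding agree_def using init[OF \<xi> \<eta>] S(2)[OF \<xi>] S(2)[OF \<eta>] by simp
  then show ?thesis using bpath_eqI \<xi> \<eta> S(1) by blast
qed

text \<open>
Along a path without exits there is never a choice, so any boundary path from its source follows it.
\<close>

lemma starts_with_exitless:
  assumes "awalk u p w" "\<And>e f. e \<in> set p \<Longrightarrow> f \<in> arcs G \<Longrightarrow> tail G f = tail G e \<Longrightarrow> f = e"
    "\<xi> \<in> bpaths G" "bsource G \<xi> = u"
  shows "starts_with \<xi> p"
  using assms
proof (induction p arbitrary: u \<xi>)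
  case (Cons e p)
  then have e: "e \<in> arcs G" "tail G e = u" "awalk (head G e) p w" by (auto simp: awalk_Cons_iff)
  then have "\<not> sink G (bsource G \<xi>)" using Cons.prems(4) unfolding sink_def by auto
  from bpaths_step[OF Cons.prems(3) this] obtain f \<zeta> where f: "\<xi> = prepend [f] \<zeta>" "\<zeta> \<in> bpaths G"
    "f \<in> arcs G" "tail G f = bsource G \<xi>" "head G f = bsource G \<zeta>" .
  then have "f = e" using Cons.prems(2)[of e f] Cons.prems(4) e by simp
  moreover have "starts_with \<zeta> p"
    by (rule Cons.IH[OF e(3) _ f(2)]) (use Cons.prems(2) f(5) \<open>f = e\<close> in auto)
  ultimately show ?case using f(1) by simp
qed simp

end

section \<open>The free group and the orbit relation\<close>

lemma of_path_append: "of_path (a @ b) = of_path a @ of_path b"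
  by (simp add: of_path_def)

lemma of_path_Nil [simp]: "of_path [] = []"
  by (simp add: of_path_def)

lemma inv_word_Nil [simp]: "inv_word [] = []"
  by (simp add: inv_word_def)

lemma inv_word_append: "inv_word (u @ w) = inv_word w @ inv_word u"
  by (simp add: inv_word_def)

lemma reduced_of_path: "reduced (of_path a)"
proof (induction a)
  case (Cons e a)
  then show ?case by (cases a) (auto simp: of_path_def reduced_Cons cancels_def)
qed simp

text \<open>
Cancellation in \<open>ab\<^sup>-\<^sup>1\<close> can only occur at the junction, between the last arcs of \<open>a\<close> and \<open>b\<close>.
\<close>

lemma reduced_path_word:
  assumes "a = [] \<or> b = [] \<or> last a \<noteq> last b"
  shows "reduced (of_path a @ inv_word (of_path b))"
proof -
  have "hd (inv_word (of_path b)) = (last b, False)" if "b \<noteq> []"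
    using that by (simp add: inv_word_def of_path_def hd_rev last_map)
  moreover have "last (of_path a) = (last a, True)" if "a \<noteq> []"
    using that by (simp add: of_path_def last_map)
  ultimately show ?thesis
    using assms reduced_of_path[of a] reduced_inv_word[OF reduced_of_path[of b]]
    by (auto simp: reduced_def successively_append_iff cancels_def of_path_def inv_word_def)
qed

lemma free_group_mult_reduced:
  assumes "reduced (u @ w)"
  shows "u \<otimes>\<^bsub>free_group S\<^esub> w = u @ w"
proof -
  have "reduced w" using assms by (simp add: reduced_def successively_append_iff)
  then have "foldr lmult (u @ w) [] = foldr lmult u w" by (simp add: foldr_lmult_Nil)
  then show ?thesis using foldr_lmult_Nil[OF assms] by (simp add: free_group_def)
qed

lemma one_free_group [simp]: "\<one>\<^bsub>free_group S\<^esub> = []"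
  by (simp add: free_group_def)

lemma Nil_mult_free_group [simp]: "[] \<otimes>\<^bsub>free_group S\<^esub> w = w"
  by (simp add: free_group_def)

lemma mult_Nil_free_group [simp]: "w \<in> carrier (free_group S) \<Longrightarrow> w \<otimes>\<^bsub>free_group S\<^esub> [] = w"
  by (simp add: free_group_def foldr_lmult_Nil)

lemma of_path_closed: "set a \<subseteq> S \<Longrightarrow> of_path a \<in> carrier (free_group S)"
  using reduced_of_path by (auto simp: free_group_def of_path_def)

lemma inv_of_path: "set a \<subseteq> S \<Longrightarrow> inv\<^bsub>free_group S\<^esub> (of_path a) = inv_word (of_path a)"
  by (simp add: inv_free_group of_path_closed)

lemma of_path_mult: "of_path a \<otimes>\<^bsub>free_group S\<^esub> of_path b = of_path (a @ b)"
  using free_group_mult_reduced reduced_of_path[of "a @ b"] by (simp add: of_path_append)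

context wf_digraph
begin

sublocale F: group "FG G" by (rule group_free_group)

text \<open>
The transformation groupoid of the partial action: \<open>moves t \<xi> \<eta>\<close> says that \<open>t\<close> takes \<open>\<eta>\<close> to \<open>\<xi>\<close>, with
\<open>t = ab\<^sup>-\<^sup>1\<close>, \<open>\<xi> = a\<zeta>\<close> and \<open>\<eta> = b\<zeta>\<close>. The word \<open>ab\<^sup>-\<^sup>1\<close> may have cancellations here, so that
this description is closed under composition.
\<close>

definition moves :: "'b word \<Rightarrow> ('a, 'b) bpath \<Rightarrow> ('a, 'b) bpath \<Rightarrow> bool" where
  "moves t \<xi> \<eta> \<longleftrightarrow> (\<exists>a b \<zeta> u v. \<zeta> \<in> bpaths G \<and>
     awalk u a (bsource G \<zeta>) \<and> awalk v b (bsource G \<zeta>) \<and>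
     \<xi> = prepend a \<zeta> \<and> \<eta> = prepend b \<zeta> \<and>
     t = of_path a \<otimes>\<^bsub>FG G\<^esub> inv\<^bsub>FG G\<^esub> (of_path b))"

lemma awalk_arcs: "awalk u a v \<Longrightarrow> set a \<subseteq> arcs G"
  by (simp add: awalk_def)

lemma of_path_awalk_closed: "awalk u a v \<Longrightarrow> of_path a \<in> carrier (FG G)"
  by (simp add: of_path_closed awalk_arcs)

lemma moves_closed: "moves t \<xi> \<eta> \<Longrightarrow> t \<in> carrier (FG G)"
  by (auto simp: moves_def of_path_awalk_closed)

lemma moves_in_bpaths: "moves t \<xi> \<eta> \<Longrightarrow> \<xi> \<in> bpaths G" "moves t \<xi> \<eta> \<Longrightarrow> \<eta> \<in> bpaths G"
  by (auto simp: moves_def intro: prepend_in_bpaths)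

text \<open>
A common last arc of \<open>a\<close> and \<open>b\<close> can be moved to the front of \<open>\<zeta>\<close>. Once this is no longer possible
the word \<open>ab\<^sup>-\<^sup>1\<close> is reduced, and \<open>a\<close> and \<open>b\<close> are recovered from it. In particular they depend on \<open>t\<close> only.
\<close>

lemma moves_normal_form:
  assumes "moves t \<xi> \<eta>"
  obtains \<zeta> u v where "\<zeta> \<in> bpaths G"
    "awalk u (pos_part t) (bsource G \<zeta>)" "awalk v (neg_part t) (bsource G \<zeta>)"
    "\<xi> = prepend (pos_part t) \<zeta>" "\<eta> = prepend (neg_part t) \<zeta>"
    "t = of_path (pos_part t) @ inv_word (of_path (neg_part t))" "reduced t"
proof -
  have "\<exists>a b \<zeta> u v. \<zeta> \<in> bpaths G \<and> awalk u a (bsource G \<zeta>) \<and> awalk v b (bsource G \<zeta>) \<and>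
     \<xi> = prepend a \<zeta> \<and> \<eta> = prepend b \<zeta> \<and> t = of_path a @ inv_word (of_path b) \<and> reduced t"
    if "\<zeta> \<in> bpaths G" "awalk u a (bsource G \<zeta>)" "awalk v b (bsource G \<zeta>)"
      "\<xi> = prepend a \<zeta>" "\<eta> = prepend b \<zeta>"
      "t = of_path a \<otimes>\<^bsub>FG G\<^esub> inv\<^bsub>FG G\<^esub> (of_path b)" for a b \<zeta> u v
    using that
  proof (induction a arbitrary: b \<zeta> rule: rev_induct)
    case Nil
    have "t = of_path [] @ inv_word (of_path b)"
      using Nil F.l_one[of "inv_word (of_path b)"] F.inv_closed[OF of_path_awalk_closed[OF Nil(3)]]
      by (simp add: inv_of_path awalk_arcs)
    with Nil reduced_path_word[of "[]" b] show ?case by metis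
  next
    case (snoc e a)
    show ?case
    proof (cases "b \<noteq> [] \<and> last b = e")
      case True
      then obtain b' where b: "b = b' @ [e]" by (metis append_butlast_last_id)
      have e: "e \<in> arcs G" "head G e = bsource G \<zeta>"
        using snoc.prems(2) by (auto simp: awalk_simps)
      let ?\<zeta> = "prepend [e] \<zeta>"
      have wa: "awalk u a (tail G e)" "awalk v b' (tail G e)"
        using snoc.prems(2,3) b by (auto simp: awalk_simps)
      have c: "of_path a \<in> carrier (FG G)" "of_path b' \<in> carrier (FG G)" "of_path [e] \<in> carrier (FG G)"
        using wa e by (auto intro: of_path_awalk_closed of_path_closed)
      have "t = (of_path a \<otimes>\<^bsub>FG G\<^esub> of_path [e]) \<otimes>\<^bsub>FG G\<^esub> inv\<^bsub>FG G\<^esub> (of_path b' \<otimes>\<^bsub>FG G\<^esub> of_path [e])"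
        using snoc.prems(6) b by (simp add: of_path_mult)
      also have "\<dots> = of_path a \<otimes>\<^bsub>FG G\<^esub> inv\<^bsub>FG G\<^esub> (of_path b')"
        using c by (simp add: F.inv_mult_group F.m_assoc) (simp flip: F.m_assoc)
      finally show ?thesis
        using snoc.IH[of ?\<zeta> b'] snoc.prems b wa e prepend_arc_in_bpaths[of \<zeta> e]
        by (simp add: prepend_append)
    next
      case False
      then have r: "reduced (of_path (a @ [e]) @ inv_word (of_path b))"
        by (intro reduced_path_word) auto
      then have "t = of_path (a @ [e]) @ inv_word (of_path b)"
        using snoc.prems(3,6) by (simp add: inv_of_path awalk_arcs free_group_mult_reduced)
      with r snoc.prems show ?thesis by metis
    qed
  qed
  with assms obtain a b \<zeta> u v where *: "\<zeta> \<in> bpaths G" "awalk u a (bsource G \<zeta>)"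
     "awalk v b (bsource G \<zeta>)" "\<xi> = prepend a \<zeta>" "\<eta> = prepend b \<zeta>"
     "t = of_path a @ inv_word (of_path b)" "reduced t"
    unfolding moves_def by blast
  have parts: "pos_part t = a" "neg_part t = b" by (simp_all add: *(6))
  show ?thesis by (rule that[unfolded parts, OF *])
qed

lemma chop_prepend:
  assumes "\<zeta> \<in> bpaths G" "awalk u a (bsource G \<zeta>)"
  shows "chop G a (prepend a \<zeta>) = \<zeta>"
  using assms awalk_fpaths(3)[OF assms(2)]
  by (cases \<zeta>) (auto simp: in_bpaths fpaths_def sdrop_shift)

lemma moves_imp_theta:
  assumes "moves t \<xi> \<eta>"
  shows "\<xi> \<in> Xset G t" "\<eta> = theta G (inv\<^bsub>FG G\<^esub> t) \<xi>"
proof -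
  let ?a = "pos_part t" and ?b = "neg_part t"
  from assms obtain \<zeta> u v where \<zeta>: "\<zeta> \<in> bpaths G"
    and a: "awalk u ?a (bsource G \<zeta>)" and b: "awalk v ?b (bsource G \<zeta>)"
    and \<xi>: "\<xi> = prepend ?a \<zeta>" and \<eta>: "\<eta> = prepend ?b \<zeta>"
    and t: "t = of_path ?a @ inv_word (of_path ?b)" "reduced t"
    by (rule moves_normal_form)
  have "inv\<^bsub>FG G\<^esub> t = of_path ?b @ inv_word (of_path ?a)"
    using inv_free_group[OF moves_closed[OF assms]] by (subst (asm) (2) t(1)) (simp add: inv_word_append)
  then show "\<eta> = theta G (inv\<^bsub>FG G\<^esub> t) \<xi>"
    using \<zeta> a by (simp add: theta_word \<xi> \<eta> chop_prepend)
  have "\<xi> \<in> bpaths G" using \<xi> \<zeta> a by (auto intro: prepend_in_bpaths)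
  moreover have "starts_with \<xi> ?a" using starts_with_prepend[of ?a \<zeta>] \<xi> by simp
  moreover have "bsource G \<xi> = prange G ?b" if "?a = []" "?b \<noteq> []"
    using awalk_fpaths(3)[OF b that(2)] \<xi> that(1) by simp
  moreover have "prange G ?a = prange G ?b" if "?a \<noteq> []" "?b \<noteq> []"
    using awalk_fpaths(3)[OF b that(2)] awalk_fpaths(3)[OF a that(1)] by simp
  moreover have "?a \<noteq> [] \<Longrightarrow> ?a \<in> fpaths G" "?b \<noteq> [] \<Longrightarrow> ?b \<in> fpaths G"
    using awalk_fpaths(1)[OF a] awalk_fpaths(1)[OF b] by auto
  ultimately have "\<xi> \<in> Xset G (of_path ?a @ inv_word (of_path ?b))"
    using t by (cases "?a = []"; cases "?b = []") (auto simp: Xset_def)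
  with t(1) show "\<xi> \<in> Xset G t" by simp
qed

lemma Xset_imp_moves:
  assumes "\<xi> \<in> Xset G t"
  shows "moves t \<xi> (theta G (inv\<^bsub>FG G\<^esub> t) \<xi>)"
proof -
  have \<xi>: "\<xi> \<in> bpaths G" using assms by (simp add: Xset_def)
  have mv: "\<exists>\<eta>. moves t \<xi> \<eta>"
    if "awalk (bsource G \<xi>) a w" "awalk u b w" "starts_with \<xi> a" "a = [] \<longrightarrow> bsource G \<xi> = w"
      "t = of_path a @ inv_word (of_path b)" "reduced t" for a b u w
  proof -
    from starts_withE[OF \<xi> that(3)] obtain \<zeta> where \<zeta>: "\<zeta> \<in> bpaths G" "\<xi> = prepend a \<zeta>"
      "awalk (bsource G \<xi>) a (bsource G \<zeta>)" .
    have "bsource G \<zeta> = w"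
      using that(1,4) \<zeta> awalk_fpaths(3)[OF that(1)] awalk_fpaths(3)[OF \<zeta>(3)] by (cases "a = []") auto
    moreover have "t = of_path a \<otimes>\<^bsub>FG G\<^esub> inv\<^bsub>FG G\<^esub> (of_path b)"
      using that(2,5,6) by (simp add: inv_of_path awalk_arcs free_group_mult_reduced)
    ultimately show ?thesis unfolding moves_def using \<zeta> that(2) by metis
  qed
  have nil: "awalk (bsource G \<xi>) [] (bsource G \<xi>)"
    using bsource_in_verts[OF \<xi>] by (simp add: awalk_Nil_iff)
  have "\<exists>\<eta>. moves t \<xi> \<eta>"
  proof -
    consider "t = []"
      | b where "b \<in> fpaths G" "t = inv_word (of_path b)" "bsource G \<xi> = prange G b"
      | a where "a \<in> fpaths G" "t = of_path a" "starts_with \<xi> a"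
      | a b where "a \<in> fpaths G" "b \<in> fpaths G" "prange G a = prange G b"
         "t = of_path a @ inv_word (of_path b)" "reduced t" "starts_with \<xi> a"
      using assms unfolding Xset_def by blast
    then show ?thesis
    proof cases
      case 1
      then show ?thesis using mv[OF nil nil] by simp
    next
      case 2
      then show ?thesis using mv[OF nil, of "psource G b" b] fpaths_awalk[of b]
        reduced_inv_word[OF reduced_of_path] by auto
    next
      case 3
      from starts_withE[OF \<xi> 3(3)] obtain \<zeta> where \<zeta>: "\<zeta> \<in> bpaths G" "\<xi> = prepend a \<zeta>"
        "awalk (bsource G \<xi>) a (bsource G \<zeta>)" .
      then show ?thesis using 3 mv[OF \<zeta>(3), of "bsource G \<zeta>" "[]"] reduced_of_path[of a]
          awalk_last_in_verts[OF \<zeta>(3)] by (auto simp: awalk_Nil_iff fpaths_def)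
    next
      case 4
      from starts_withE[OF \<xi> 4(6)] obtain \<zeta> where \<zeta>: "\<zeta> \<in> bpaths G" "\<xi> = prepend a \<zeta>"
        "awalk (bsource G \<xi>) a (bsource G \<zeta>)" .
      have "a \<noteq> []" using 4 by (simp add: fpaths_def)
      then have "bsource G \<zeta> = prange G b" using awalk_fpaths(3)[OF \<zeta>(3)] 4 by simp
      then show ?thesis using 4 mv[OF \<zeta>(3), of "psource G b" b] fpaths_awalk[OF 4(2)] \<open>a \<noteq> []\<close> by auto
    qed
  qed
  then show ?thesis using moves_imp_theta(2) by blast
qed

text \<open>
The groupoid and the partial action carry the same information. Statements about \<open>Xset\<close> and \<open>theta\<close>
are proved below through the groupoid, where inverses and products are easy.
\<close>

lemma moves_iff: "moves t \<xi> \<eta> \<longleftrightarrow> \<xi> \<in> Xset G t \<and> \<eta> = theta G (inv\<^bsub>FG G\<^esub> t) \<xi>"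
  using moves_imp_theta Xset_imp_moves by blast

lemma moves_one: "\<xi> \<in> bpaths G \<Longrightarrow> moves [] \<xi> \<xi>"
  unfolding moves_def
  by (intro exI[of _ "[]"] exI[of _ \<xi>] exI[of _ "bsource G \<xi>"])
    (use bsource_in_verts[of \<xi>] F.r_one[of "[]"] F.inv_one in \<open>auto simp: awalk_Nil_iff\<close>)

lemma moves_sym: "moves t \<xi> \<eta> \<Longrightarrow> moves (inv\<^bsub>FG G\<^esub> t) \<eta> \<xi>"
proof -
  assume "moves t \<xi> \<eta>"
  then obtain a b \<zeta> u v where *: "\<zeta> \<in> bpaths G"
     "awalk u a (bsource G \<zeta>)" "awalk v b (bsource G \<zeta>)"
     "\<xi> = prepend a \<zeta>" "\<eta> = prepend b \<zeta>" "t = of_path a \<otimes>\<^bsub>FG G\<^esub> inv\<^bsub>FG G\<^esub> (of_path b)"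
    unfolding moves_def by blast
  have "of_path a \<in> carrier (FG G)" "of_path b \<in> carrier (FG G)"
    using * by (auto intro: of_path_awalk_closed)
  then have "inv\<^bsub>FG G\<^esub> t = of_path b \<otimes>\<^bsub>FG G\<^esub> inv\<^bsub>FG G\<^esub> (of_path a)"
    using *(6) by (simp add: F.inv_mult_group)
  with * show ?thesis unfolding moves_def by blast
qed

text \<open>
With \<open>\<eta> = b\<zeta> = c\<zeta>'\<close> one of \<open>b\<close>, \<open>c\<close> is a prefix of the other. If \<open>c = bp\<close>, then
\<open>ab\<^sup>-\<^sup>1cd\<^sup>-\<^sup>1 = (ap)d\<^sup>-\<^sup>1\<close>; if \<open>b = cp\<close>, then \<open>ab\<^sup>-\<^sup>1cd\<^sup>-\<^sup>1 = a(dp)\<^sup>-\<^sup>1\<close>.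
\<close>

lemma moves_trans:
  assumes "moves t \<xi> \<eta>" "moves s \<eta> \<kappa>"
  shows "moves (t \<otimes>\<^bsub>FG G\<^esub> s) \<xi> \<kappa>"
proof -
  from assms(1) obtain a b \<zeta> u v where 1: "\<zeta> \<in> bpaths G"
     "awalk u a (bsource G \<zeta>)" "awalk v b (bsource G \<zeta>)"
     "\<xi> = prepend a \<zeta>" "\<eta> = prepend b \<zeta>" "t = of_path a \<otimes>\<^bsub>FG G\<^esub> inv\<^bsub>FG G\<^esub> (of_path b)"
    unfolding moves_def by blast
  from assms(2) obtain c d \<zeta>' u' v' where 2: "\<zeta>' \<in> bpaths G"
     "awalk u' c (bsource G \<zeta>')" "awalk v' d (bsource G \<zeta>')"
     "\<eta> = prepend c \<zeta>'" "\<kappa> = prepend d \<zeta>'" "s = of_path c \<otimes>\<^bsub>FG G\<^esub> inv\<^bsub>FG G\<^esub> (of_path d)"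
    unfolding moves_def by blast
  have cl: "of_path a \<in> carrier (FG G)" "of_path b \<in> carrier (FG G)"
    "of_path c \<in> carrier (FG G)" "of_path d \<in> carrier (FG G)"
    using 1 2 by (auto intro: of_path_awalk_closed)
  have "prepend b \<zeta> = prepend c \<zeta>'" using 1 2 by simp
  from this 1(1) 2(1) 1(3) 2(2) show ?thesis
  proof (cases rule: prepend_eq_cases)
    case (1 p)
    have p: "of_path p \<in> carrier (FG G)" using 1 by (auto intro: of_path_awalk_closed)
    have "t \<otimes>\<^bsub>FG G\<^esub> s = of_path (a @ p) \<otimes>\<^bsub>FG G\<^esub> inv\<^bsub>FG G\<^esub> (of_path d)"
      unfolding \<open>t = _\<close> \<open>s = _\<close> \<open>c = _\<close> of_path_mult[symmetric, where S = "arcs G"]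
      using cl p by (simp add: F.m_assoc F.inv_solve_left) (simp flip: F.m_assoc)
    moreover have "awalk u (a @ p) (bsource G \<zeta>')" using \<open>awalk u a _\<close> 1(3) by (rule awalk_appendI)
    moreover have "\<xi> = prepend (a @ p) \<zeta>'" using \<open>\<xi> = _\<close> 1(2) by (simp add: prepend_append)
    ultimately show ?thesis unfolding moves_def using 2 by blast
  next
    case (2 p)
    have p: "of_path p \<in> carrier (FG G)" using 2 by (auto intro: of_path_awalk_closed)
    have "t \<otimes>\<^bsub>FG G\<^esub> s = of_path a \<otimes>\<^bsub>FG G\<^esub> inv\<^bsub>FG G\<^esub> (of_path (d @ p))"
      unfolding \<open>t = _\<close> \<open>s = _\<close> \<open>b = _\<close> of_path_mult[symmetric, where S = "arcs G"]
      using cl p by (simp add: F.inv_mult_group F.m_assoc) (simp flip: F.m_assoc)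
    moreover have "awalk v' (d @ p) (bsource G \<zeta>)" using \<open>awalk v' d _\<close> 2(3) by (rule awalk_appendI)
    moreover have "\<kappa> = prepend (d @ p) \<zeta>" using \<open>\<kappa> = _\<close> 2(2) by (simp add: prepend_append)
    ultimately show ?thesis unfolding moves_def using 1 by blast
  qed
qed

text \<open>
Continuity of the action: replacing an initial segment shifts the agreement of two paths by at most
the length of the word.
\<close>

lemma moves_agree:
  assumes "moves t \<xi> \<eta>" "moves t \<xi>' \<eta>'" "agree G (m + length t) \<xi> \<xi>'"
  shows "agree G m \<eta> \<eta>'"
proof -
  let ?a = "pos_part t" and ?b = "neg_part t"
  from assms(1) obtain \<zeta> u v where 1: "\<zeta> \<in> bpaths G"
    "awalk u ?a (bsource G \<zeta>)" "awalk v ?b (bsource G \<zeta>)"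
    "\<xi> = prepend ?a \<zeta>" "\<eta> = prepend ?b \<zeta>"
    by (rule moves_normal_form)
  from assms(2) obtain \<zeta>' u' v' where 2: "\<zeta>' \<in> bpaths G"
    "awalk u' ?a (bsource G \<zeta>')" "awalk v' ?b (bsource G \<zeta>')"
    "\<xi>' = prepend ?a \<zeta>'" "\<eta>' = prepend ?b \<zeta>'"
    by (rule moves_normal_form)
  have "length ?a \<le> length t" by (simp add: pos_part_def length_takeWhile_le)
  then have "agree G (m + length ?a) \<xi> \<xi>'" using assms(3) by (auto intro: agree_mono)
  then have "agree G m \<zeta> \<zeta>'" unfolding 1(4) 2(4) by (rule agree_prependD[OF _ 1(2) 2(2)])
  then have "agree G (m + length ?b) \<eta> \<eta>'" unfolding 1(5) 2(5) by (rule agree_prependI[OF _ 1(3)])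
  then show ?thesis by (rule agree_mono) simp
qed

lemma moves_of_path_iff:
  assumes "awalk v p w" "p \<noteq> []"
  shows "moves (of_path p) \<xi> \<eta> \<longleftrightarrow> \<eta> \<in> bpaths G \<and> bsource G \<eta> = w \<and> \<xi> = prepend p \<eta>"
proof
  assume m: "moves (of_path p) \<xi> \<eta>"
  have parts: "pos_part (of_path p) = p" "neg_part (of_path p) = []"
    using pos_part_word[of p "[]"] neg_part_word[of p "[]"] by simp_all
  from m obtain \<zeta> u where "\<zeta> \<in> bpaths G" "awalk u p (bsource G \<zeta>)" "\<xi> = prepend p \<zeta>" "\<eta> = prepend [] \<zeta>"
    using moves_normal_form[OF m] unfolding parts by blast
  then show "\<eta> \<in> bpaths G \<and> bsource G \<eta> = w \<and> \<xi> = prepend p \<eta>"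
    using awalk_fpaths(3)[OF _ assms(2)] assms(1) by (metis prepend_Nil)
next
  assume *: "\<eta> \<in> bpaths G \<and> bsource G \<eta> = w \<and> \<xi> = prepend p \<eta>"
  have "of_path p = of_path p \<otimes>\<^bsub>FG G\<^esub> inv\<^bsub>FG G\<^esub> (of_path [])"
    using of_path_awalk_closed[OF assms(1)] F.inv_one by simp
  moreover have "awalk (bsource G \<eta>) [] (bsource G \<eta>)"
    using * bsource_in_verts[of \<eta>] by (simp add: awalk_Nil_iff)
  moreover have "awalk v p (bsource G \<eta>)" "\<eta> = prepend [] \<eta>" using * assms(1) by simp_all
  ultimately show "moves (of_path p) \<xi> \<eta>"
    unfolding moves_def using * by blast
qed

end

section \<open>The coefficient algebra and its cylinder sets\<close>

interpretation fscale: module "fscale :: 'k::field \<Rightarrow> ('x \<Rightarrow> 'k) \<Rightarrow> 'x \<Rightarrow> 'k"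
  by (rule module_fscale)

lemma indicator_inter_mult:
  "indicator (A \<inter> B) = (indicator A * indicator B :: 'x \<Rightarrow> 'k::field)"
  by (simp add: fun_eq_iff indicator_def)

lemma Xset_Nil [simp]: "Xset G [] = bpaths G"
  by (auto simp: Xset_def)

text \<open>
The vertex is part of the data so that \<open>Cyl G v []\<close> covers the sets \<open>X_v\<close>, and the indicators of all
the sets \<open>Cyl G v a\<close> form one uniform spanning set of \<open>D0\<close>.
\<close>

definition Cyl :: "('v, 'e) pre_digraph \<Rightarrow> 'v \<Rightarrow> 'e list \<Rightarrow> ('v, 'e) bpath set" where
  "Cyl G v a = {\<xi> \<in> bpaths G. bsource G \<xi> = v \<and> starts_with \<xi> a}"

lemma Cyl_Int_Cyl:
  fixes G :: "('v, 'e) pre_digraph"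
  shows "Cyl G v a \<inter> Cyl G w b \<in> {{}, Cyl G v a, Cyl G w b}"
proof -
  have *: "Cyl G v a \<inter> Cyl G w b \<in> {{}, Cyl G v a}" if "length b \<le> length a" for v w a b
  proof -
    have "take (length b) a = b" if "starts_with \<xi> a" "starts_with \<xi> b" for \<xi> :: "('v, 'e) bpath"
    proof -
      have "take (length b) (initial (length a) \<xi>) = initial (length b) \<xi>"
        using \<open>length b \<le> length a\<close> by (simp add: take_initial min_absorb1)
      then show ?thesis using that by (simp add: starts_with_iff_initial)
    qed
    moreover have "starts_with \<xi> b" if "starts_with \<xi> a" "take (length b) a = b" for \<xi> :: "('v, 'e) bpath"
      using that \<open>length b \<le> length a\<close> take_initial[of "length b" "length a" \<xi>]
      by (simp add: starts_with_iff_initial min_absorb1)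
    ultimately have "Cyl G v a \<inter> Cyl G w b = (if v = w \<and> take (length b) a = b then Cyl G v a else {})"
      unfolding Cyl_def by (simp split: if_split) blast
    then show ?thesis by simp
  qed
  show ?thesis using *[of b a v w] *[of a b w v] by (cases "length b \<le> length a") (auto simp: Int_commute)
qed

context wf_digraph
begin

text \<open>
For \<open>t \<noteq> 1\<close> the normal form \<open>ab\<^sup>-\<^sup>1\<close> contains at least one arc, and this arc determines the common
endpoint of \<open>a\<close> and \<open>b\<close>. For \<open>t = 1\<close> both paths are empty and any source can occur.
\<close>

lemma moves_sources:
  assumes "moves t \<xi> \<eta>" "moves t \<xi>' \<eta>'" "t \<noteq> []"
  shows "bsource G \<xi> = bsource G \<xi>'" "bsource G \<eta> = bsource G \<eta>'"
proof -
  let ?a = "pos_part t" and ?b = "neg_part t"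
  from assms(1) obtain \<zeta> u v where 1: "\<zeta> \<in> bpaths G"
    "awalk u ?a (bsource G \<zeta>)" "awalk v ?b (bsource G \<zeta>)"
    "\<xi> = prepend ?a \<zeta>" "\<eta> = prepend ?b \<zeta>" and t: "t = of_path ?a @ inv_word (of_path ?b)"
    by (rule moves_normal_form)
  from assms(2) obtain \<zeta>' u' v' where 2: "\<zeta>' \<in> bpaths G"
    "awalk u' ?a (bsource G \<zeta>')" "awalk v' ?b (bsource G \<zeta>')"
    "\<xi>' = prepend ?a \<zeta>'" "\<eta>' = prepend ?b \<zeta>'"
    by (rule moves_normal_form)
  have "?a \<noteq> [] \<or> ?b \<noteq> []" using t assms(3) by (metis append_Nil inv_word_Nil of_path_Nil)
  then have \<zeta>: "bsource G \<zeta> = bsource G \<zeta>'"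
    using awalk_fpaths(3)[OF 1(2)] awalk_fpaths(3)[OF 1(3)] awalk_fpaths(3)[OF 2(2)] awalk_fpaths(3)[OF 2(3)]
    by auto
  have "u = u'" using awalk_fpaths(2)[OF 1(2)] awalk_fpaths(2)[OF 2(2)] \<zeta> 1(2) 2(2)
    by (cases "?a = []") (auto simp: awalk_Nil_iff)
  then show "bsource G \<xi> = bsource G \<xi>'" using bsource_prepend[OF 1(2)] bsource_prepend[OF 2(2)] 1 2 by simp
  have "v = v'" using awalk_fpaths(2)[OF 1(3)] awalk_fpaths(2)[OF 2(3)] \<zeta> 1(3) 2(3)
    by (cases "?b = []") (auto simp: awalk_Nil_iff)
  then show "bsource G \<eta> = bsource G \<eta>'" using bsource_prepend[OF 1(3)] bsource_prepend[OF 2(3)] 1 2 by simp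
qed

lemma moves_cylinder:
  assumes "moves t \<xi> \<eta>" "\<xi>' \<in> Cyl G (bsource G \<xi>) (pos_part t)"
  shows "\<xi>' \<in> Xset G t"
proof -
  let ?a = "pos_part t" and ?b = "neg_part t"
  from assms(1) obtain \<zeta> u v where \<zeta>: "\<zeta> \<in> bpaths G"
    "awalk u ?a (bsource G \<zeta>)" "awalk v ?b (bsource G \<zeta>)" "\<xi> = prepend ?a \<zeta>"
    and t: "t = of_path ?a @ inv_word (of_path ?b)" "reduced t"
    by (rule moves_normal_form)
  from assms(2) have \<xi>': "\<xi>' \<in> bpaths G" "starts_with \<xi>' ?a" "bsource G \<xi>' = bsource G \<xi>"
    by (auto simp: Cyl_def)
  from starts_withE[OF \<xi>'(1,2)] obtain \<zeta>' where \<zeta>': "\<zeta>' \<in> bpaths G"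
    "\<xi>' = prepend ?a \<zeta>'" "awalk (bsource G \<xi>') ?a (bsource G \<zeta>')" .
  have *: "bsource G \<zeta>' = bsource G \<zeta>"
    using awalk_fpaths(3)[OF \<zeta>(2)] awalk_fpaths(3)[OF \<zeta>'(3)] \<xi>'(3) \<zeta> \<zeta>'
    by (cases "?a = []") auto
  have "t = of_path ?a \<otimes>\<^bsub>FG G\<^esub> inv\<^bsub>FG G\<^esub> (of_path ?b)"
    using t free_group_mult_reduced[of "of_path ?a" "inv_word (of_path ?b)"] awalk_arcs[OF \<zeta>(3)]
    by (simp add: inv_of_path)
  then have "moves t \<xi>' (prepend ?b \<zeta>')"
    unfolding moves_def using \<zeta>(3) \<zeta>' * by (metis (no_types))
  then show ?thesis by (simp add: moves_iff)
qed

lemma Xset_subset_bpaths: "Xset G t \<subseteq> bpaths G"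
  by (auto simp: Xset_def)

lemma Xset_eq_Cyl:
  assumes "t \<noteq> []" "\<xi> \<in> Xset G t"
  shows "Xset G t = Cyl G (bsource G \<xi>) (pos_part t)"
proof (intro equalityI subsetI)
  from assms(2) obtain \<eta> where m: "moves t \<xi> \<eta>" by (auto simp: moves_iff)
  fix \<xi>'
  show "\<xi>' \<in> Xset G t" if "\<xi>' \<in> Cyl G (bsource G \<xi>) (pos_part t)"
    by (rule moves_cylinder[OF m that])
  assume x: "\<xi>' \<in> Xset G t"
  then obtain \<eta>' where m': "moves t \<xi>' \<eta>'" by (auto simp: moves_iff)
  obtain \<zeta> where "\<xi>' = prepend (pos_part t) \<zeta>" using moves_normal_form[OF m'] by blast
  then show "\<xi>' \<in> Cyl G (bsource G \<xi>) (pos_part t)"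
    using x Xset_subset_bpaths moves_sources(1)[OF m m' assms(1)] starts_with_prepend
    by (auto simp: Cyl_def)
qed

lemma Xset_outside: "t \<notin> carrier (FG G) \<Longrightarrow> Xset G t = {}"
  using moves_closed moves_iff by blast

text \<open>
Every nonempty \<open>X_p\<close> with \<open>p \<noteq> 1\<close> is a cylinder set, and every nonempty cylinder set is some \<open>X_a\<close> or
\<open>X_v\<close>. The span of cylinder indicators is the form of \<open>D0\<close> on which all inductions below are based.
\<close>

lemma D0_eq_span:
  "(D0 G :: (('a, 'b) bpath \<Rightarrow> 'k::field) set) = fscale.span {indicator (Cyl G v a) | v a. True}"
  (is "_ = fscale.span ?C")
  unfolding D0_def fscale.span_eq
proof (intro conjI subsetI)
  let ?S = "{indicator (Xset G p) | p. p \<in> carrier (FG G) - {\<one>\<^bsub>FG G\<^esub>}} \<union>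
      {indicator (Xvert G v) | v. v \<in> verts G} :: (('a, 'b) bpath \<Rightarrow> 'k) set"
  have ind0: "(indicator {} :: ('a, 'b) bpath \<Rightarrow> 'k) = 0" by (simp add: fun_eq_iff)
  fix f :: "('a, 'b) bpath \<Rightarrow> 'k"
  show "f \<in> fscale.span ?C" if "f \<in> ?S"
    using that
  proof (elim UnE CollectE exE conjE)
    fix p assume p: "f = indicator (Xset G p)" "p \<in> carrier (FG G) - {\<one>\<^bsub>FG G\<^esub>}"
    show ?thesis
    proof (cases "Xset G p = {}")
      case True
      then show ?thesis using p(1) ind0 by (simp only: fscale.span_zero)
    next
      case False
      then obtain \<xi> where \<xi>: "\<xi> \<in> Xset G p" by blast
      have "p \<noteq> []" using p(2) by simp
      then have "f = indicator (Cyl G (bsource G \<xi>) (pos_part p))" using p(1) Xset_eq_Cyl[OF _ \<xi>] by simp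
      then show ?thesis by (intro fscale.span_base CollectI exI conjI TrueI)
    qed
  next
    fix v assume v: "f = indicator (Xvert G v)"
    have "Xvert G v = Cyl G v []" by (auto simp: Cyl_def Xvert_def)
    with v have "f = indicator (Cyl G v [])" by simp
    then show ?thesis by (intro fscale.span_base CollectI exI conjI TrueI)
  qed
  assume "f \<in> ?C"
  then obtain v a where f: "f = indicator (Cyl G v a)" by blast
  show "f \<in> fscale.span ?S"
  proof (cases "Cyl G v a = {}")
    case True
    then show ?thesis using f ind0 by (simp only: fscale.span_zero)
  next
    case False
    then obtain \<xi> where \<xi>: "\<xi> \<in> bpaths G" "bsource G \<xi> = v" "starts_with \<xi> a" by (auto simp: Cyl_def)
    show ?thesis
    proof (cases "a = []")
      case True
      then have "Cyl G v a = Xvert G v" by (auto simp: Cyl_def Xvert_def)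
      with f have "f = indicator (Xvert G v)" by simp
      moreover have "v \<in> verts G" using \<xi> bsource_in_verts by blast
      ultimately show ?thesis by (intro fscale.span_base UnI2 CollectI exI conjI)
    next
      case False
      obtain \<zeta> where "awalk v a (bsource G \<zeta>)" using starts_withE[OF \<xi>(1,3)] \<xi>(2) by blast
      then have a: "a \<in> fpaths G" "of_path a \<in> carrier (FG G)"
        using False by (auto intro: awalk_fpaths of_path_awalk_closed)
      have "\<xi> \<in> Xset G (of_path a)" using \<xi> a unfolding Xset_def by blast
      then have "Xset G (of_path a) = Cyl G v a"
        using Xset_eq_Cyl[of "of_path a" \<xi>] \<xi> False pos_part_word[of a "[]"] by (simp add: of_path_def)
      moreover have "of_path a \<noteq> []" using False by (simp add: of_path_def)
      ultimately have "f = indicator (Xset G (of_path a))" "of_path a \<in> carrier (FG G) - {\<one>\<^bsub>FG G\<^esub>}"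
        using f a by simp_all
      then show ?thesis by (intro fscale.span_base UnI1 CollectI exI conjI)
    qed
  qed
qed

lemma D0_zero: "0 \<in> D0 G"
  and D0_add: "f \<in> D0 G \<Longrightarrow> g \<in> D0 G \<Longrightarrow> f + g \<in> D0 G"
  and D0_uminus: "f \<in> D0 G \<Longrightarrow> - f \<in> D0 G"
  and D0_scale: "f \<in> D0 G \<Longrightarrow> fscale c f \<in> D0 G"
  by (auto simp: D0_eq_span intro: fscale.span_zero fscale.span_add fscale.span_neg fscale.span_scale)

lemma D0_sum: "(\<And>i. i \<in> A \<Longrightarrow> f i \<in> D0 G) \<Longrightarrow> sum f A \<in> D0 G"
  unfolding D0_eq_span by (rule fscale.span_sum)

lemma indicator_Cyl_in_D0: "indicator (Cyl G v a) \<in> D0 G"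
  unfolding D0_eq_span by (rule fscale.span_base) blast

lemma D0_induct [consumes 1, case_names zero step]:
  assumes "f \<in> D0 G" "P 0"
    "\<And>c v a f. f \<in> D0 G \<Longrightarrow> P f \<Longrightarrow> P (fscale c (indicator (Cyl G v a)) + f)"
  shows "P f"
proof -
  from assms(1) have "f \<in> fscale.span {indicator (Cyl G v a) | v a. True}"
    by (simp only: D0_eq_span)
  then have "f \<in> D0 G \<and> P f"
  proof (induction rule: fscale.span_induct_alt)
    case (step c x y)
    then obtain v a where "x = indicator (Cyl G v a)" by blast
    then show ?case using step assms(3) D0_add[OF D0_scale[OF indicator_Cyl_in_D0]] by blast
  next
    case base
    show ?case using D0_zero assms(2) ..
  qed
  then show ?thesis ..
qed

text \<open>
Two cylinder sets are disjoint or nested, so the product of two spanning elements is zero or one of them.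
\<close>

lemma D0_mult:
  assumes "f \<in> D0 G" "g \<in> D0 G"
  shows "f * g \<in> D0 G"
  using assms(1)
proof (induction rule: D0_induct)
  case (step c v a f)
  have "indicator (Cyl G v a) * g \<in> D0 G"
    using assms(2)
  proof (induction rule: D0_induct)
    case (step d w b g)
    have "indicator (Cyl G v a \<inter> Cyl G w b) \<in> {0, indicator (Cyl G v a), indicator (Cyl G w b) :: ('a, 'b) bpath \<Rightarrow> 'c}"
      using Cyl_Int_Cyl[of G v a w b] by (auto simp: fun_eq_iff)
    then have "(indicator (Cyl G v a) * indicator (Cyl G w b) :: ('a, 'b) bpath \<Rightarrow> 'c) \<in> D0 G"
      unfolding indicator_inter_mult using D0_zero indicator_Cyl_in_D0 by (metis empty_iff insert_iff)
    moreover have "indicator (Cyl G v a) * (fscale d (indicator (Cyl G w b)) + g) =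
       fscale d (indicator (Cyl G v a) * indicator (Cyl G w b)) + indicator (Cyl G v a) * g"
      by (simp add: fun_eq_iff fscale_def algebra_simps)
    ultimately show ?case using step D0_add D0_scale by metis
  qed (simp only: mult_zero_right D0_zero)
  moreover have "(fscale c (indicator (Cyl G v a)) + f) * g = fscale c (indicator (Cyl G v a) * g) + f * g"
    by (simp add: fun_eq_iff fscale_def algebra_simps)
  ultimately show ?case using step D0_add D0_scale by metis
qed (simp only: mult_zero_left D0_zero)

lemma D0_vanishes: "f \<in> D0 G \<Longrightarrow> f \<xi> \<noteq> 0 \<Longrightarrow> \<xi> \<in> bpaths G"
proof -
  assume "f \<in> D0 G"
  then have "f \<xi> \<noteq> 0 \<longrightarrow> \<xi> \<in> bpaths G"
    by (induction rule: D0_induct) (auto simp: fscale_def Cyl_def indicator_def)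
  then show "f \<xi> \<noteq> 0 \<Longrightarrow> \<xi> \<in> bpaths G" by blast
qed

lemma indicator_Xset_in_D0:
  assumes "t \<noteq> []"
  shows "(indicator (Xset G t) :: ('a, 'b) bpath \<Rightarrow> 'k::field) \<in> D0 G"
proof (cases "Xset G t = {}")
  case True
  then have "(indicator (Xset G t) :: ('a, 'b) bpath \<Rightarrow> 'k) = 0" by (simp add: fun_eq_iff)
  then show ?thesis by (simp only: D0_zero)
next
  case False
  then obtain \<xi> where "\<xi> \<in> Xset G t" by blast
  from Xset_eq_Cyl[OF assms this] show ?thesis by (simp only: indicator_Cyl_in_D0)
qed

text \<open>
Since \<open>D0\<close> is closed under multiplication by \<open>1_t\<close>, membership in the ideal \<open>D_t\<close> is a condition on
the support.
\<close>

lemma in_D_iff: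
  assumes "t \<in> carrier (FG G)"
  shows "f \<in> D G t \<longleftrightarrow> f \<in> D0 G \<and> (\<forall>\<xi>. f \<xi> \<noteq> 0 \<longrightarrow> \<xi> \<in> Xset G t)"
proof (cases "t = []")
  case True
  then show ?thesis using D0_vanishes by (auto simp: D_def)
next
  case False
  have "f \<in> D G t" if "f \<in> D0 G" "\<forall>\<xi>. f \<xi> \<noteq> 0 \<longrightarrow> \<xi> \<in> Xset G t"
  proof -
    have "f = indicator (Xset G t) * f" using that(2) by (auto simp: fun_eq_iff indicator_def)
    then show ?thesis using False that(1) by (auto simp: D_def)
  qed
  moreover have "f \<in> D0 G \<and> (\<forall>\<xi>. f \<xi> \<noteq> 0 \<longrightarrow> \<xi> \<in> Xset G t)" if "f \<in> D G t"
    using that False D0_mult indicator_Xset_in_D0[OF False] by (auto simp: D_def indicator_def)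
  ultimately show ?thesis by blast
qed

text \<open>
The preimage of a cylinder set under \<open>ab\<^sup>-\<^sup>1\<close> is empty or the part of \<open>X_t\<close> lying in another cylinder
set: \<open>b\<zeta>\<close> starts with \<open>d\<close> if and only if \<open>\<zeta>\<close> starts with what remains of \<open>d\<close> beyond \<open>b\<close>, provided that
\<open>b\<close> and \<open>d\<close> are comparable, and this is then a condition on the initial segment of \<open>a\<zeta>\<close>.
\<close>

lemma alpha_in_D0:
  assumes "f \<in> D0 G"
  shows "alpha G t f \<in> D0 G"
  using assms
proof (induction rule: D0_induct)
  case zero
  have "alpha G t 0 = (0 :: ('a, 'b) bpath \<Rightarrow> 'c)" by (simp add: fun_eq_iff alpha_def)
  then show ?case by (simp only: D0_zero)
next
  case (step c v d f)
  let ?i = "indicator (Cyl G v d) :: ('a, 'b) bpath \<Rightarrow> 'c"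
  have "alpha G t ?i \<in> D0 G"
  proof (cases "t = []")
    case True
    have "theta G [] \<xi> = \<xi>" if "\<xi> \<in> bpaths G" for \<xi>
      using moves_one[OF that] F.inv_one moves_iff[of "[]" \<xi> \<xi>] by simp
    then have "alpha G t ?i = ?i" using True F.inv_one by (auto simp: fun_eq_iff alpha_def Cyl_def indicator_def)
    then show ?thesis using indicator_Cyl_in_D0 by simp
  next
    case False
    let ?a = "pos_part t" and ?b = "neg_part t"
    let ?S = "{\<xi> \<in> Xset G t. theta G (inv\<^bsub>FG G\<^esub> t) \<xi> \<in> Cyl G v d}"
    have S: "alpha G t ?i = indicator ?S" by (auto simp: fun_eq_iff alpha_def indicator_def)
    show ?thesis
    proof (cases "?S = {}")
      case True
      have "alpha G t ?i = 0" unfolding S True by (simp add: fun_eq_iff)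
      then show ?thesis by (simp only: D0_zero)
    next
      case nonempty: False
      then obtain \<xi>0 where "\<xi>0 \<in> ?S" by blast
      then obtain \<eta>0 where m0: "moves t \<xi>0 \<eta>0" "\<eta>0 \<in> Cyl G v d" by (auto simp: moves_iff)
      have split: "\<eta> \<in> Cyl G v d \<longleftrightarrow> \<xi> \<in> Cyl G (bsource G \<xi>0) (?a @ drop (length ?b) d)"
        if m: "moves t \<xi> \<eta>" for \<xi> \<eta>
      proof -
        obtain \<zeta> where \<zeta>: "\<xi> = prepend ?a \<zeta>" "\<eta> = prepend ?b \<zeta>"
          using moves_normal_form[OF m] by blast
        obtain \<zeta>0 where \<zeta>0: "\<eta>0 = prepend ?b \<zeta>0"
          using moves_normal_form[OF m0(1)] by blast
        have d0: "take (length d) ?b @ initial (length d - length ?b) \<zeta>0 = d"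
          using m0(2) \<zeta>0 by (simp add: Cyl_def starts_with_iff_initial initial_prepend)
        have d: "take (length d) ?b @ drop (length ?b) d = d"
        proof (cases "length d \<le> length ?b")
          case True
          then have "initial (length d - length ?b) \<zeta>0 = []" using arg_cong[OF d0, of length] by simp
          then show ?thesis using d0 True by simp
        next
          case False
          then have "take (length d) ?b = ?b" "take (length ?b) d = ?b"
            using arg_cong[OF d0, of "take (length ?b)"] by simp_all
          then show ?thesis using append_take_drop_id[of "length ?b" d] by (simp only:)
        qed
        have "starts_with \<eta> d \<longleftrightarrow> initial (length d - length ?b) \<zeta> = drop (length ?b) d"
          using \<zeta>(2) d same_append_eq[of "take (length d) ?b" _ "drop (length ?b) d"]
          by (simp add: initial_prepend starts_with_iff_initial)
        also have "\<dots> \<longleftrightarrow> starts_with \<xi> (?a @ drop (length ?b) d)"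
          using \<zeta> by (simp add: starts_with_iff_initial initial_prepend)
        finally show ?thesis
          using moves_sources[OF m m0(1) False] moves_in_bpaths[OF m] m0(2) by (auto simp: Cyl_def)
      qed
      have "?S = Xset G t \<inter> Cyl G (bsource G \<xi>0) (?a @ drop (length ?b) d)"
        using split by (auto simp: moves_iff)
      then show ?thesis unfolding S
        using D0_mult[OF indicator_Xset_in_D0[OF False] indicator_Cyl_in_D0]
        by (simp add: indicator_inter_mult)
    qed
  qed
  moreover have "alpha G t (fscale c ?i + f) = fscale c (alpha G t ?i) + alpha G t f"
    by (auto simp: fun_eq_iff alpha_def fscale_def)
  ultimately show ?case using step D0_add D0_scale by metis
qed

lemma D0_locally_constant:
  assumes "f \<in> D0 G"
  obtains n where "\<And>\<xi> \<eta>. \<xi> \<in> bpaths G \<Longrightarrow> \<eta> \<in> bpaths G \<Longrightarrow> agree G n \<xi> \<eta> \<Longrightarrow> f \<xi> = f \<eta>"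
proof -
  have "\<exists>n. \<forall>\<xi>\<in>bpaths G. \<forall>\<eta>\<in>bpaths G. agree G n \<xi> \<eta> \<longrightarrow> f \<xi> = f \<eta>"
    using assms
  proof (induction rule: D0_induct)
    case (step c v a f)
    then obtain n where n: "\<forall>\<xi>\<in>bpaths G. \<forall>\<eta>\<in>bpaths G. agree G n \<xi> \<eta> \<longrightarrow> f \<xi> = f \<eta>" by blast
    have "\<xi> \<in> Cyl G v a \<longleftrightarrow> \<eta> \<in> Cyl G v a"
      if "\<xi> \<in> bpaths G" "\<eta> \<in> bpaths G" "agree G (length a) \<xi> \<eta>" for \<xi> \<eta>
    proof -
      have "starts_with \<xi> a \<longleftrightarrow> starts_with \<eta> a" "bsource G \<xi> = bsource G \<eta>"
        using that(3) unfolding starts_with_iff_initial agree_def by (simp_all only:)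
      then show ?thesis using that(1,2) by (simp add: Cyl_def)
    qed
    note cyl = this
    have "(fscale c (indicator (Cyl G v a)) + f) \<xi> = (fscale c (indicator (Cyl G v a)) + f) \<eta>"
      if "\<xi> \<in> bpaths G" "\<eta> \<in> bpaths G" "agree G (max n (length a)) \<xi> \<eta>" for \<xi> \<eta>
    proof -
      have "f \<xi> = f \<eta>" using n that(1,2) agree_mono[OF that(3) max.cobounded1] by blast
      moreover have "\<xi> \<in> Cyl G v a \<longleftrightarrow> \<eta> \<in> Cyl G v a"
        by (rule cyl[OF that(1,2) agree_mono[OF that(3) max.cobounded2]])
      ultimately show ?thesis by (simp add: fscale_def indicator_def)
    qed
    then show ?case by (intro exI[of _ "max n (length a)"]) blast
  qed simp
  with that show ?thesis by blast
qed

lemma D0_finitely_many_sources: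
  assumes "f \<in> D0 G"
  obtains S where "finite S" "S \<subseteq> verts G" "\<And>\<xi>. f \<xi> \<noteq> 0 \<Longrightarrow> bsource G \<xi> \<in> S"
proof -
  have "\<exists>S. finite S \<and> (\<forall>\<xi>. f \<xi> \<noteq> 0 \<longrightarrow> bsource G \<xi> \<in> S)"
    using assms
  proof (induction rule: D0_induct)
    case (step c v a f)
    then obtain S where "finite S" "\<forall>\<xi>. f \<xi> \<noteq> 0 \<longrightarrow> bsource G \<xi> \<in> S" by blast
    then show ?case
      by (intro exI[of _ "insert v S"]) (auto simp: fscale_def Cyl_def indicator_def)
  qed auto
  then obtain S where "finite S" "\<forall>\<xi>. f \<xi> \<noteq> 0 \<longrightarrow> bsource G \<xi> \<in> S" by blast
  then show ?thesis using D0_vanishes[OF assms] bsource_in_verts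
    by (intro that[of "S \<inter> verts G"]) auto
qed

text \<open>
If \<open>\<eta>\<close> has fewer than \<open>n\<close> arcs, then it ends in a sink, no other boundary path from its source has
\<open>\<eta>\<close> as a prefix, and both sides are \<open>{\<eta>}\<close>.
\<close>

lemma agree_eq_Cyl:
  assumes "\<eta> \<in> bpaths G"
  shows "{\<kappa> \<in> bpaths G. agree G n \<eta> \<kappa>} = Cyl G (bsource G \<eta>) (initial n \<eta>)"
proof (intro equalityI subsetI)
  fix \<kappa> assume \<kappa>: "\<kappa> \<in> {\<kappa> \<in> bpaths G. agree G n \<eta> \<kappa>}"
  have len: "length (initial n \<kappa>) \<le> n" by (cases \<kappa>) auto
  have "take (length (initial n \<kappa>)) (initial n \<kappa>) = initial n \<kappa>" by simp
  then have "initial (length (initial n \<kappa>)) \<kappa> = initial n \<kappa>"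
    using len by (simp add: take_initial min_absorb1)
  then show "\<kappa> \<in> Cyl G (bsource G \<eta>) (initial n \<eta>)"
    using \<kappa> by (auto simp: Cyl_def agree_def starts_with_iff_initial)
next
  fix \<kappa> assume "\<kappa> \<in> Cyl G (bsource G \<eta>) (initial n \<eta>)"
  then have \<kappa>: "\<kappa> \<in> bpaths G" "bsource G \<kappa> = bsource G \<eta>" "starts_with \<kappa> (initial n \<eta>)"
    by (auto simp: Cyl_def)
  have sinkV: "\<zeta> = Vtx v" if "\<zeta> \<in> bpaths G" "bsource G \<zeta> = v" "sink G v" for \<zeta> v
  proof (cases \<zeta>)
    case (Fin p)
    then have "p \<in> fpaths G" "psource G p = v" using that by (auto simp: in_bpaths)
    then have "hd p \<in> out_arcs G v" using fpaths_awalk[of p]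
      by (cases p) (auto simp: fpaths_def psource_def awalk_Cons_iff)
    then show ?thesis using that unfolding sink_def by blast
  next
    case (Inf w)
    then have "shd w \<in> out_arcs G v" using that by (cases w) (auto simp: in_bpaths)
    then show ?thesis using that unfolding sink_def by blast
  qed (use that in simp)
  have "agree G n \<eta> \<kappa>"
  proof (cases "length (initial n \<eta>) = n")
    case True
    then show ?thesis using \<kappa> by (simp add: agree_def starts_with_iff_initial)
  next
    case False
    have "\<kappa> = \<eta>"
    proof (cases \<eta>)
      case (Vtx v)
      then show ?thesis using sinkV[OF \<kappa>(1)] \<kappa>(2) assms by (simp add: in_bpaths)
    next
      case (Fin p)
      then have p: "initial n \<eta> = p" using False by auto
      then have "starts_with \<kappa> p" using \<kappa> by simp
      from starts_withE[OF \<kappa>(1) this] obtain \<zeta> where \<zeta>: "\<zeta> \<in> bpaths G" "\<kappa> = prepend p \<zeta>"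
        "awalk (bsource G \<kappa>) p (bsource G \<zeta>)" .
      have "p \<in> fpaths G" "sink G (prange G p)" using assms Fin by (auto simp: in_bpaths)
      moreover have "p \<noteq> []" using calculation by (simp add: fpaths_def)
      ultimately have "\<zeta> = Vtx (prange G p)" using \<zeta>(1) awalk_fpaths(3)[OF \<zeta>(3)] by (intro sinkV) auto
      then show ?thesis using \<zeta>(2) Fin \<open>p \<noteq> []\<close> by simp
    next
      case (Inf w)
      then show ?thesis using False by simp
    qed
    then show ?thesis by simp
  qed
  with \<kappa> show "\<kappa> \<in> {\<kappa> \<in> bpaths G. agree G n \<eta> \<kappa>}" by simp
qed

end

section \<open>The ring as a convolution algebra\<close>

lemma sum_fun_apply: "(\<Sum>i\<in>A. f i) x = (\<Sum>i\<in>A. f i x :: 'b::comm_monoid_add)"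
  by (induction A rule: infinite_finite_induct) auto

context wf_digraph
begin

abbreviation R :: "('b word \<Rightarrow> ('a, 'b) bpath \<Rightarrow> 'k::field) ring" where
  "R \<equiv> graph_skew_ring G"

abbreviation act :: "'b word \<Rightarrow> ('a, 'b) bpath \<Rightarrow> ('a, 'b) bpath" where
  "act t \<equiv> theta G (inv\<^bsub>FG G\<^esub> t)"

text \<open>
The homogeneous element \<open>f \<delta>_t\<close>.
\<close>

definition single :: "'b word \<Rightarrow> (('a, 'b) bpath \<Rightarrow> 'k::field) \<Rightarrow> 'b word \<Rightarrow> ('a, 'b) bpath \<Rightarrow> 'k" where
  "single t f = (\<lambda>s. if s = t then f else 0)"

text \<open>
Words outside the free group have empty domain, hence the support condition already forces their
coefficients to vanish.
\<close>

lemma in_R_iff: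
  "a \<in> carrier R \<longleftrightarrow> finite {t. a t \<noteq> 0} \<and> (\<forall>t. a t \<in> D0 G) \<and> (\<forall>t \<xi>. a t \<xi> \<noteq> 0 \<longrightarrow> \<xi> \<in> Xset G t)"
proof -
  have "(\<forall>t\<in>carrier (FG G). a t \<in> D G t) \<and> (\<forall>t. t \<notin> carrier (FG G) \<longrightarrow> a t = 0) \<longleftrightarrow>
    (\<forall>t. a t \<in> D0 G) \<and> (\<forall>t \<xi>. a t \<xi> \<noteq> 0 \<longrightarrow> \<xi> \<in> Xset G t)" (is "?l \<longleftrightarrow> ?r")
  proof
    assume l: ?l
    show ?r
    proof (intro conjI allI impI)
      fix t show "a t \<in> D0 G"
        using l in_D_iff[of t "a t"] D0_zero by (cases "t \<in> carrier (FG G)") (auto simp only:)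
      fix \<xi> assume "a t \<xi> \<noteq> 0"
      then have "t \<in> carrier (FG G)" using l by (metis zero_fun_apply)
      then show "\<xi> \<in> Xset G t" using l in_D_iff[of t "a t"] \<open>a t \<xi> \<noteq> 0\<close> by blast
    qed
  next
    assume r: ?r
    show ?l
    proof (intro conjI ballI allI impI)
      show "a t \<in> D G t" if "t \<in> carrier (FG G)" for t
        using r by (simp add: in_D_iff[OF that])
      show "a t = 0" if "t \<notin> carrier (FG G)" for t
      proof
        show "a t \<xi> = 0 \<xi>" for \<xi> using r Xset_outside[OF that] by (metis empty_iff zero_fun_apply)
      qed
    qed
  qed
  then show ?thesis unfolding graph_skew_ring_def partial_skew_group_ring_def by (simp only: partial_object.simps mem_Collect_eq) blast
qed

lemma R_support: "a \<in> carrier R \<Longrightarrow> a t \<xi> \<noteq> 0 \<Longrightarrow> moves t \<xi> (act t \<xi>)"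
  by (simp add: in_R_iff moves_iff)

lemma R_support_closed: "a \<in> carrier R \<Longrightarrow> a t \<noteq> 0 \<Longrightarrow> t \<in> carrier (FG G)"
  using R_support moves_closed by (fastforce simp: fun_eq_iff)

lemma R_finite: "a \<in> carrier R \<Longrightarrow> finite {t. a t \<noteq> 0}"
  by (simp add: in_R_iff)

lemma R_zero: "\<zero>\<^bsub>R\<^esub> = (\<lambda>t. 0)"
  and R_add: "a \<oplus>\<^bsub>R\<^esub> b = (\<lambda>t. a t + b t)"
  by (simp_all add: graph_skew_ring_def partial_skew_group_ring_def)

lemma act_moves: "moves t \<xi> \<eta> \<Longrightarrow> act t \<xi> = \<eta>"
  by (simp add: moves_iff)

lemma alpha_apply: "\<xi> \<in> Xset G t \<Longrightarrow> alpha G t f \<xi> = f (act t \<xi>)"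
  by (simp add: alpha_def)

lemma R_mult_summand:
  assumes "a \<in> carrier R"
  shows "alpha G t (alpha G (inv\<^bsub>FG G\<^esub> t) (a t) * g) = a t * alpha G t g"
proof
  fix \<xi>
  show "alpha G t (alpha G (inv\<^bsub>FG G\<^esub> t) (a t) * g) \<xi> = (a t * alpha G t g) \<xi>"
  proof (cases "\<xi> \<in> Xset G t")
    case True
    then have m: "moves t \<xi> (act t \<xi>)" by (simp add: moves_iff)
    from moves_sym[OF this] have "act t \<xi> \<in> Xset G (inv\<^bsub>FG G\<^esub> t)" "act (inv\<^bsub>FG G\<^esub> t) (act t \<xi>) = \<xi>"
      by (simp_all add: moves_iff)
    then show ?thesis using True by (simp add: alpha_apply)
  next
    case False
    then show ?thesis by (simp add: alpha_def)
  qed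
qed

lemma R_mult_fun:
  assumes "a \<in> carrier R"
  shows "(a \<otimes>\<^bsub>R\<^esub> b) u = (\<Sum>(t, s) \<in> {(t, s). a t \<noteq> 0 \<and> b s \<noteq> 0 \<and> t \<otimes>\<^bsub>FG G\<^esub> s = u}. a t * alpha G t (b s))"
  by (simp add: graph_skew_ring_def partial_skew_group_ring_def R_mult_summand[OF assms])

text \<open>
Multiplication is convolution over the groupoid. The index sets \<open>A\<close> and \<open>B\<close> may be larger than the
supports, which allows sums for different elements to be taken over a common set.
\<close>

lemma R_mult_apply:
  assumes a: "a \<in> carrier R" and b: "b \<in> carrier R"
    and A: "finite A" "{t. a t \<noteq> 0} \<subseteq> A" and B: "finite B" "{t. b t \<noteq> 0} \<subseteq> B"
  shows "(a \<otimes>\<^bsub>R\<^esub> b) u \<xi> =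
    (\<Sum>t\<in>A. \<Sum>s\<in>B. if t \<otimes>\<^bsub>FG G\<^esub> s = u then a t \<xi> * b s (act t \<xi>) else 0)"
proof -
  let ?P = "{(t, s). a t \<noteq> 0 \<and> b s \<noteq> 0 \<and> t \<otimes>\<^bsub>FG G\<^esub> s = u}"
  let ?h = "\<lambda>(t, s). if t \<otimes>\<^bsub>FG G\<^esub> s = u then a t \<xi> * b s (act t \<xi>) else 0"
  have "(a \<otimes>\<^bsub>R\<^esub> b) u \<xi> = (\<Sum>p\<in>?P. (case p of (t, s) \<Rightarrow> a t * alpha G t (b s)) \<xi>)"
    unfolding R_mult_fun[OF a] by (rule sum_fun_apply)
  also have "\<dots> = sum ?h ?P"
  proof (rule sum.cong[OF refl])
    fix p assume "p \<in> ?P"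
    moreover have "a t \<xi> * alpha G t (b s) \<xi> = a t \<xi> * b s (act t \<xi>)" for t s
      using a by (cases "a t \<xi> = 0") (auto simp: in_R_iff alpha_apply)
    ultimately show "(case p of (t, s) \<Rightarrow> a t * alpha G t (b s)) \<xi> = ?h p" by auto
  qed
  also have "\<dots> = sum ?h (A \<times> B)"
  proof (rule sum.mono_neutral_left)
    show "finite (A \<times> B)" using A B by simp
    show "?P \<subseteq> A \<times> B" using A B by auto
    show "\<forall>p\<in>A \<times> B - ?P. ?h p = 0" by (auto split: if_splits)
  qed
  also have "\<dots> = (\<Sum>t\<in>A. \<Sum>s\<in>B. if t \<otimes>\<^bsub>FG G\<^esub> s = u then a t \<xi> * b s (act t \<xi>) else 0)"
    by (rule sum.cartesian_product[symmetric])
  finally show ?thesis .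
qed

lemma R_mult_nonzeroE:
  assumes a: "a \<in> carrier R" and b: "b \<in> carrier R" and nz: "(a \<otimes>\<^bsub>R\<^esub> b) u \<xi> \<noteq> 0"
  obtains t s where "t \<otimes>\<^bsub>FG G\<^esub> s = u" "a t \<xi> \<noteq> 0" "b s (act t \<xi>) \<noteq> 0"
proof -
  from nz have "(\<Sum>t\<in>{t. a t \<noteq> 0}. \<Sum>s\<in>{s. b s \<noteq> 0}.
      if t \<otimes>\<^bsub>FG G\<^esub> s = u then a t \<xi> * b s (act t \<xi>) else 0) \<noteq> 0"
    using R_mult_apply[OF a b R_finite[OF a] subset_refl R_finite[OF b] subset_refl] by simp
  then obtain t where "(\<Sum>s\<in>{s. b s \<noteq> 0}.
      if t \<otimes>\<^bsub>FG G\<^esub> s = u then a t \<xi> * b s (act t \<xi>) else 0) \<noteq> 0"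
    by (rule sum.not_neutral_contains_not_neutral)
  then obtain s where "(if t \<otimes>\<^bsub>FG G\<^esub> s = u then a t \<xi> * b s (act t \<xi>) else 0) \<noteq> 0"
    by (rule sum.not_neutral_contains_not_neutral)
  with that show ?thesis by (metis mult_not_zero)
qed

lemma R_mult_support:
  assumes a: "a \<in> carrier R" and b: "b \<in> carrier R"
  shows "{u. (a \<otimes>\<^bsub>R\<^esub> b) u \<noteq> 0} \<subseteq> (\<lambda>(t, s). t \<otimes>\<^bsub>FG G\<^esub> s) ` ({t. a t \<noteq> 0} \<times> {s. b s \<noteq> 0})"
proof
  fix u assume "u \<in> {u. (a \<otimes>\<^bsub>R\<^esub> b) u \<noteq> 0}"
  then have "(a \<otimes>\<^bsub>R\<^esub> b) u \<noteq> 0" by simp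
  then obtain \<xi> where "(a \<otimes>\<^bsub>R\<^esub> b) u \<xi> \<noteq> 0" by (auto simp: fun_eq_iff)
  from a b this obtain t s where "t \<otimes>\<^bsub>FG G\<^esub> s = u" "a t \<xi> \<noteq> 0" "b s (act t \<xi>) \<noteq> 0"
    by (rule R_mult_nonzeroE)
  then have "a t \<noteq> 0" "b s \<noteq> 0" "u = t \<otimes>\<^bsub>FG G\<^esub> s" by auto
  then show "u \<in> (\<lambda>(t, s). t \<otimes>\<^bsub>FG G\<^esub> s) ` ({t. a t \<noteq> 0} \<times> {s. b s \<noteq> 0})" by force
qed

lemma R_mult_closed:
  assumes a: "a \<in> carrier R" and b: "b \<in> carrier R"
  shows "a \<otimes>\<^bsub>R\<^esub> b \<in> carrier R"
  unfolding in_R_iff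
proof (intro conjI allI impI)
  show "finite {u. (a \<otimes>\<^bsub>R\<^esub> b) u \<noteq> 0}"
    by (rule finite_subset[OF R_mult_support[OF a b]]) (use R_finite[OF a] R_finite[OF b] in simp)
  show "(a \<otimes>\<^bsub>R\<^esub> b) u \<in> D0 G" for u
    unfolding R_mult_fun[OF a] using a b
    by (intro D0_sum) (auto intro!: D0_mult alpha_in_D0 simp: in_R_iff)
  fix u \<xi> assume "(a \<otimes>\<^bsub>R\<^esub> b) u \<xi> \<noteq> 0"
  with a b obtain t s where "t \<otimes>\<^bsub>FG G\<^esub> s = u" "a t \<xi> \<noteq> 0" "b s (act t \<xi>) \<noteq> 0"
    by (rule R_mult_nonzeroE)
  then have "moves u \<xi> (act s (act t \<xi>))"
    using moves_trans R_support[OF a] R_support[OF b] by blast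
  then show "\<xi> \<in> Xset G u" by (simp add: moves_iff)
qed

lemma R_add_closed:
  assumes "a \<in> carrier R" "b \<in> carrier R"
  shows "(\<lambda>t. a t + b t) \<in> carrier R"
proof -
  have "{t. a t + b t \<noteq> 0} \<subseteq> {t. a t \<noteq> 0} \<union> {t. b t \<noteq> 0}" by auto
  then have "finite {t. a t + b t \<noteq> 0}"
    by (rule finite_subset) (simp add: assms R_finite)
  moreover have "a t + b t \<in> D0 G" for t
    using assms unfolding in_R_iff by (intro D0_add) blast+
  moreover have "\<xi> \<in> Xset G t" if nz: "(a t + b t) \<xi> \<noteq> 0" for t \<xi>
  proof -
    have "a t \<xi> \<noteq> 0 \<or> b t \<xi> \<noteq> 0" using nz by auto
    then show ?thesis using assms unfolding in_R_iff by blast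
  qed
  ultimately show ?thesis unfolding in_R_iff by blast
qed

lemma R_uminus_closed: "a \<in> carrier R \<Longrightarrow> (\<lambda>t. - a t) \<in> carrier R"
  by (simp add: in_R_iff D0_uminus)

lemma R_zero_closed: "(\<lambda>t. 0) \<in> carrier R"
  using D0_zero by (simp add: in_R_iff zero_fun_def)

lemma R_add_group: "group (add_monoid R)"
proof (rule groupI)
  show "x \<otimes>\<^bsub>add_monoid R\<^esub> y \<in> carrier (add_monoid R)"
    if "x \<in> carrier (add_monoid R)" "y \<in> carrier (add_monoid R)" for x y
    using R_add_closed that by (simp add: R_add)
  show "\<exists>y\<in>carrier (add_monoid R). y \<otimes>\<^bsub>add_monoid R\<^esub> x = \<one>\<^bsub>add_monoid R\<^esub>"
    if "x \<in> carrier (add_monoid R)" for x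
    using R_uminus_closed that by (intro bexI[of _ "\<lambda>t. - x t"]) (simp_all add: R_add R_zero)
qed (simp_all add: R_add R_zero add.assoc R_zero_closed)

lemma R_add_inv:
  assumes "x \<in> carrier R"
  shows "inv\<^bsub>add_monoid R\<^esub> x = (\<lambda>t. - x t)"
  by (rule group.inv_equality[OF R_add_group])
    (use assms R_uminus_closed in \<open>simp_all add: R_add R_zero\<close>)

text \<open>
Spells out the abstract additive inverse as the pointwise negative, so that ideals can be tested
on coefficient functions.
\<close>

lemma two_sided_ideal_iff:
  "two_sided_ideal I R \<longleftrightarrow> I \<subseteq> carrier R \<and> (\<lambda>t. 0) \<in> I \<and>
    (\<forall>x\<in>I. \<forall>y\<in>I. (\<lambda>t. x t + y t) \<in> I) \<and> (\<forall>x\<in>I. (\<lambda>t. - x t) \<in> I) \<and>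
    (\<forall>x\<in>I. \<forall>r\<in>carrier R. r \<otimes>\<^bsub>R\<^esub> x \<in> I \<and> x \<otimes>\<^bsub>R\<^esub> r \<in> I)"
proof -
  have "additive_subgroup I R \<longleftrightarrow> subgroup I (add_monoid R)"
    by (auto simp: additive_subgroup_def)
  also have "\<dots> \<longleftrightarrow> I \<subseteq> carrier R \<and> (\<lambda>t. 0) \<in> I \<and>
    (\<forall>x\<in>I. \<forall>y\<in>I. (\<lambda>t. x t + y t) \<in> I) \<and> (\<forall>x\<in>I. (\<lambda>t. - x t) \<in> I)"
    unfolding subgroup_def using R_add_inv by (auto simp: R_add R_zero subset_iff)
  finally show ?thesis by (auto simp: two_sided_ideal_def)
qed

lemma R_mult_zero: "a \<otimes>\<^bsub>R\<^esub> (\<lambda>t. 0) = (\<lambda>t. 0)" "(\<lambda>t. 0) \<otimes>\<^bsub>R\<^esub> a = (\<lambda>t. 0)"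
  by (simp_all add: graph_skew_ring_def partial_skew_group_ring_def fun_eq_iff)

lemma trivial_ideals: "two_sided_ideal {\<lambda>t. 0} R" "two_sided_ideal (carrier R) R"
proof -
  let ?Z = "{\<lambda>t. 0} :: ('b word \<Rightarrow> ('a, 'b) bpath \<Rightarrow> 'c) set"
  have "r \<otimes>\<^bsub>R\<^esub> x \<in> ?Z \<and> x \<otimes>\<^bsub>R\<^esub> r \<in> ?Z" if "x \<in> ?Z" "r \<in> carrier R" for x r
  proof -
    have x: "x = (\<lambda>t. 0)" using that(1) by blast
    show ?thesis unfolding x R_mult_zero by blast
  qed
  moreover have "?Z \<subseteq> carrier R" using R_zero_closed by blast
  moreover have "(\<lambda>t. x t + y t) \<in> ?Z" "(\<lambda>t. - x t) \<in> ?Z" if "x \<in> ?Z" "y \<in> ?Z" for x y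
    using that by simp_all
  ultimately show "two_sided_ideal ?Z R"
    unfolding two_sided_ideal_iff by (meson singletonI)
  show "two_sided_ideal (carrier R) R"
    unfolding two_sided_ideal_iff
    by (intro conjI ballI subset_refl R_zero_closed R_add_closed R_uminus_closed R_mult_closed)
qed

lemma simple_ring_iff:
  "simple_ring (R :: ('b word \<Rightarrow> ('a, 'b) bpath \<Rightarrow> 'k::field) ring) \<longleftrightarrow>
    (\<forall>I :: ('b word \<Rightarrow> ('a, 'b) bpath \<Rightarrow> 'k) set. two_sided_ideal I R \<longrightarrow> I = {\<lambda>t. 0} \<or> I = carrier R)"
proof -
  have "{I. P I} = {A, B} \<longleftrightarrow> (\<forall>I. P I \<longrightarrow> I = A \<or> I = B)" if "P A" "P B" for P and A B :: "'x set"
    using that by blast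
  from this[OF trivial_ideals] show ?thesis unfolding simple_ring_def R_zero .
qed

lemma single_in_R:
  assumes "f \<in> D0 G" "\<And>\<xi>. f \<xi> \<noteq> 0 \<Longrightarrow> \<xi> \<in> Xset G t"
  shows "single t f \<in> carrier R"
proof -
  have "finite {s. single t f s \<noteq> 0}"
    by (rule finite_subset[of _ "{t}"]) (auto simp: single_def)
  moreover have "single t f s \<in> D0 G" for s
    by (cases "s = t") (simp_all only: single_def simp_thms if_True if_False assms(1) D0_zero)
  moreover have "\<xi> \<in> Xset G s" if "single t f s \<xi> \<noteq> 0" for s \<xi>
    using that assms(2) by (cases "s = t") (auto simp: single_def)
  ultimately show ?thesis unfolding in_R_iff by blast
qed

lemma single_Nil_in_R: "f \<in> D0 G \<Longrightarrow> single [] f \<in> carrier R"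
  by (rule single_in_R) (auto dest: D0_vanishes)

lemma single_Xset_in_R: "t \<noteq> [] \<Longrightarrow> single t (indicator (Xset G t)) \<in> carrier R"
  by (rule single_in_R[OF indicator_Xset_in_D0]) (simp_all add: indicator_def split: if_splits)

lemma R_single_mult:
  assumes "single t f \<in> carrier R" "b \<in> carrier R" "t \<in> carrier (FG G)" "u \<in> carrier (FG G)"
  shows "(single t f \<otimes>\<^bsub>R\<^esub> b) u \<xi> = f \<xi> * b (inv\<^bsub>FG G\<^esub> t \<otimes>\<^bsub>FG G\<^esub> u) (act t \<xi>)"
proof -
  let ?w = "inv\<^bsub>FG G\<^esub> t \<otimes>\<^bsub>FG G\<^esub> u"
  let ?B = "insert ?w {s. b s \<noteq> 0}"
  have B: "finite ?B" using R_finite[OF assms(2)] by simp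
  have eq: "t \<otimes>\<^bsub>FG G\<^esub> s = u \<longleftrightarrow> s = ?w" if "s \<in> ?B" for s
  proof -
    have "s \<in> carrier (FG G)" using that assms R_support_closed[OF assms(2)] by auto
    then show ?thesis using assms(3,4) by (metis F.inv_solve_left F.inv_closed F.m_closed)
  qed
  have "(single t f \<otimes>\<^bsub>R\<^esub> b) u \<xi> =
    (\<Sum>r\<in>{t}. \<Sum>s\<in>?B. if r \<otimes>\<^bsub>FG G\<^esub> s = u then single t f r \<xi> * b s (act r \<xi>) else 0)"
    by (rule R_mult_apply[OF assms(1,2)]) (use B in \<open>auto simp: single_def\<close>)
  also have "\<dots> = (\<Sum>s\<in>?B. if s = ?w then f \<xi> * b s (act t \<xi>) else 0)"
    using eq by (simp only: sum.insert[OF finite.emptyI] empty_iff sum.empty add_0_right not_False_eq_True)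
      (intro sum.cong refl, simp add: single_def)
  also have "\<dots> = f \<xi> * b ?w (act t \<xi>)" using B by (simp add: sum.delta)
  finally show ?thesis .
qed

lemma R_mult_single:
  assumes "b \<in> carrier R" "single s g \<in> carrier R" "s \<in> carrier (FG G)" "u \<in> carrier (FG G)"
  shows "(b \<otimes>\<^bsub>R\<^esub> single s g) u \<xi> =
    b (u \<otimes>\<^bsub>FG G\<^esub> inv\<^bsub>FG G\<^esub> s) \<xi> * g (act (u \<otimes>\<^bsub>FG G\<^esub> inv\<^bsub>FG G\<^esub> s) \<xi>)"
proof -
  let ?w = "u \<otimes>\<^bsub>FG G\<^esub> inv\<^bsub>FG G\<^esub> s"
  let ?B = "insert ?w {t. b t \<noteq> 0}"
  have B: "finite ?B" using R_finite[OF assms(1)] by simp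
  have eq: "t \<otimes>\<^bsub>FG G\<^esub> s = u \<longleftrightarrow> t = ?w" if "t \<in> ?B" for t
  proof -
    have "t \<in> carrier (FG G)" using that assms R_support_closed[OF assms(1)] by auto
    then show ?thesis using assms(3,4) by (metis F.inv_solve_right F.inv_closed F.m_closed)
  qed
  have "(b \<otimes>\<^bsub>R\<^esub> single s g) u \<xi> =
    (\<Sum>t\<in>?B. \<Sum>r\<in>{s}. if t \<otimes>\<^bsub>FG G\<^esub> r = u then b t \<xi> * single s g r (act t \<xi>) else 0)"
    by (rule R_mult_apply[OF assms(1,2)]) (use B in \<open>auto simp: single_def\<close>)
  also have "\<dots> = (\<Sum>t\<in>?B. if t = ?w then b t \<xi> * g (act t \<xi>) else 0)"
    using eq by (intro sum.cong refl) (simp add: single_def)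
  also have "\<dots> = b ?w \<xi> * g (act ?w \<xi>)" using B by (simp add: sum.delta)
  finally show ?thesis .
qed

end

section \<open>Ideals of hereditary saturated sets\<close>

context wf_digraph
begin

lemma hereditary_awalk: "hereditary G H \<Longrightarrow> awalk u p v \<Longrightarrow> u \<in> H \<Longrightarrow> v \<in> H"
  by (induction p arbitrary: u) (auto simp: awalk_simps hereditary_def)

text \<open>
The path \<open>\<xi>\<close> reaches \<open>H\<close> along a prefix all of whose arcs lie in \<open>F\<close>. The bound \<open>F\<close> matters at a vertex
outside \<open>H\<close> with infinitely many outgoing arcs, all of them leading into \<open>H\<close>: every boundary path
from such a vertex reaches \<open>H\<close>, but no finite \<open>F\<close> serves all of them.
\<close>

definition enters :: "'a set \<Rightarrow> 'b set \<Rightarrow> ('a, 'b) bpath \<Rightarrow> bool" where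
  "enters H F \<xi> \<longleftrightarrow> (\<exists>a \<zeta> u. \<zeta> \<in> bpaths G \<and> awalk u a (bsource G \<zeta>) \<and> \<xi> = prepend a \<zeta> \<and>
     set a \<subseteq> F \<and> bsource G \<zeta> \<in> H)"

lemma enters_mono: "enters H F \<xi> \<Longrightarrow> F \<subseteq> F' \<Longrightarrow> enters H F' \<xi>"
  unfolding enters_def by blast

text \<open>
Replacing the prefix \<open>b\<close> of \<open>\<eta>\<close> by \<open>a\<close> affects the arcs traversed before entering \<open>H\<close> only by those of
\<open>a\<close>. If \<open>\<eta>\<close> enters \<open>H\<close> already within \<open>b\<close>, then by heredity \<open>a\<close>, which has the same endpoint, ends in \<open>H\<close>.
\<close>

lemma enters_moves:
  assumes H: "hereditary G H" and m: "moves t \<xi> \<eta>" and e: "enters H F \<eta>"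
  shows "enters H (F \<union> set (pos_part t)) \<xi>"
proof -
  let ?a = "pos_part t" and ?b = "neg_part t"
  from m obtain \<zeta> u v where 1: "\<zeta> \<in> bpaths G"
    "awalk u ?a (bsource G \<zeta>)" "awalk v ?b (bsource G \<zeta>)"
    "\<xi> = prepend ?a \<zeta>" "\<eta> = prepend ?b \<zeta>"
    by (rule moves_normal_form)
  from e obtain c \<kappa> w where 2: "\<kappa> \<in> bpaths G" "awalk w c (bsource G \<kappa>)" "\<eta> = prepend c \<kappa>"
    "set c \<subseteq> F" "bsource G \<kappa> \<in> H"
    unfolding enters_def by blast
  have "prepend ?b \<zeta> = prepend c \<kappa>" using 1 2 by simp
  from this 1(1) 2(1) 1(3) 2(2) show ?thesis
  proof (cases rule: prepend_eq_cases)
    case d: (1 d)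
    have "awalk u (?a @ d) (bsource G \<kappa>)" using 1(2) d(3) by (rule awalk_appendI)
    moreover have "\<xi> = prepend (?a @ d) \<kappa>" using 1(4) d(2) by (simp add: prepend_append)
    moreover have "set (?a @ d) \<subseteq> F \<union> set ?a" using 2(4) d(1) by auto
    ultimately show ?thesis unfolding enters_def using 2 by blast
  next
    case d: (2 d)
    then have "bsource G \<zeta> \<in> H" using hereditary_awalk[OF H] 2(5) by blast
    then show ?thesis unfolding enters_def using 1 by blast
  qed
qed

text \<open>
For a hereditary set \<open>H\<close> this is meant as a description by supports of the ideal generated by the
idempotents \<open>1_v\<close> with \<open>v \<in> H\<close>. One finite set \<open>F\<close> has to serve all coefficients of the element.
\<close>

definition hs_ideal :: "'a set \<Rightarrow> ('b word \<Rightarrow> ('a, 'b) bpath \<Rightarrow> 'k::field) set" where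
  "hs_ideal H = {a \<in> carrier R. \<exists>F. finite F \<and> (\<forall>t \<xi>. a t \<xi> \<noteq> 0 \<longrightarrow> enters H F \<xi>)}"

lemma hs_ideal_ideal:
  assumes H: "hereditary G H"
  shows "two_sided_ideal (hs_ideal H :: ('b word \<Rightarrow> ('a, 'b) bpath \<Rightarrow> 'k::field) set) R"
  unfolding two_sided_ideal_iff
proof (intro conjI ballI)
  let ?I = "hs_ideal H :: ('b word \<Rightarrow> ('a, 'b) bpath \<Rightarrow> 'k) set"
  show "?I \<subseteq> carrier R" by (auto simp: hs_ideal_def)
  show "(\<lambda>t. 0) \<in> ?I" using R_zero_closed by (auto simp: hs_ideal_def)
  fix x assume x: "x \<in> ?I"
  then have xR: "x \<in> carrier R" by (simp add: hs_ideal_def)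
  from x obtain F where F: "finite F" "\<And>t \<xi>. x t \<xi> \<noteq> 0 \<Longrightarrow> enters H F \<xi>"
    unfolding hs_ideal_def by blast
  show "(\<lambda>t. - x t) \<in> ?I" unfolding hs_ideal_def using R_uminus_closed[OF xR] F by auto
  {
    fix y assume y: "y \<in> ?I"
    then obtain F' where F': "finite F'" "\<And>t \<xi>. y t \<xi> \<noteq> 0 \<Longrightarrow> enters H F' \<xi>"
      unfolding hs_ideal_def by blast
    have "enters H (F \<union> F') \<xi>" if "(x t + y t) \<xi> \<noteq> 0" for t \<xi>
    proof -
      have "x t \<xi> \<noteq> 0 \<or> y t \<xi> \<noteq> 0" using that by auto
      then show ?thesis using F(2) F'(2) enters_mono by blast
    qed
    moreover have "(\<lambda>t. x t + y t) \<in> carrier R" using xR y by (intro R_add_closed) (simp_all add: hs_ideal_def)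
    ultimately show "(\<lambda>t. x t + y t) \<in> ?I" unfolding hs_ideal_def using F(1) F'(1) finite_UnI by blast
  }
  fix r assume r: "r \<in> carrier (R :: ('b word \<Rightarrow> ('a, 'b) bpath \<Rightarrow> 'k) ring)"
  show "x \<otimes>\<^bsub>R\<^esub> r \<in> ?I"
  proof -
    have "enters H F \<xi>" if "(x \<otimes>\<^bsub>R\<^esub> r) t \<xi> \<noteq> 0" for t \<xi>
      using R_mult_nonzeroE[OF xR r that] F(2) by blast
    then show ?thesis unfolding hs_ideal_def using R_mult_closed[OF xR r] F(1) by blast
  qed
  show "r \<otimes>\<^bsub>R\<^esub> x \<in> ?I"
  proof -
    \<comment> \<open>By \<open>enters_moves\<close> each word of the support of \<open>r\<close> contributes the arcs of its positive part.\<close>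
    let ?F = "F \<union> (\<Union>t\<in>{t. r t \<noteq> 0}. set (pos_part t))"
    have "enters H ?F \<xi>" if nz: "(r \<otimes>\<^bsub>R\<^esub> x) u \<xi> \<noteq> 0" for u \<xi>
    proof -
      obtain t s where ts: "r t \<xi> \<noteq> 0" "x s (act t \<xi>) \<noteq> 0"
        using R_mult_nonzeroE[OF r xR nz] by blast
      have "r t \<noteq> 0" using ts(1) by auto
      from enters_moves[OF H R_support[OF r ts(1)] F(2)[OF ts(2)]] show ?thesis
        by (rule enters_mono) (use \<open>r t \<noteq> 0\<close> in blast)
    qed
    moreover have "finite ?F" using F(1) R_finite[OF r] by simp
    ultimately show ?thesis unfolding hs_ideal_def using R_mult_closed[OF r xR] by blast
  qed
qed

text \<open>
The idempotent \<open>1_v \<delta>_1\<close>, which corresponds to the vertex \<open>v\<close> of the Leavitt path algebra.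
\<close>

definition vunit :: "'a \<Rightarrow> 'b word \<Rightarrow> ('a, 'b) bpath \<Rightarrow> 'k::field" where
  "vunit v = single [] (indicator (Cyl G v []))"

lemma vunit_in_R: "vunit v \<in> carrier R"
  unfolding vunit_def by (rule single_Nil_in_R[OF indicator_Cyl_in_D0])

lemma vunit_nonzero:
  assumes "v \<in> verts G"
  shows "(vunit v :: 'b word \<Rightarrow> ('a, 'b) bpath \<Rightarrow> 'k::field) \<noteq> (\<lambda>t. 0)"
proof -
  obtain \<xi> where "\<xi> \<in> bpaths G" "bsource G \<xi> = v" using ex_bpath_from[OF assms] by blast
  then have "(vunit v [] \<xi> :: 'k) = 1" by (simp add: vunit_def single_def Cyl_def)
  then show ?thesis by (metis zero_fun_apply zero_neq_one)
qed

lemma vunit_notin_hs_ideal: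
  assumes sat: "saturated G H" and v: "v \<in> verts G" "v \<notin> H"
  shows "(vunit v :: 'b word \<Rightarrow> ('a, 'b) bpath \<Rightarrow> 'k::field) \<notin> hs_ideal H"
proof
  assume "(vunit v :: 'b word \<Rightarrow> ('a, 'b) bpath \<Rightarrow> 'k) \<in> hs_ideal H"
  then obtain F where F: "finite F" "\<And>t \<xi>. (vunit v t \<xi> :: 'k) \<noteq> 0 \<Longrightarrow> enters H F \<xi>"
    unfolding hs_ideal_def by blast
  \<comment> \<open>If all arcs from \<open>w\<close> lie in \<open>F\<close>, they are finite in number and saturation provides one that stays outside \<open>H\<close>.\<close>
  have "\<exists>e. w \<in> verts G \<and> \<not> sink G w \<longrightarrow> e \<in> out_arcs G w \<and> (w \<in> H \<or> e \<notin> F \<or> head G e \<notin> H)" for w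
  proof (cases "w \<in> verts G \<and> \<not> sink G w \<and> w \<notin> H \<and> out_arcs G w \<subseteq> F")
    case True
    then have "finite (out_arcs G w)" "out_arcs G w \<noteq> {}"
      using F(1) by (auto intro: finite_subset simp: sink_def)
    then have "\<not> head G ` out_arcs G w \<subseteq> H" using sat True unfolding saturated_def by blast
    then show ?thesis by blast
  next
    case False
    then show ?thesis unfolding sink_def by blast
  qed
  then obtain nx where nx: "\<And>w. w \<in> verts G \<Longrightarrow> \<not> sink G w \<Longrightarrow>
      nx w \<in> out_arcs G w \<and> (w \<in> H \<or> nx w \<notin> F \<or> head G (nx w) \<notin> H)"
    by metis
  obtain \<xi> where \<xi>: "\<xi> \<in> bpaths G" "bsource G \<xi> = v"
    "\<And>a e. starts_with \<xi> (a @ [e]) \<Longrightarrow> e = nx (tail G e)"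
    using bpath_following_choice[of nx v] nx v(1) by blast
  \<comment> \<open>As long as only arcs from \<open>F\<close> are used, the path has to stay outside \<open>H\<close>.\<close>
  have avoid: "w \<notin> H" if "awalk v a w" "starts_with \<xi> a" "set a \<subseteq> F" for a w
    using that
  proof (induction a arbitrary: w rule: rev_induct)
    case Nil
    then show ?case using v by (simp add: awalk_Nil_iff)
  next
    case (snoc e a)
    have e: "awalk v a (tail G e)" "e \<in> arcs G" "head G e = w"
      using snoc.prems(1) by (auto simp: awalk_simps)
    have "tail G e \<notin> H"
      using snoc.IH[OF e(1)] starts_with_append snoc.prems(2,3) by auto
    moreover have "\<not> sink G (tail G e)" using e(2) unfolding sink_def by auto
    ultimately show ?case using nx[of "tail G e"] \<xi>(3)[OF snoc.prems(2)] e snoc.prems(3) by auto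
  qed
  have "(vunit v [] \<xi> :: 'k) \<noteq> 0" using \<xi> by (simp add: vunit_def single_def Cyl_def)
  then obtain a \<zeta> u where a: "awalk u a (bsource G \<zeta>)" "\<xi> = prepend a \<zeta>" "set a \<subseteq> F" "bsource G \<zeta> \<in> H"
    using F(2) unfolding enters_def by blast
  then have "u = v" using bsource_prepend[OF a(1)] \<xi>(2) by simp
  then show False using avoid[of a "bsource G \<zeta>"] a starts_with_prepend[of a \<zeta>] by simp
qed

lemma simple_imp_hs_trivial:
  assumes simple: "simple_ring (R :: ('b word \<Rightarrow> ('a, 'b) bpath \<Rightarrow> 'k::field) ring)"
    and H: "hereditary G H" "saturated G H"
  shows "H = {} \<or> H = verts G"
proof (rule ccontr)
  assume "\<not> ?thesis"
  moreover have "H \<subseteq> verts G" using H(1) by (simp add: hereditary_def)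
  ultimately obtain v w where vw: "v \<in> H" "v \<in> verts G" "w \<in> verts G" "w \<notin> H" by blast
  let ?I = "hs_ideal H :: ('b word \<Rightarrow> ('a, 'b) bpath \<Rightarrow> 'k) set"
  have "?I = {\<lambda>t. 0} \<or> ?I = carrier R"
    using simple hs_ideal_ideal[OF H(1)] simple_ring_iff by blast
  moreover have "vunit v \<in> ?I"
  proof -
    have "enters H {} \<xi>" if "(vunit v t \<xi> :: 'k) \<noteq> 0" for t \<xi>
    proof -
      have "\<xi> \<in> bpaths G" "bsource G \<xi> = v"
        using that by (auto simp: vunit_def single_def Cyl_def indicator_def split: if_splits)
      then show ?thesis unfolding enters_def using vw
        by (intro exI[of _ "[]"] exI[of _ \<xi>] exI[of _ v]) (simp add: awalk_Nil_iff)
    qed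
    then show ?thesis unfolding hs_ideal_def using vunit_in_R by blast
  qed
  ultimately show False
    using vunit_nonzero[OF vw(2), where 'k = 'k] vunit_notin_hs_ideal[OF H(2) vw(3,4), where 'k = 'k]
      vunit_in_R by blast
qed

lemma hs_trivial_sets: "hereditary G {}" "saturated G {}" "hereditary G (verts G)" "saturated G (verts G)"
  by (auto simp: hereditary_def saturated_def)

end

section \<open>The orbit representation and exits of closed paths\<close>

context wf_digraph
begin

text \<open>
The representation on all functions on the boundary paths. It forgets the word \<open>t\<close> and keeps only its
effect on \<open>\<xi>\<close>, hence it cannot distinguish words that act equally on an open set.
\<close>

definition rep :: "('b word \<Rightarrow> ('a, 'b) bpath \<Rightarrow> 'k::field) \<Rightarrow> (('a, 'b) bpath \<Rightarrow> 'k) \<Rightarrow> ('a, 'b) bpath \<Rightarrow> 'k" where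
  "rep a f \<xi> = (\<Sum>t\<in>{t. a t \<noteq> 0}. a t \<xi> * f (act t \<xi>))"

lemma rep_superset: "finite A \<Longrightarrow> {t. a t \<noteq> 0} \<subseteq> A \<Longrightarrow> rep a f \<xi> = (\<Sum>t\<in>A. a t \<xi> * f (act t \<xi>))"
  unfolding rep_def by (rule sum.mono_neutral_left) auto

lemma rep_add:
  assumes "a \<in> carrier R" "b \<in> carrier R"
  shows "rep (\<lambda>t. a t + b t) f \<xi> = rep a f \<xi> + rep b f \<xi>"
proof -
  let ?A = "{t. a t \<noteq> 0} \<union> {t. b t \<noteq> 0}"
  have fin: "finite ?A" using R_finite assms by blast
  have "rep (\<lambda>t. a t + b t) f \<xi> = (\<Sum>t\<in>?A. (a t + b t) \<xi> * f (act t \<xi>))"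
    by (rule rep_superset[OF fin]) auto
  also have "\<dots> = (\<Sum>t\<in>?A. a t \<xi> * f (act t \<xi>)) + (\<Sum>t\<in>?A. b t \<xi> * f (act t \<xi>))"
    by (simp add: distrib_right sum.distrib)
  also have "\<dots> = rep a f \<xi> + rep b f \<xi>"
    using rep_superset[OF fin, of a f \<xi>] rep_superset[OF fin, of b f \<xi>] by simp
  finally show ?thesis .
qed

lemma rep_uminus: "rep (\<lambda>t. - a t) f \<xi> = - rep a f \<xi>"
  unfolding rep_def by (simp add: sum_negf)

text \<open>
Writing both sides as sums over pairs \<open>(t, s)\<close> of supported words, the claim reduces to the fact that
the action of \<open>ts\<close> is the composition of the actions where the coefficients do not vanish.
\<close>

lemma rep_mult:
  assumes a: "a \<in> carrier R" and b: "b \<in> carrier R"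
  shows "rep (a \<otimes>\<^bsub>R\<^esub> b) f \<xi> = rep a (rep b f) \<xi>"
proof -
  let ?A = "{t. a t \<noteq> 0}" and ?B = "{t. b t \<noteq> 0}"
  let ?U = "(\<lambda>(t, s). t \<otimes>\<^bsub>FG G\<^esub> s) ` (?A \<times> ?B)"
  have fin: "finite ?A" "finite ?B" "finite ?U" using R_finite a b by auto
  have "rep (a \<otimes>\<^bsub>R\<^esub> b) f \<xi> = (\<Sum>u\<in>?U. (a \<otimes>\<^bsub>R\<^esub> b) u \<xi> * f (act u \<xi>))"
    by (rule rep_superset[OF fin(3) R_mult_support[OF a b]])
  also have "\<dots> = (\<Sum>u\<in>?U. \<Sum>t\<in>?A. \<Sum>s\<in>?B.
      if t \<otimes>\<^bsub>FG G\<^esub> s = u then a t \<xi> * b s (act t \<xi>) * f (act u \<xi>) else 0)"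
    unfolding R_mult_apply[OF a b fin(1) subset_refl fin(2) subset_refl] sum_distrib_right
    by (intro sum.cong refl) simp
  also have "\<dots> = (\<Sum>t\<in>?A. \<Sum>s\<in>?B. \<Sum>u\<in>?U.
      if t \<otimes>\<^bsub>FG G\<^esub> s = u then a t \<xi> * b s (act t \<xi>) * f (act u \<xi>) else 0)"
    by (rule trans[OF sum.swap], rule sum.cong[OF refl], rule sum.swap)
  also have "\<dots> = (\<Sum>t\<in>?A. \<Sum>s\<in>?B. a t \<xi> * b s (act t \<xi>) * f (act (t \<otimes>\<^bsub>FG G\<^esub> s) \<xi>))"
  proof (intro sum.cong refl)
    fix t s assume "t \<in> ?A" "s \<in> ?B"
    then have "t \<otimes>\<^bsub>FG G\<^esub> s \<in> ?U" by force
    then show "(\<Sum>u\<in>?U. if t \<otimes>\<^bsub>FG G\<^esub> s = u then a t \<xi> * b s (act t \<xi>) * f (act u \<xi>) else 0) =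
        a t \<xi> * b s (act t \<xi>) * f (act (t \<otimes>\<^bsub>FG G\<^esub> s) \<xi>)"
      using fin(3) by (simp add: sum.delta')
  qed
  also have "\<dots> = (\<Sum>t\<in>?A. \<Sum>s\<in>?B. a t \<xi> * (b s (act t \<xi>) * f (act s (act t \<xi>))))"
  proof (intro sum.cong refl)
    fix t s
    show "a t \<xi> * b s (act t \<xi>) * f (act (t \<otimes>\<^bsub>FG G\<^esub> s) \<xi>) = a t \<xi> * (b s (act t \<xi>) * f (act s (act t \<xi>)))"
    proof (cases "a t \<xi> = 0 \<or> b s (act t \<xi>) = 0")
      case False
      then have "moves t \<xi> (act t \<xi>)" "moves s (act t \<xi>) (act s (act t \<xi>))"
        using R_support a b by auto
      from act_moves[OF moves_trans[OF this]] show ?thesis by simp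
    qed auto
  qed
  also have "\<dots> = rep a (rep b f) \<xi>"
    by (simp add: rep_def sum_distrib_left)
  finally show ?thesis .
qed

definition rep_kernel :: "('b word \<Rightarrow> ('a, 'b) bpath \<Rightarrow> 'k::field) set" where
  "rep_kernel = {a \<in> carrier R. \<forall>f \<xi>. rep a f \<xi> = 0}"

lemma rep_kernel_ideal: "two_sided_ideal (rep_kernel :: ('b word \<Rightarrow> ('a, 'b) bpath \<Rightarrow> 'k::field) set) R"
  unfolding two_sided_ideal_iff
proof (intro conjI ballI)
  let ?K = "rep_kernel :: ('b word \<Rightarrow> ('a, 'b) bpath \<Rightarrow> 'k) set"
  show "?K \<subseteq> carrier R" by (auto simp: rep_kernel_def)
  show "(\<lambda>t. 0) \<in> ?K" using R_zero_closed by (simp add: rep_kernel_def rep_def)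
  fix x assume x: "x \<in> ?K"
  then have xR: "x \<in> carrier R" and rx: "rep x f = (\<lambda>\<xi>. 0)" for f by (auto simp: rep_kernel_def)
  show "(\<lambda>t. - x t) \<in> ?K" using R_uminus_closed[OF xR] by (simp add: rep_kernel_def rep_uminus rx)
  show "(\<lambda>t. x t + y t) \<in> ?K" if "y \<in> ?K" for y
    using that R_add_closed[OF xR, of y] by (simp add: rep_kernel_def rep_add[OF xR] rx)
  fix r assume r: "r \<in> carrier (R :: ('b word \<Rightarrow> ('a, 'b) bpath \<Rightarrow> 'k) ring)"
  show "r \<otimes>\<^bsub>R\<^esub> x \<in> ?K"
    using R_mult_closed[OF r xR] by (simp add: rep_kernel_def rep_mult[OF r xR] rx) (simp add: rep_def)
  show "x \<otimes>\<^bsub>R\<^esub> r \<in> ?K"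
    using R_mult_closed[OF xR r] by (simp add: rep_kernel_def rep_mult[OF xR r] rx)
qed

text \<open>
If \<open>p\<close> is a closed path at \<open>v\<close> without exit, then \<open>p\<close> fixes the only boundary path from \<open>v\<close>. Hence
\<open>1_v \<delta>_1\<close> and \<open>1_p \<delta>_p\<close> have the same image under the representation, and its kernel is a nontrivial
ideal.
\<close>

lemma simple_imp_condition_L:
  assumes simple: "simple_ring (R :: ('b word \<Rightarrow> ('a, 'b) bpath \<Rightarrow> 'k::field) ring)"
  shows "condition_L G"
proof (rule ccontr)
  assume "\<not> condition_L G"
  then obtain p where p: "p \<in> fpaths G" "psource G p = prange G p"
    "\<And>i f. i < length p \<Longrightarrow> f \<in> arcs G \<Longrightarrow> tail G f = tail G (p ! i) \<Longrightarrow> f = p ! i"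
    unfolding condition_L_def by blast
  define v where "v = psource G p"
  have w: "awalk v p v" "p \<noteq> []" using p(1,2) by (auto simp: fpaths_iff v_def)
  have v: "v \<in> verts G" using w(1) by (rule awalk_hd_in_verts)
  let ?S = "Cyl G v []" and ?g = "of_path p"
  have ex: "\<exists>\<zeta>\<in>?S. \<xi> = prepend p \<zeta>" if "\<xi> \<in> ?S" for \<xi>
  proof -
    have \<xi>: "\<xi> \<in> bpaths G" "bsource G \<xi> = v" using that by (auto simp: Cyl_def)
    have "starts_with \<xi> p"
      by (rule starts_with_exitless[OF w(1) _ \<xi>]) (metis p(3) in_set_conv_nth)
    from starts_withE[OF \<xi>(1) this] obtain \<zeta> where \<zeta>: "\<zeta> \<in> bpaths G" "\<xi> = prepend p \<zeta>"
      "awalk (bsource G \<xi>) p (bsource G \<zeta>)" .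
    have "bsource G \<zeta> = v" using awalk_fpaths(3)[OF \<zeta>(3) w(2)] awalk_fpaths(3)[OF w] by simp
    then show ?thesis using \<zeta> by (auto simp: Cyl_def)
  qed
  have eq: "\<xi> = \<eta>" if "\<xi> \<in> ?S" "\<eta> \<in> ?S" for \<xi> \<eta>
    using ex w(2) that by (intro self_similar_unique[of ?S v p]) (auto simp: Cyl_def)
  have mv: "moves ?g \<xi> \<xi>" if \<xi>: "\<xi> \<in> ?S" for \<xi>
  proof -
    obtain \<zeta> where \<zeta>: "\<zeta> \<in> ?S" "\<xi> = prepend p \<zeta>" using ex[OF \<xi>] by blast
    from \<zeta>(2) have "\<xi> = prepend p \<xi>" unfolding eq[OF \<zeta>(1) \<xi>] .
    moreover have "\<xi> \<in> bpaths G" "bsource G \<xi> = v" using \<xi> by (simp_all add: Cyl_def)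
    ultimately show ?thesis unfolding moves_of_path_iff[OF w] by blast
  qed
  have X: "\<xi> \<in> ?S" if "\<xi> \<in> Xset G ?g" for \<xi>
  proof -
    have "moves ?g \<xi> (act ?g \<xi>)" using that by (rule Xset_imp_moves)
    then obtain \<eta> where \<eta>: "\<eta> \<in> bpaths G" "awalk v p (bsource G \<eta>)" "\<xi> = prepend p \<eta>"
      unfolding moves_of_path_iff[OF w] using w(1) by blast
    show ?thesis
      unfolding \<eta>(3) using bsource_prepend[OF \<eta>(2)] prepend_in_bpaths[OF \<eta>(2,1)] by (simp add: Cyl_def)
  qed
  have g: "?g \<noteq> []" using w(2) by (simp add: of_path_def)
  let ?q = "- indicator (Xset G ?g) :: ('a, 'b) bpath \<Rightarrow> 'k"
  \<comment> \<open>The element \<open>1_v \<delta>_1 - 1_p \<delta>_p\<close>.\<close>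
  let ?x = "\<lambda>t. vunit v t + single ?g ?q t :: ('a, 'b) bpath \<Rightarrow> 'k"
  have "single ?g ?q \<in> carrier R"
    by (rule single_in_R) (auto intro!: D0_uminus indicator_Xset_in_D0[OF g] simp: indicator_def)
  then have xR: "?x \<in> carrier R" by (rule R_add_closed[OF vunit_in_R])
  have "rep ?x f \<xi> = 0" for f \<xi>
  proof -
    have "rep ?x f \<xi> = (\<Sum>t\<in>{[], ?g}. ?x t \<xi> * f (act t \<xi>))"
      by (rule rep_superset) (auto simp: vunit_def single_def)
    also have "\<dots> = indicator ?S \<xi> * f (act [] \<xi>) - indicator (Xset G ?g) \<xi> * f (act ?g \<xi>)"
      using g by (simp add: vunit_def single_def)
    also have "\<dots> = 0"
    proof (cases "\<xi> \<in> ?S")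
      case True
      then have "act ?g \<xi> = \<xi>" "\<xi> \<in> Xset G ?g" using mv moves_iff by auto
      moreover have "act [] \<xi> = \<xi>" using True act_moves[OF moves_one] by (simp add: Cyl_def)
      ultimately show ?thesis using True by simp
    next
      case False
      then show ?thesis using X by (auto simp: indicator_def)
    qed
    finally show ?thesis .
  qed
  with xR have xK: "?x \<in> rep_kernel" by (simp add: rep_kernel_def)
  obtain \<xi> where \<xi>: "\<xi> \<in> bpaths G" "bsource G \<xi> = v" using ex_bpath_from[OF v] by blast
  then have "?x [] \<xi> = 1" using g by (simp add: vunit_def single_def Cyl_def)
  then have "?x \<noteq> (\<lambda>t. 0)" by (metis zero_fun_apply zero_neq_one)
  moreover have "vunit v \<notin> (rep_kernel :: ('b word \<Rightarrow> ('a, 'b) bpath \<Rightarrow> 'k) set)"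
  proof -
    have "rep (vunit v) (\<lambda>\<xi>. 1) \<xi> = (\<Sum>t\<in>{[]}. vunit v t \<xi> * (1 :: 'k))"
      by (rule rep_superset) (auto simp: vunit_def single_def)
    also have "\<dots> = 1" using \<xi> by (simp add: vunit_def single_def Cyl_def)
    finally show ?thesis unfolding rep_kernel_def by (metis (mono_tags, lifting) mem_Collect_eq zero_neq_one)
  qed
  ultimately show False
    using simple rep_kernel_ideal xK vunit_in_R unfolding simple_ring_iff by blast
qed

end

section \<open>Density of boundary paths with trivial isotropy\<close>

context wf_digraph
begin

text \<open>
For \<open>\<xi> = a\<zeta> = b\<zeta>\<close> with \<open>a \<noteq> b\<close>, one of \<open>a\<close>, \<open>b\<close> properly extends the other by a path \<open>d\<close>, and
cancelling gives \<open>\<zeta> = d\<zeta>\<close>. So a path fixed by a nontrivial word is eventually periodic.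
\<close>

lemma fixed_point_period:
  assumes m: "moves t \<xi> \<xi>" and t: "t \<noteq> []"
  obtains a d \<zeta> u where "\<zeta> \<in> bpaths G" "awalk u a (bsource G \<zeta>)"
    "awalk (bsource G \<zeta>) d (bsource G \<zeta>)" "d \<noteq> []" "\<xi> = prepend a \<zeta>" "\<zeta> = prepend d \<zeta>"
    "{pos_part t, neg_part t} = {a, a @ d}"
proof -
  let ?a = "pos_part t" and ?b = "neg_part t"
  from m obtain \<zeta> u v where 1: "\<zeta> \<in> bpaths G"
    "awalk u ?a (bsource G \<zeta>)" "awalk v ?b (bsource G \<zeta>)"
    "\<xi> = prepend ?a \<zeta>" "\<xi> = prepend ?b \<zeta>" and w: "t = of_path ?a @ inv_word (of_path ?b)" "reduced t"
    by (rule moves_normal_form)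
  have ne: "?a \<noteq> ?b"
  proof
    assume eq: "?a = ?b"
    have "t = of_path ?a \<otimes>\<^bsub>FG G\<^esub> inv\<^bsub>FG G\<^esub> (of_path ?a)"
      using w free_group_mult_reduced[of "of_path ?a" "inv_word (of_path ?b)"] awalk_arcs[OF 1(2)] eq
      by (simp add: inv_of_path)
    also have "\<dots> = []"
      using F.r_inv[OF of_path_awalk_closed[OF 1(2)]] by (simp only: one_free_group)
    finally show False using t by simp
  qed
  have "prepend ?a \<zeta> = prepend ?b \<zeta>" using 1(4,5) by (rule subst)
  from this 1(1) 1(1) 1(2) 1(3) show ?thesis
  proof (cases rule: prepend_eq_cases)
    case d: (1 d)
    then have "d \<noteq> []" using ne by auto
    with d 1 show ?thesis by (intro that[of \<zeta> u ?a d]) auto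
  next
    case d: (2 d)
    then have "d \<noteq> []" using ne by auto
    with d 1 show ?thesis by (intro that[of \<zeta> v ?b d]) auto
  qed
qed

text \<open>
The word alone determines the preperiod \<open>a\<close> and the period \<open>d\<close> of a fixed path, hence the path \<open>addd\<dots>\<close>.
\<close>

lemma fixed_point_unique:
  assumes m: "moves t \<xi> \<xi>" "moves t \<eta> \<eta>" and t: "t \<noteq> []"
  shows "\<xi> = \<eta>"
proof -
  obtain a d \<zeta> u where 1: "\<zeta> \<in> bpaths G" "awalk u a (bsource G \<zeta>)"
    "awalk (bsource G \<zeta>) d (bsource G \<zeta>)" "d \<noteq> []" "\<xi> = prepend a \<zeta>" "\<zeta> = prepend d \<zeta>"
    "{pos_part t, neg_part t} = {a, a @ d}"
    using m(1) t by (rule fixed_point_period)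
  obtain a' d' \<zeta>' u' where 2: "\<zeta>' \<in> bpaths G" "awalk u' a' (bsource G \<zeta>')"
    "awalk (bsource G \<zeta>') d' (bsource G \<zeta>')" "d' \<noteq> []" "\<eta> = prepend a' \<zeta>'" "\<zeta>' = prepend d' \<zeta>'"
    "{pos_part t, neg_part t} = {a', a' @ d'}"
    using m(2) t by (rule fixed_point_period)
  have "{a, a @ d} = {a', a' @ d'}" using 1(7) 2(7) by (rule subst)
  then have eq: "a' = a" "d' = d" by (auto simp: doubleton_eq_iff)
  have "bsource G \<zeta>' = bsource G \<zeta>"
    using awalk_fpaths(3)[OF 1(3,4)] awalk_fpaths(3)[OF 2(3,4)] eq by simp
  then have "\<zeta> = \<zeta>'"
    using 1 2 eq by (intro self_similar_unique[of "{\<zeta>, \<zeta>'}" "bsource G \<zeta>" d]) auto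
  then show ?thesis using 1(5) 2(5) eq by simp
qed

lemma awalk_concat_replicate: "awalk v d v \<Longrightarrow> awalk v (concat (replicate k d)) v"
  by (induction k) (auto simp: awalk_Nil_iff awalk_hd_in_verts intro: awalk_appendI)

lemma prepend_concat_replicate: "\<zeta> = prepend d \<zeta> \<Longrightarrow> prepend (concat (replicate k d)) \<zeta> = \<zeta>"
  by (induction k) (simp_all add: prepend_append)

text \<open>
The period of \<open>\<xi>\<close> is a closed path and has an exit by condition (L). Leaving \<open>\<xi>\<close> through this exit after
sufficiently many periods gives a different boundary path close to \<open>\<xi>\<close>.
\<close>

lemma fixed_point_not_isolated:
  assumes L: "condition_L G" and m: "moves t \<xi> \<xi>" and t: "t \<noteq> []"
  obtains \<kappa> where "\<kappa> \<in> bpaths G" "agree G n \<xi> \<kappa>" "\<kappa> \<noteq> \<xi>"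
proof -
  obtain a d \<zeta> u where \<zeta>: "\<zeta> \<in> bpaths G" "awalk u a (bsource G \<zeta>)"
    and d: "awalk (bsource G \<zeta>) d (bsource G \<zeta>)" "d \<noteq> []"
    and eq: "\<xi> = prepend a \<zeta>" "\<zeta> = prepend d \<zeta>"
    using m t by (rule fixed_point_period)
  have "d \<in> fpaths G" "psource G d = prange G d" using awalk_fpaths[OF d] by simp_all
  then obtain i f where f: "i < length d" "f \<in> arcs G" "f \<noteq> d ! i" "tail G f = tail G (d ! i)"
    using L unfolding condition_L_def by blast
  have di: "d = take i d @ d ! i # drop (Suc i) d" using f(1) by (rule id_take_nth_drop)
  have "awalk (bsource G \<zeta>) (take i d @ d ! i # drop (Suc i) d) (bsource G \<zeta>)"
    using d(1) by (subst (asm) di)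
  then have wi: "awalk (bsource G \<zeta>) (take i d) (tail G (d ! i))"
    by (auto simp: awalk_Cons_iff)
  \<comment> \<open>Running through \<open>n\<close> periods first guarantees that the exit is taken after the first \<open>n\<close> arcs.\<close>
  let ?p = "a @ concat (replicate n d) @ take i d"
  have wp: "awalk u ?p (tail G f)"
    unfolding f(4) by (intro awalk_appendI[OF \<zeta>(2)] awalk_appendI[OF awalk_concat_replicate[OF d(1)]] wi)
  have "length (concat (replicate n d)) \<ge> n"
    using d(2) by (cases d) (simp_all add: length_concat sum_list_replicate)
  then have len: "length ?p \<ge> n" by simp
  obtain x where x: "x \<in> bpaths G" "bsource G x = head G f"
    using ex_bpath_from f(2) head_in_verts by metis
  have wf: "awalk u (?p @ [f]) (bsource G x)"
    using wp f(2) x(2) head_in_verts tail_in_verts by (intro awalk_appendI[OF wp]) (simp add: awalk_simps)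
  let ?\<kappa> = "prepend (?p @ [f]) x"
  have "\<zeta> = prepend (take i d @ d ! i # drop (Suc i) d) \<zeta>" using eq(2) by (subst (asm) di)
  then have "\<zeta> = prepend (take i d @ [d ! i]) (prepend (drop (Suc i) d) \<zeta>)"
    by (simp flip: prepend_append)
  then have "\<xi> = prepend (a @ concat (replicate n d)) (prepend (take i d @ [d ! i]) (prepend (drop (Suc i) d) \<zeta>))"
    using eq(1) prepend_concat_replicate[OF eq(2), of n] by (simp add: prepend_append)
  then have \<xi>: "\<xi> = prepend (?p @ [d ! i]) (prepend (drop (Suc i) d) \<zeta>)"
    by (simp add: prepend_append)
  have "initial n \<xi> = take n ?p" "initial n ?\<kappa> = take n ?p"
    unfolding \<xi> initial_prepend using len by simp_all
  moreover have "bsource G \<xi> = u" using bsource_prepend[OF \<zeta>(2)] eq(1) by simp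
  moreover have "bsource G ?\<kappa> = u" by (rule bsource_prepend[OF wf])
  ultimately have "agree G n \<xi> ?\<kappa>" by (simp add: agree_def)
  moreover have "?\<kappa> \<noteq> \<xi>"
  proof
    assume "?\<kappa> = \<xi>"
    then have "initial (Suc (length ?p)) ?\<kappa> = initial (Suc (length ?p)) \<xi>" by simp
    then have "?p @ [f] = ?p @ [d ! i]" unfolding \<xi> initial_prepend by simp
    then show False using f(3) by simp
  qed
  moreover have "?\<kappa> \<in> bpaths G" by (rule prepend_in_bpaths[OF wf x(1)])
  ultimately show ?thesis using that by blast
qed

text \<open>
The form in which the openness of the set of non-fixed points is used: a small neighbourhood of \<open>\<eta>\<close> is
moved off itself by \<open>t\<close>.
\<close>

lemma not_fixed_open:
  assumes \<eta>: "\<eta> \<in> bpaths G" and nf: "\<not> moves t \<eta> \<eta>" and t: "t \<noteq> []"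
  obtains m where "\<And>\<kappa> \<kappa>'. agree G m \<eta> \<kappa> \<Longrightarrow> moves t \<kappa> \<kappa>' \<Longrightarrow> \<not> agree G m \<eta> \<kappa>'"
proof (cases "\<eta> \<in> Xset G t")
  case True
  then have mv: "moves t \<eta> (act t \<eta>)" by (rule Xset_imp_moves)
  then have "act t \<eta> \<noteq> \<eta>" using nf by metis
  then obtain m where m: "\<not> agree G m \<eta> (act t \<eta>)"
    using bpath_eqI[OF \<eta> moves_in_bpaths(2)[OF mv]] by metis
  show ?thesis
  proof (rule that[of "m + length t"])
    fix \<kappa> \<kappa>' assume *: "agree G (m + length t) \<eta> \<kappa>" "moves t \<kappa> \<kappa>'"
    show "\<not> agree G (m + length t) \<eta> \<kappa>'"
    proof
      assume "agree G (m + length t) \<eta> \<kappa>'"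
      then have "agree G m \<eta> \<kappa>'" by (rule agree_mono) simp
      moreover have "agree G m (act t \<eta>) \<kappa>'" by (rule moves_agree[OF mv *(2,1)])
      ultimately show False using m agree_trans agree_sym by blast
    qed
  qed
next
  case False
  \<comment> \<open>That \<open>X_t\<close> is open and closed follows from local constancy of its indicator, over any field of values.\<close>
  obtain n where n: "\<And>\<xi> \<eta>. \<xi> \<in> bpaths G \<Longrightarrow> \<eta> \<in> bpaths G \<Longrightarrow> agree G n \<xi> \<eta> \<Longrightarrow>
      (indicator (Xset G t) \<xi> :: rat) = indicator (Xset G t) \<eta>"
    using D0_locally_constant[OF indicator_Xset_in_D0[OF t]] by blast
  show ?thesis
  proof (rule that[of n])
    fix \<kappa> \<kappa>' assume *: "agree G n \<eta> \<kappa>" "moves t \<kappa> \<kappa>'"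
    then have "\<kappa> \<in> Xset G t" "\<kappa> \<in> bpaths G" using moves_iff moves_in_bpaths by blast+
    then show "\<not> agree G n \<eta> \<kappa>'" using n[OF \<eta> _ *(1)] False by (simp add: indicator_def)
  qed
qed

lemma not_fixed_open_finite:
  assumes \<eta>: "\<eta> \<in> bpaths G" and T: "finite T" "[] \<notin> T" "\<forall>t\<in>T. \<not> moves t \<eta> \<eta>"
  shows "\<exists>m. \<forall>t\<in>T. \<forall>\<kappa> \<kappa>'. agree G m \<eta> \<kappa> \<longrightarrow> moves t \<kappa> \<kappa>' \<longrightarrow> \<not> agree G m \<eta> \<kappa>'"
  using T
proof (induction T rule: finite_induct)
    case (insert t T)
    then obtain m where m: "\<forall>t\<in>T. \<forall>\<kappa> \<kappa>'. agree G m \<eta> \<kappa> \<longrightarrow> moves t \<kappa> \<kappa>' \<longrightarrow> \<not> agree G m \<eta> \<kappa>'"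
      by auto
    obtain m' where m': "\<And>\<kappa> \<kappa>'. agree G m' \<eta> \<kappa> \<Longrightarrow> moves t \<kappa> \<kappa>' \<Longrightarrow> \<not> agree G m' \<eta> \<kappa>'"
      using not_fixed_open[OF \<eta>, of t] insert.prems by auto
    have "\<not> agree G (max m m') \<eta> \<kappa>'"
      if "s \<in> insert t T" "agree G (max m m') \<eta> \<kappa>" "moves s \<kappa> \<kappa>'" for s \<kappa> \<kappa>'
      using that m m' agree_mono[OF that(2) max.cobounded1] agree_mono[OF that(2) max.cobounded2]
        agree_mono[OF _ max.cobounded1] agree_mono[OF _ max.cobounded2] by blast
    then show ?case by blast
qed simp

text \<open>
Induction on \<open>T\<close>. If the path \<open>\<eta>\<close> found for \<open>T\<close> is fixed by the new word \<open>t\<close>, pass to a nearby path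
\<open>\<kappa> \<noteq> \<eta>\<close>. It is not fixed by \<open>t\<close>, because \<open>\<eta>\<close> is the only path fixed by \<open>t\<close>, and it is not fixed by
the words of \<open>T\<close> if it is close enough to \<open>\<eta>\<close>.
\<close>

lemma ex_near_not_fixed:
  assumes L: "condition_L G" and T: "finite T" "[] \<notin> T" and \<xi>: "\<xi> \<in> bpaths G"
  obtains \<eta> where "\<eta> \<in> bpaths G" "agree G n \<xi> \<eta>" "\<forall>t\<in>T. \<not> moves t \<eta> \<eta>"
proof -
  have "\<exists>\<eta>\<in>bpaths G. agree G n \<xi> \<eta> \<and> (\<forall>t\<in>T. \<not> moves t \<eta> \<eta>)"
    using T
  proof (induction T rule: finite_induct)
    case empty
    show ?case by (rule bexI[OF _ \<xi>]) simp
  next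
    case (insert t T)
    then obtain \<eta> where \<eta>: "\<eta> \<in> bpaths G" "agree G n \<xi> \<eta>" "\<forall>s\<in>T. \<not> moves s \<eta> \<eta>" by auto
    show ?case
    proof (cases "moves t \<eta> \<eta>")
      case False
      then show ?thesis using \<eta> by blast
    next
      case True
      have t: "t \<noteq> []" "[] \<notin> T" using insert.prems by auto
      obtain m where m: "\<forall>s\<in>T. \<forall>\<kappa> \<kappa>'. agree G m \<eta> \<kappa> \<longrightarrow> moves s \<kappa> \<kappa>' \<longrightarrow> \<not> agree G m \<eta> \<kappa>'"
        using not_fixed_open_finite[OF \<eta>(1) insert.hyps(1) t(2) \<eta>(3)] by (elim exE)
      obtain \<kappa> where \<kappa>: "\<kappa> \<in> bpaths G" "agree G (max n m) \<eta> \<kappa>" "\<kappa> \<noteq> \<eta>"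
        using L True t(1) by (rule fixed_point_not_isolated)
      have "agree G n \<xi> \<kappa>" using \<eta>(2) agree_mono[OF \<kappa>(2) max.cobounded1] by (rule agree_trans)
      moreover have "\<not> moves t \<kappa> \<kappa>" using fixed_point_unique[OF True _ t(1), of \<kappa>] \<kappa>(3) by blast
      moreover have "\<not> moves s \<kappa> \<kappa>" if "s \<in> T" for s
        using m that agree_mono[OF \<kappa>(2) max.cobounded2] by blast
      ultimately show ?thesis using \<kappa>(1) by blast
    qed
  qed
  with that show ?thesis by blast
qed

end

section \<open>Ideals under condition (L)\<close>

context wf_digraph
begin

text \<open>
Conjugation with the partial isometry \<open>1_t \<delta>_t\<close> transports a function along the action. This is how an
ideal spreads over orbits.
\<close>

lemma conjugate_single:
  fixes f :: "('a, 'b) bpath \<Rightarrow> 'k::field"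
  assumes t: "t \<in> carrier (FG G)" "t \<noteq> []" and f: "f \<in> D0 G"
  shows "(single t (indicator (Xset G t)) \<otimes>\<^bsub>R\<^esub> single [] f) \<otimes>\<^bsub>R\<^esub>
      single (inv\<^bsub>FG G\<^esub> t) (indicator (Xset G (inv\<^bsub>FG G\<^esub> t))) = single [] (alpha G t f)"
proof -
  have it: "inv\<^bsub>FG G\<^esub> t \<in> carrier (FG G)" "inv\<^bsub>FG G\<^esub> t \<noteq> []"
    using t F.inv_eq_1_iff[OF t(1)] by simp_all
  let ?s = "single t (indicator (Xset G t)) :: 'b word \<Rightarrow> ('a, 'b) bpath \<Rightarrow> 'k"
  let ?s' = "single (inv\<^bsub>FG G\<^esub> t) (indicator (Xset G (inv\<^bsub>FG G\<^esub> t))) :: 'b word \<Rightarrow> ('a, 'b) bpath \<Rightarrow> 'k"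
  have fR: "single [] f \<in> carrier R" by (rule single_Nil_in_R[OF f])
  have sf: "?s \<otimes>\<^bsub>R\<^esub> single [] f \<in> carrier R" by (rule R_mult_closed[OF single_Xset_in_R[OF t(2)] fR])
  have aR: "single [] (alpha G t f) \<in> carrier R" by (rule single_Nil_in_R[OF alpha_in_D0[OF f]])
  have pR: "(?s \<otimes>\<^bsub>R\<^esub> single [] f) \<otimes>\<^bsub>R\<^esub> ?s' \<in> carrier R" by (rule R_mult_closed[OF sf single_Xset_in_R[OF it(2)]])
  show "(?s \<otimes>\<^bsub>R\<^esub> single [] f) \<otimes>\<^bsub>R\<^esub> ?s' = single [] (alpha G t f)"
  proof (intro ext)
    fix u \<kappa>
    show "((?s \<otimes>\<^bsub>R\<^esub> single [] f) \<otimes>\<^bsub>R\<^esub> ?s') u \<kappa> = single [] (alpha G t f) u \<kappa>"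
    proof (cases "u \<in> carrier (FG G)")
      case False
      then show ?thesis using pR aR R_support_closed by (metis (no_types))
    next
      case u: True
      let ?ut = "u \<otimes>\<^bsub>FG G\<^esub> t"
      have ut: "?ut \<in> carrier (FG G)" using u t by simp
      have "inv\<^bsub>FG G\<^esub> t \<otimes>\<^bsub>FG G\<^esub> ?ut = [] \<longleftrightarrow> u = []"
      proof -
        have "inv\<^bsub>FG G\<^esub> t \<otimes>\<^bsub>FG G\<^esub> ?ut = [] \<longleftrightarrow> ?ut = t"
          using F.inv_solve_left[of "[]" t ?ut] F.one_closed t ut by auto
        also have "\<dots> \<longleftrightarrow> u = []" using F.r_cancel_one[OF t(1) u] by simp
        finally show ?thesis .
      qed
      then have mid: "single [] f (inv\<^bsub>FG G\<^esub> t \<otimes>\<^bsub>FG G\<^esub> ?ut) = (if u = [] then f else 0)"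
        by (simp add: single_def)
      have "((?s \<otimes>\<^bsub>R\<^esub> single [] f) \<otimes>\<^bsub>R\<^esub> ?s') u \<kappa> =
        (?s \<otimes>\<^bsub>R\<^esub> single [] f) ?ut \<kappa> * indicator (Xset G (inv\<^bsub>FG G\<^esub> t)) (act ?ut \<kappa>)"
        using R_mult_single[OF sf single_Xset_in_R[OF it(2)] it(1) u, of \<kappa>] t(1) by simp
      also have "\<dots> = indicator (Xset G t) \<kappa> * (if u = [] then f else 0) (act t \<kappa>) *
          indicator (Xset G (inv\<^bsub>FG G\<^esub> t)) (act ?ut \<kappa>)"
        unfolding R_single_mult[OF single_Xset_in_R[OF t(2)] fR t(1) ut] mid ..
      also have "\<dots> = single [] (alpha G t f) u \<kappa>"
      proof (cases "\<kappa> \<in> Xset G t")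
        case True
        then have "act t \<kappa> \<in> Xset G (inv\<^bsub>FG G\<^esub> t)"
          using moves_sym Xset_imp_moves moves_imp_theta(1) by blast
        then show ?thesis using True by (simp add: single_def alpha_apply)
      qed (simp add: single_def alpha_def)
      finally show ?thesis .
    qed
  qed
qed

text \<open>
Pulling a cylinder set \<open>Z\<close> defined by a path \<open>p\<close> from \<open>v\<close> to \<open>w\<close> back along \<open>p\<close> yields all boundary paths
from \<open>w\<close>. The hypothesis on \<open>Z\<close> also admits the larger set \<open>X_v\<close>, which gives heredity.
\<close>

lemma alpha_inv_of_path_indicator:
  assumes "awalk v p w" "p \<noteq> []" "\<And>\<kappa>. \<kappa> \<in> Cyl G w [] \<Longrightarrow> prepend p \<kappa> \<in> Z"
  shows "alpha G (inv\<^bsub>FG G\<^esub> (of_path p)) (indicator Z) = indicator (Cyl G w [])"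
proof
  fix \<kappa>
  let ?t = "inv\<^bsub>FG G\<^esub> (of_path p)"
  have p: "of_path p \<in> carrier (FG G)" by (rule of_path_awalk_closed[OF assms(1)])
  show "alpha G ?t (indicator Z) \<kappa> = indicator (Cyl G w []) \<kappa>"
  proof (cases "\<kappa> \<in> Cyl G w []")
    case True
    then have "moves (of_path p) (prepend p \<kappa>) \<kappa>"
      unfolding moves_of_path_iff[OF assms(1,2)] by (simp add: Cyl_def)
    from moves_sym[OF this] have "\<kappa> \<in> Xset G ?t" "act ?t \<kappa> = prepend p \<kappa>" by (simp_all add: moves_iff)
    then show ?thesis using True assms(3)[OF True] by (simp add: alpha_apply)
  next
    case False
    have "\<kappa> \<notin> Xset G ?t"
    proof
      assume "\<kappa> \<in> Xset G ?t"
      then have "moves (inv\<^bsub>FG G\<^esub> ?t) (act ?t \<kappa>) \<kappa>" by (intro moves_sym Xset_imp_moves)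
      then have "moves (of_path p) (act ?t \<kappa>) \<kappa>" using p by simp
      then show False using False unfolding moves_of_path_iff[OF assms(1,2)] by (simp add: Cyl_def)
    qed
    then show ?thesis using False by (simp add: alpha_def)
  qed
qed

text \<open>
Pushing \<open>X_w\<close> forward along an arc from \<open>v\<close> to \<open>w\<close> yields the boundary paths that start with this arc.
\<close>

lemma alpha_arc_indicator:
  assumes "e \<in> arcs G"
  shows "alpha G (of_path [e]) (indicator (Cyl G (head G e) [])) = indicator (Cyl G (tail G e) [e])"
proof
  fix \<kappa>
  have w: "awalk (tail G e) [e] (head G e)" "[e] \<noteq> []" using assms by (simp_all add: awalk_simps)
  show "alpha G (of_path [e]) (indicator (Cyl G (head G e) [])) \<kappa> = indicator (Cyl G (tail G e) [e]) \<kappa>"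
  proof (cases "\<kappa> \<in> Xset G (of_path [e])")
    case True
    then have m: "moves (of_path [e]) \<kappa> (act (of_path [e]) \<kappa>)" by (rule Xset_imp_moves)
    then have a: "act (of_path [e]) \<kappa> \<in> Cyl G (head G e) []"
      unfolding moves_of_path_iff[OF w] by (simp add: Cyl_def)
    obtain \<eta> where \<eta>: "\<kappa> = prepend [e] \<eta>" using m unfolding moves_of_path_iff[OF w] by blast
    have "\<kappa> \<in> Cyl G (tail G e) [e]"
      using moves_in_bpaths(1)[OF m] unfolding Cyl_def \<eta> by simp
    then show ?thesis using True a by (simp add: alpha_apply)
  next
    case False
    have "\<kappa> \<notin> Cyl G (tail G e) [e]"
    proof
      assume *: "\<kappa> \<in> Cyl G (tail G e) [e]"
      then have \<kappa>: "\<kappa> \<in> bpaths G" "starts_with \<kappa> [e]" by (simp_all add: Cyl_def)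
      from starts_withE[OF \<kappa>] obtain \<zeta> where \<zeta>: "\<zeta> \<in> bpaths G" "\<kappa> = prepend [e] \<zeta>"
        "awalk (bsource G \<kappa>) [e] (bsource G \<zeta>)" .
      then have "moves (of_path [e]) \<kappa> \<zeta>" unfolding moves_of_path_iff[OF w] by (simp add: awalk_simps)
      then show False using False by (simp add: moves_iff)
    qed
    then show ?thesis using False by (simp add: alpha_def)
  qed
qed

lemma ideal_alpha:
  assumes I: "two_sided_ideal I R" and f: "f \<in> D0 G" "single [] f \<in> I"
    and t: "t \<in> carrier (FG G)" "t \<noteq> []"
  shows "single [] (alpha G t f) \<in> I"
proof -
  have it: "inv\<^bsub>FG G\<^esub> t \<in> carrier (FG G)" "inv\<^bsub>FG G\<^esub> t \<noteq> []"
    using t F.inv_eq_1_iff[OF t(1)] by simp_all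
  show ?thesis
    using I f(2) single_Xset_in_R[OF t(2)] single_Xset_in_R[OF it(2)]
    unfolding conjugate_single[OF t f(1), symmetric] two_sided_ideal_iff by blast
qed

lemma ideal_sum:
  assumes I: "two_sided_ideal I R" and A: "finite A" "\<And>i. i \<in> A \<Longrightarrow> single [] (f i) \<in> I"
  shows "single [] (\<Sum>i\<in>A. f i) \<in> I"
  using A
proof (induction A rule: finite_induct)
  case empty
  have "single [] (\<Sum>i\<in>{}. f i) = (\<lambda>t. 0)" by (rule ext) (simp only: single_def sum.empty if_cancel)
  moreover have "(\<lambda>t. 0) \<in> I" using I unfolding two_sided_ideal_iff by blast
  ultimately show ?case by (simp only:)
next
  case (insert i A)
  have "single [] (f i + (\<Sum>i\<in>A. f i)) = (\<lambda>t. single [] (f i) t + single [] (\<Sum>i\<in>A. f i) t)"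
    by (rule ext) (simp add: single_def)
  moreover have "single [] (f i) \<in> I" "single [] (\<Sum>i\<in>A. f i) \<in> I" using insert by blast+
  ultimately have "single [] (f i + (\<Sum>i\<in>A. f i)) \<in> I"
    using I unfolding two_sided_ideal_iff by simp
  then show ?case unfolding sum.insert[OF insert.hyps(1,2)] .
qed

text \<open>
Multiplication by \<open>1_{t\<^sup>-\<^sup>1} \<delta>_{t\<^sup>-\<^sup>1}\<close> on the right shifts the coefficient at \<open>t\<close> to the neutral element.
\<close>

lemma ideal_nonzero_at_identity:
  assumes I: "two_sided_ideal I R" and x: "x \<in> I" "x \<noteq> (\<lambda>t. 0)"
  obtains b \<xi> where "b \<in> I" "b [] \<xi> \<noteq> 0"
proof -
  have xR: "x \<in> carrier R" using I x(1) unfolding two_sided_ideal_iff by blast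
  obtain t \<xi> where nz: "x t \<xi> \<noteq> 0" using x(2) by (auto simp: fun_eq_iff)
  show ?thesis
  proof (cases "t = []")
    case True
    then show ?thesis using that x(1) nz by blast
  next
    case t: False
    let ?i = "inv\<^bsub>FG G\<^esub> t"
    have m: "moves t \<xi> (act t \<xi>)" using R_support[OF xR nz] .
    then have tc: "t \<in> carrier (FG G)" by (rule moves_closed)
    have it: "?i \<in> carrier (FG G)" "?i \<noteq> []"
      using t tc F.inv_eq_1_iff[OF tc] by simp_all
    have sR: "single ?i (indicator (Xset G ?i)) \<in> carrier R" by (rule single_Xset_in_R[OF it(2)])
    have "(x \<otimes>\<^bsub>R\<^esub> single ?i (indicator (Xset G ?i))) [] \<xi> = x t \<xi> * indicator (Xset G ?i) (act t \<xi>)"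
      using R_mult_single[OF xR sR it(1), of "[]" \<xi>] F.one_closed tc by simp
    also have "act t \<xi> \<in> Xset G ?i" using moves_sym[OF m] by (simp add: moves_iff)
    then have "x t \<xi> * indicator (Xset G ?i) (act t \<xi>) = x t \<xi>" by simp
    finally have "(x \<otimes>\<^bsub>R\<^esub> single ?i (indicator (Xset G ?i))) [] \<xi> \<noteq> 0" using nz by simp
    moreover have "x \<otimes>\<^bsub>R\<^esub> single ?i (indicator (Xset G ?i)) \<in> I"
      using I x(1) sR unfolding two_sided_ideal_iff by blast
    ultimately show ?thesis using that by blast
  qed
qed

lemma R_cut_apply:
  assumes b: "b \<in> carrier R" and f: "f \<in> D0 G" and g: "g \<in> D0 G" and u: "u \<in> carrier (FG G)"
  shows "((single [] f \<otimes>\<^bsub>R\<^esub> b) \<otimes>\<^bsub>R\<^esub> single [] g) u \<kappa> = f \<kappa> * b u \<kappa> * g (act u \<kappa>)"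
proof -
  have n: "[] \<in> carrier (FG G)" using F.one_closed by simp
  have i: "inv\<^bsub>FG G\<^esub> [] = []" using F.inv_one by simp
  have R: "single [] f \<in> carrier R" "single [] g \<in> carrier R"
    using f g by (auto intro: single_Nil_in_R)
  have "((single [] f \<otimes>\<^bsub>R\<^esub> b) \<otimes>\<^bsub>R\<^esub> single [] g) u \<kappa> = (single [] f \<otimes>\<^bsub>R\<^esub> b) u \<kappa> * g (act u \<kappa>)"
    using R_mult_single[OF R_mult_closed[OF R(1) b] R(2) n u, of \<kappa>] u i by simp
  also have "(single [] f \<otimes>\<^bsub>R\<^esub> b) u \<kappa> = f \<kappa> * b u (act [] \<kappa>)"
    using R_single_mult[OF R(1) b n u, of \<kappa>] i by simp
  also have "\<dots> = f \<kappa> * b u \<kappa>"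
    using act_moves[OF moves_one] D0_vanishes[OF f] by (cases "f \<kappa> = 0") auto
  finally show ?thesis .
qed

text \<open>
The step that uses condition (L). Near a path \<open>\<eta>\<close> fixed by no word of the support other than \<open>1\<close>,
cutting down with a small cylinder set \<open>Z\<close> removes all terms \<open>b_t \<delta>_t\<close> with \<open>t \<noteq> 1\<close>, since these
words move \<open>Z\<close> off itself.
\<close>

lemma ideal_contains_vunit:
  assumes L: "condition_L G" and I: "two_sided_ideal I (R :: ('b word \<Rightarrow> ('a, 'b) bpath \<Rightarrow> 'k::field) ring)"
    and ne: "I \<noteq> {\<lambda>t. 0}"
  obtains w where "w \<in> verts G" "vunit w \<in> I"
proof -
  obtain x where "x \<in> I" "x \<noteq> (\<lambda>t. 0)" using ne I unfolding two_sided_ideal_iff by blast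
  with I obtain b \<xi> where b: "b \<in> I" "b [] \<xi> \<noteq> 0" by (rule ideal_nonzero_at_identity)
  have bR: "b \<in> carrier R" using I b(1) unfolding two_sided_ideal_iff by blast
  then have b0: "b [] \<in> D0 G" by (simp add: in_R_iff)
  have \<xi>: "\<xi> \<in> bpaths G" using D0_vanishes[OF b0 b(2)] .
  obtain n where n: "\<And>\<xi> \<eta>. \<xi> \<in> bpaths G \<Longrightarrow> \<eta> \<in> bpaths G \<Longrightarrow> agree G n \<xi> \<eta> \<Longrightarrow> b [] \<xi> = b [] \<eta>"
    using D0_locally_constant[OF b0] by blast
  let ?T = "{t. b t \<noteq> 0} - {[]}"
  have T: "finite ?T" "[] \<notin> ?T" using R_finite[OF bR] by auto
  obtain \<eta> where \<eta>: "\<eta> \<in> bpaths G" "agree G n \<xi> \<eta>" "\<forall>t\<in>?T. \<not> moves t \<eta> \<eta>"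
    using L T \<xi> by (rule ex_near_not_fixed)
  obtain m where m: "\<forall>t\<in>?T. \<forall>\<kappa> \<kappa>'. agree G m \<eta> \<kappa> \<longrightarrow> moves t \<kappa> \<kappa>' \<longrightarrow> \<not> agree G m \<eta> \<kappa>'"
    using not_fixed_open_finite[OF \<eta>(1) T \<eta>(3)] by (elim exE)
  define N where "N = max n m"
  define Z where "Z = Cyl G (bsource G \<eta>) (initial N \<eta>)"
  have Z: "\<kappa> \<in> Z \<longleftrightarrow> \<kappa> \<in> bpaths G \<and> agree G N \<eta> \<kappa>" for \<kappa>
    using agree_eq_Cyl[OF \<eta>(1), of N] unfolding Z_def by blast
  define c where "c = b [] \<xi>"
  have c: "b [] \<kappa> = c" if "\<kappa> \<in> Z" for \<kappa>
  proof -
    have "agree G n \<eta> \<kappa>" using that Z agree_mono unfolding N_def by (meson max.cobounded1)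
    then show ?thesis unfolding c_def using n[OF \<xi>] that Z agree_trans[OF \<eta>(2)] by metis
  qed
  have iZ: "(indicator Z :: ('a, 'b) bpath \<Rightarrow> 'k) \<in> D0 G" unfolding Z_def by (rule indicator_Cyl_in_D0)
  \<comment> \<open>The factor \<open>1 / c\<close> normalises the constant value of \<open>b 1\<close> on \<open>Z\<close> to \<open>1\<close>.\<close>
  let ?f = "fscale (1 / c) (indicator Z) :: ('a, 'b) bpath \<Rightarrow> 'k"
  have fD: "?f \<in> D0 G" by (rule D0_scale[OF iZ])
  let ?y = "(single [] ?f \<otimes>\<^bsub>R\<^esub> b) \<otimes>\<^bsub>R\<^esub> single [] (indicator Z)"
  have R: "single [] ?f \<in> carrier R" "single [] (indicator Z :: ('a, 'b) bpath \<Rightarrow> 'k) \<in> carrier R"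
    using fD iZ by (auto intro: single_Nil_in_R)
  have yI: "?y \<in> I" using I b(1) R unfolding two_sided_ideal_iff by blast
  then have yR: "?y \<in> carrier R" using I unfolding two_sided_ideal_iff by blast
  have "?y = single [] (indicator Z)"
  proof (intro ext)
    fix u \<kappa>
    show "?y u \<kappa> = single [] (indicator Z) u \<kappa>"
    proof (cases "u \<in> carrier (FG G)")
      case False
      then show ?thesis using yR R(2) R_support_closed by (metis (no_types))
    next
      case u: True
      have y: "?y u \<kappa> = ?f \<kappa> * b u \<kappa> * indicator Z (act u \<kappa>)" by (rule R_cut_apply[OF bR fD iZ u])
      show ?thesis
      proof (cases "u = []")
        case True
        show ?thesis
        proof (cases "\<kappa> \<in> Z")
          case \<kappa>: True
          have "act [] \<kappa> = \<kappa>" using \<kappa> Z act_moves[OF moves_one] by simp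
          moreover have "c \<noteq> 0" using b(2) by (simp add: c_def)
          ultimately show ?thesis using \<kappa> c[OF \<kappa>] y True by (simp add: single_def fscale_def)
        next
          case False
          then show ?thesis using y True by (simp add: single_def fscale_def)
        qed
      next
        case False
        have "?f \<kappa> * b u \<kappa> * indicator Z (act u \<kappa>) = 0"
        proof (rule ccontr)
          assume nz: "\<not> ?thesis"
          then have "b u \<kappa> \<noteq> 0" "\<kappa> \<in> Z" "act u \<kappa> \<in> Z" by (auto simp: fscale_def indicator_def split: if_splits)
          then have "u \<in> ?T" "moves u \<kappa> (act u \<kappa>)" "agree G N \<eta> \<kappa>" "agree G N \<eta> (act u \<kappa>)"
            using False R_support[OF bR] Z by auto
          moreover have "m \<le> N" by (simp add: N_def)
          ultimately show False using m agree_mono by blast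
        qed
        then show ?thesis using y False by (simp add: single_def)
      qed
    qed
  qed
  then have ZI: "single [] (indicator Z) \<in> I" using yI by simp
  \<comment> \<open>The cylinder set \<open>Z\<close> is defined by the path \<open>?p\<close>, whose endpoint is the vertex sought.\<close>
  let ?p = "initial N \<eta>"
  have "\<eta> \<in> Z" using Z \<eta>(1) by simp
  then have "starts_with \<eta> ?p" unfolding Z_def by (simp add: Cyl_def)
  from starts_withE[OF \<eta>(1) this] obtain \<zeta> where \<zeta>: "\<zeta> \<in> bpaths G" "\<eta> = prepend ?p \<zeta>"
    "awalk (bsource G \<eta>) ?p (bsource G \<zeta>)" .
  show ?thesis
  proof (cases "?p = []")
    case True
    then have "vunit (bsource G \<eta>) \<in> I" using ZI by (simp add: vunit_def Z_def)
    then show ?thesis using that bsource_in_verts[OF \<eta>(1)] by blast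
  next
    case False
    let ?w = "bsource G \<zeta>"
    have t: "of_path ?p \<in> carrier (FG G)" "of_path ?p \<noteq> []"
      using of_path_awalk_closed[OF \<zeta>(3)] False by (simp_all add: of_path_def)
    then have it: "inv\<^bsub>FG G\<^esub> (of_path ?p) \<in> carrier (FG G)" "inv\<^bsub>FG G\<^esub> (of_path ?p) \<noteq> []"
      using F.inv_eq_1_iff[OF t(1)] by simp_all
    have "prepend ?p \<kappa> \<in> Z" if "\<kappa> \<in> Cyl G ?w []" for \<kappa>
    proof -
      have \<kappa>: "\<kappa> \<in> bpaths G" "awalk (bsource G \<eta>) ?p (bsource G \<kappa>)" using that \<zeta>(3) by (simp_all add: Cyl_def)
      show ?thesis unfolding Z_def Cyl_def
        using prepend_in_bpaths[OF \<kappa>(2,1)] bsource_prepend[OF \<kappa>(2)] starts_with_prepend[of ?p \<kappa>] by simp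
    qed
    then have eq: "alpha G (inv\<^bsub>FG G\<^esub> (of_path ?p)) (indicator Z :: ('a, 'b) bpath \<Rightarrow> 'k) = indicator (Cyl G ?w [])"
      by (rule alpha_inv_of_path_indicator[OF \<zeta>(3) False])
    have "single [] (indicator (Cyl G ?w [])) \<in> I"
      using ideal_alpha[OF I iZ ZI it] unfolding eq .
    then show ?thesis using that bsource_in_verts[OF \<zeta>(1)] by (simp add: vunit_def)
  qed
qed

lemma ideal_vertices_hereditary:
  assumes I: "two_sided_ideal I (R :: ('b word \<Rightarrow> ('a, 'b) bpath \<Rightarrow> 'k::field) ring)"
  shows "hereditary G {v \<in> verts G. vunit v \<in> I}"
  unfolding hereditary_def
proof (intro conjI ballI impI)
  fix e assume e: "e \<in> arcs G" "tail G e \<in> {v \<in> verts G. vunit v \<in> I}"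
  have w: "awalk (tail G e) [e] (head G e)" "[e] \<noteq> []" using e(1) by (simp_all add: awalk_simps)
  have t: "of_path [e] \<in> carrier (FG G)" "of_path [e] \<noteq> []"
    using of_path_awalk_closed[OF w(1)] by (simp_all add: of_path_def)
  then have it: "inv\<^bsub>FG G\<^esub> (of_path [e]) \<in> carrier (FG G)" "inv\<^bsub>FG G\<^esub> (of_path [e]) \<noteq> []"
    using F.inv_eq_1_iff[OF t(1)] by simp_all
  have "prepend [e] \<kappa> \<in> Cyl G (tail G e) []" if "\<kappa> \<in> Cyl G (head G e) []" for \<kappa>
    using that prepend_arc_in_bpaths[of \<kappa> e] e(1) by (simp add: Cyl_def)
  then have eq: "alpha G (inv\<^bsub>FG G\<^esub> (of_path [e])) (indicator (Cyl G (tail G e) []) :: ('a, 'b) bpath \<Rightarrow> 'k) =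
      indicator (Cyl G (head G e) [])"
    by (rule alpha_inv_of_path_indicator[OF w])
  have "single [] (indicator (Cyl G (tail G e) [])) \<in> I" using e(2) by (simp add: vunit_def)
  from ideal_alpha[OF I indicator_Cyl_in_D0 this it]
  have "single [] (indicator (Cyl G (head G e) [])) \<in> I" unfolding eq .
  then show "head G e \<in> {v \<in> verts G. vunit v \<in> I}" using e(1) by (simp add: vunit_def)
qed blast

text \<open>
If \<open>v\<close> emits finitely many arcs and at least one, then \<open>X_v\<close> is the finite disjoint union of the
cylinder sets of these arcs, and the indicator of each is obtained from \<open>1_{r(e)}\<close> by conjugation.
\<close>

lemma ideal_vertices_saturated:
  assumes I: "two_sided_ideal I (R :: ('b word \<Rightarrow> ('a, 'b) bpath \<Rightarrow> 'k::field) ring)"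
  shows "saturated G {v \<in> verts G. vunit v \<in> I}"
  unfolding saturated_def
proof (intro ballI impI)
  fix v assume v: "v \<in> verts G" "out_arcs G v \<noteq> {} \<and> finite (out_arcs G v)"
    "head G ` out_arcs G v \<subseteq> {v \<in> verts G. vunit v \<in> I}"
  have "single [] (indicator (Cyl G v [e])) \<in> I" if e: "e \<in> out_arcs G v" for e
  proof -
    have ea: "e \<in> arcs G" "tail G e = v" using e by auto
    have "of_path [e] \<in> carrier (FG G)" "of_path [e] \<noteq> []"
      using of_path_closed[of "[e]" "arcs G"] ea by (simp_all add: of_path_def)
    moreover have "vunit (head G e) \<in> I" using v(3) e by blast
    ultimately have "single [] (alpha G (of_path [e]) (indicator (Cyl G (head G e) []))) \<in> I"
      unfolding vunit_def by (intro ideal_alpha[OF I indicator_Cyl_in_D0])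
    then show ?thesis unfolding alpha_arc_indicator[OF ea(1)] ea(2) .
  qed
  then have "single [] (\<Sum>e\<in>out_arcs G v. indicator (Cyl G v [e])) \<in> I"
    using v(2) by (intro ideal_sum[OF I]) auto
  moreover have "(\<Sum>e\<in>out_arcs G v. indicator (Cyl G v [e])) = (indicator (Cyl G v []) :: ('a, 'b) bpath \<Rightarrow> 'k)"
  proof
    fix \<kappa>
    show "(\<Sum>e\<in>out_arcs G v. indicator (Cyl G v [e])) \<kappa> = (indicator (Cyl G v []) \<kappa> :: 'k)"
    proof (cases "\<kappa> \<in> Cyl G v []")
      case True
      then have \<kappa>: "\<kappa> \<in> bpaths G" "bsource G \<kappa> = v" by (simp_all add: Cyl_def)
      then have "\<not> sink G (bsource G \<kappa>)" using v(2) by (simp add: sink_def)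
      from bpaths_step[OF \<kappa>(1) this] obtain f \<zeta> where f: "\<kappa> = prepend [f] \<zeta>" "f \<in> arcs G" "tail G f = bsource G \<kappa>"
        by blast
      have "indicator (Cyl G v [e]) \<kappa> = (if e = f then 1 else 0 :: 'k)" for e
        using \<kappa> unfolding f(1) Cyl_def by (auto simp: indicator_def)
      then have "(\<Sum>e\<in>out_arcs G v. indicator (Cyl G v [e]) \<kappa> :: 'k) = (\<Sum>e\<in>out_arcs G v. if e = f then 1 else 0)"
        by simp
      also have "\<dots> = 1" using v(2) f \<kappa>(2) by (simp add: sum.delta)
      finally show ?thesis using True by (simp add: sum_fun_apply)
    next
      case False
      then have "\<kappa> \<notin> Cyl G v [e]" for e by (auto simp: Cyl_def)
      then show ?thesis using False by (simp add: sum_fun_apply)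
    qed
  qed
  ultimately show "v \<in> {v \<in> verts G. vunit v \<in> I}" using v(1) by (simp add: vunit_def)
qed

text \<open>
The coefficients of an element involve finitely many sources altogether, and the sum of the
corresponding idempotents \<open>1_v\<close> is a left unit for the element.
\<close>

lemma ideal_with_all_vunits:
  assumes I: "two_sided_ideal I (R :: ('b word \<Rightarrow> ('a, 'b) bpath \<Rightarrow> 'k::field) ring)"
    and all: "\<And>v. v \<in> verts G \<Longrightarrow> vunit v \<in> I"
  shows "I = carrier R"
proof
  show "I \<subseteq> carrier R" using I unfolding two_sided_ideal_iff by blast
  show "carrier R \<subseteq> I"
  proof
    fix a :: "'b word \<Rightarrow> ('a, 'b) bpath \<Rightarrow> 'k" assume a: "a \<in> carrier R"
    have "\<exists>S. finite S \<and> S \<subseteq> verts G \<and> (\<forall>\<xi>. a t \<xi> \<noteq> 0 \<longrightarrow> bsource G \<xi> \<in> S)" for t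
    proof -
      have "a t \<in> D0 G" using a by (simp add: in_R_iff)
      from D0_finitely_many_sources[OF this] show ?thesis by metis
    qed
    then obtain S where S: "\<And>t. finite (S t)" "\<And>t. S t \<subseteq> verts G" "\<And>t \<xi>. a t \<xi> \<noteq> 0 \<Longrightarrow> bsource G \<xi> \<in> S t"
      by metis
    let ?S = "\<Union>t\<in>{t. a t \<noteq> 0}. S t"
    let ?f = "\<Sum>v\<in>?S. indicator (Cyl G v []) :: ('a, 'b) bpath \<Rightarrow> 'k"
    have fin: "finite ?S" using R_finite[OF a] S(1) by blast
    have eI: "single [] ?f \<in> I"
    proof (rule ideal_sum[OF I fin])
      fix v assume "v \<in> ?S"
      then have "v \<in> verts G" using S(2) by blast
      from all[OF this] show "single [] (indicator (Cyl G v [])) \<in> I" unfolding vunit_def .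
    qed
    have fD: "?f \<in> D0 G" by (intro D0_sum indicator_Cyl_in_D0)
    have eR: "single [] ?f \<in> carrier R" by (rule single_Nil_in_R[OF fD])
    have n: "[] \<in> carrier (FG G)" using F.one_closed by simp
    have i: "inv\<^bsub>FG G\<^esub> [] = []" using F.inv_one by simp
    have "single [] ?f \<otimes>\<^bsub>R\<^esub> a = a"
    proof (intro ext)
      fix u \<kappa>
      show "(single [] ?f \<otimes>\<^bsub>R\<^esub> a) u \<kappa> = a u \<kappa>"
      proof (cases "u \<in> carrier (FG G)")
        case False
        then show ?thesis using a R_mult_closed[OF eR a] R_support_closed by (metis (no_types))
      next
        case u: True
        have "(single [] ?f \<otimes>\<^bsub>R\<^esub> a) u \<kappa> = ?f \<kappa> * a u (act [] \<kappa>)"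
          using R_single_mult[OF eR a n u, of \<kappa>] i by simp
        also have "\<dots> = a u \<kappa>"
        proof (cases "\<kappa> \<in> bpaths G")
          case True
          have act: "act [] \<kappa> = \<kappa>" by (rule act_moves[OF moves_one[OF True]])
          have "indicator (Cyl G v []) \<kappa> = (if bsource G \<kappa> = v then 1 else 0 :: 'k)" for v
            using True by (auto simp: Cyl_def indicator_def)
          then have "?f \<kappa> = (\<Sum>v\<in>?S. if bsource G \<kappa> = v then 1 else 0)" by (simp only: sum_fun_apply)
          also have "\<dots> = (if bsource G \<kappa> \<in> ?S then 1 else 0)" using fin by (rule sum.delta')
          finally have f: "?f \<kappa> = (if bsource G \<kappa> \<in> ?S then 1 else 0)" .
          have "bsource G \<kappa> \<in> ?S" if nz: "a u \<kappa> \<noteq> 0"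
          proof -
            have "a u \<noteq> 0" using nz by auto
            then show ?thesis using S(3)[OF nz] by blast
          qed
          then show ?thesis unfolding f act by (cases "a u \<kappa> = 0") simp_all
        next
          case False
          then have "?f \<kappa> = 0" "a u \<kappa> = 0" using D0_vanishes[OF fD] D0_vanishes[of "a u"] a by (auto simp: in_R_iff)
          then show ?thesis by simp
        qed
        finally show ?thesis .
      qed
    qed
    moreover have "single [] ?f \<otimes>\<^bsub>R\<^esub> a \<in> I" using I eI a unfolding two_sided_ideal_iff by blast
    ultimately show "a \<in> I" by simp
  qed
qed

lemma condition_L_hs_trivial_imp_simple:
  assumes L: "condition_L G" and hs: "\<And>H. hereditary G H \<Longrightarrow> saturated G H \<Longrightarrow> H = {} \<or> H = verts G"
  shows "simple_ring (R :: ('b word \<Rightarrow> ('a, 'b) bpath \<Rightarrow> 'k::field) ring)"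
  unfolding simple_ring_iff
proof (intro allI impI)
  fix I :: "('b word \<Rightarrow> ('a, 'b) bpath \<Rightarrow> 'k) set" assume I: "two_sided_ideal I R"
  show "I = {\<lambda>t. 0} \<or> I = carrier R"
  proof (cases "I = {\<lambda>t. 0}")
    case False
    from ideal_contains_vunit[OF L I False] have "{v \<in> verts G. vunit v \<in> I} \<noteq> {}" by blast
    then have "{v \<in> verts G. vunit v \<in> I} = verts G"
      using hs[OF ideal_vertices_hereditary[OF I] ideal_vertices_saturated[OF I]] by blast
    then show ?thesis using ideal_with_all_vunits[OF I] by blast
  qed simp
qed

end

section \<open>Simplicity\<close>

theorem theorem3p5:
  fixes G :: "('v, 'e) pre_digraph"
  assumes "wf_digraph G"
  shows "simple_ring (graph_skew_ring G :: ('e word \<Rightarrow> ('v, 'e) bpath \<Rightarrow> 'k::field) ring) \<longleftrightarrow>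
    condition_L G \<and> {H. hereditary G H \<and> saturated G H} = {{}, verts G}"
proof -
  interpret wf_digraph G by (rule assms)
  have "{H. hereditary G H \<and> saturated G H} = {{}, verts G} \<longleftrightarrow>
    (\<forall>H. hereditary G H \<longrightarrow> saturated G H \<longrightarrow> H = {} \<or> H = verts G)"
    using hs_trivial_sets by blast
  then show ?thesis
    using simple_imp_condition_L[where 'k = 'k] simple_imp_hs_trivial[where 'k = 'k]
      condition_L_hs_trivial_imp_simple[where 'k = 'k] by blast
qed

end
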